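(* Let $\lambda\in X^+(\infty)$. Then there are $\mathbf U(\infty)$-module isomorphisms $$L(\lambda)\cong\varinjlim_n L(\lambda_{[-n,n]})\cong M(\lambda)/I(\lambda).$$
   Context: $v$ indeterminate, $[t]=\frac{v^t-v^{-t}}{v-v^{-1}}$, $[m]^!=[1]\cdots[m]$. $\mathbf U(\infty)$ is the $\mathbb Q(v)$-algebra with generators $E_i,F_i,K_i,K_i^{-1}$ ($i\in\mathbb Z$) and relations: $K_iK_j=K_jK_i$, $K_iK_i^{-1}=1$; $K_iE_j=v^{\delta_{i,j}-\delta_{i,j+1}}E_jK_i$; $K_iF_j=v^{\delta_{i,j+1}-\delta_{i,j}}F_jK_i$; $E_iE_j=E_jE_i$, $F_iF_j=F_jF_i$ if $|i-j|>1$; $E_iF_j-F_jE_i=\delta_{i,j}\frac{\widetilde K_i-\widetilde K_i^{-1}}{v-v^{-1}}$, $\widetilde K_i=K_iK_{i+1}^{-1}$; $E_i^2E_j-(v+v^{-1})E_iE_jE_i+E_jE_i^2=0$ and likewise for $F$ if $|i-j|=1$. $\mathbf U^-(\infty)$ is the subalgebra generated by the $F_i$; $F_i^{(m)}=F_i^m/[m]^!$. For $n\ge1$, $\mathbf U([-n,n])$ is the subalgebra generated by $E_i,F_i$ ($-n\le i<n$) and $K_j^{\pm1}$ ($-n\le j\le n$). $X^+(\infty)$ is the set of integer sequences $(\lambda_i)_{i\in\mathbb Z}$ with $\lambda_i\ge\lambda_{i+1}$ for all $i$. For $\lambda\in X^+(\infty)$: $M(\lambda)=\mathbf U(\infty)/(\sum_i\mathbf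 U(\infty)E_i+\sum_i\mathbf U(\infty)(K_i-v^{\lambda_i}))=\mathbf U^-(\infty)1_\lambda$, where $1_\lambda$ is the image of $1$; $M(\lambda)$ has a unique maximal submodule and $L(\lambda)$ is its irreducible quotient. $I(\lambda)=\sum_{i\in\mathbb Z}\mathbf U^-(\infty)F_i^{(\lambda_i-\lambda_{i+1}+1)}1_\lambda$. With $\lambda_{[-n,n]}=(\lambda_i)_{-n\le i\le n}$, let $I_n(\lambda_{[-n,n]})$ be the left ideal of $\mathbf U([-n,n])$ generated by $E_i$, $F_i^{\lambda_i-\lambda_{i+1}+1}$ ($-n\le i<n$) and $K_j-v^{\lambda_j}$ ($-n\le j\le n$), and $L(\lambda_{[-n,n]})=\mathbf U([-n,n])/I_n(\lambda_{[-n,n]})$ (the finite-dimensional irreducible $\mathbf U([-n,n])$-module of highest weight $\lambda_{[-n,n]}$). Since $I_n\subseteq I_{n+1}$, the maps $u+I_n\mapsto u+I_{n+1}$ ($u\in\mathbf U([-n,n])$) form a direct system, whose direct limit $\varinjlim_nL(\lambda_{[-n,n]})$ is naturally a $\mathbf U(\infty)$-module. *)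

theory Defs
  imports "HOL-Computational_Algebra.Polynomial" "HOL-Computational_Algebra.Fraction_Field"
begin

type_synonym qf = "rat poly fract"

definition qv :: qf where "qv = Fract [:0, 1:] 1"

definition qint :: "int \<Rightarrow> qf" where
  "qint t = (qv powi t - qv powi (-t)) / (qv - inverse qv)"

definition qfact :: "nat \<Rightarrow> qf" where
  "qfact m = (\<Prod>t\<in>{1..m}. qint (int t))"

datatype gen = E int | F int | K int | Kinv int

type_synonym fa = "gen list \<Rightarrow> qf"

definition FA :: "fa set" where
  "FA = {p. finite {w. p w \<noteq> 0}}"

definition fzero :: fa where "fzero = (\<lambda>_. 0)"
definition fadd :: "fa \<Rightarrow> fa \<Rightarrow> fa" where "fadd p q = (\<lambda>w. p w + q w)"
definition fscale :: "qf \<Rightarrow> fa \<Rightarrow> fa" where "fscale c p = (\<lambda>w. c * p w)"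
definition fsub :: "fa \<Rightarrow> fa \<Rightarrow> fa" where "fsub p q = (\<lambda>w. p w - q w)"
definition fmul :: "fa \<Rightarrow> fa \<Rightarrow> fa" where
  "fmul p q = (\<lambda>w. \<Sum>i\<in>{..length w}. p (take i w) * q (drop i w))"
definition mon :: "gen list \<Rightarrow> fa" where "mon w = (\<lambda>u. if u = w then 1 else 0)"
definition cst :: "qf \<Rightarrow> fa" where "cst c = fscale c (mon [])"

definition lideal :: "fa set \<Rightarrow> fa set \<Rightarrow> bool" where
  "lideal R I \<longleftrightarrow> I \<subseteq> R \<and> fzero \<in> I \<and> (\<forall>x\<in>I. \<forall>y\<in>I. fadd x y \<in> I)
     \<and> (\<forall>a\<in>R. \<forall>x\<in>I. fmul a x \<in> I)"

definition tideal :: "fa set \<Rightarrow> bool" where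
  "tideal I \<longleftrightarrow> lideal FA I \<and> (\<forall>a\<in>FA. \<forall>x\<in>I. fmul x a \<in> I)"

definition lgen :: "fa set \<Rightarrow> fa set \<Rightarrow> fa set" where
  "lgen R S = \<Inter>{I. lideal R I \<and> S \<subseteq> I}"

definition tgen :: "fa set \<Rightarrow> fa set" where
  "tgen S = \<Inter>{I. tideal I \<and> S \<subseteq> I}"

definition vexp :: "int \<Rightarrow> qf" where "vexp k = qv powi k"

definition delta :: "int \<Rightarrow> int \<Rightarrow> int" where "delta i j = (if i = j then 1 else 0)"

definition Rels :: "fa set" where
  "Rels =
     {fsub (mon [K i, K j]) (mon [K j, K i]) | i j. True}
   \<union> {fsub (mon [K i, Kinv i]) (mon []) | i. True}
   \<union> {fsub (mon [Kinv i, K i]) (mon []) | i. True}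
   \<union> {fsub (mon [K i, E j]) (fscale (vexp (delta i j - delta i (j+1))) (mon [E j, K i])) | i j. True}
   \<union> {fsub (mon [K i, F j]) (fscale (vexp (delta i (j+1) - delta i j)) (mon [F j, K i])) | i j. True}
   \<union> {fsub (mon [E i, E j]) (mon [E j, E i]) | i j. \<bar>i - j\<bar> > 1}
   \<union> {fsub (mon [F i, F j]) (mon [F j, F i]) | i j. \<bar>i - j\<bar> > 1}
   \<union> {fsub (fsub (mon [E i, F j]) (mon [F j, E i]))
          (fscale (of_int (delta i j) / (qv - inverse qv)) (fsub (mon [K i, Kinv (i+1)]) (mon [K (i+1), Kinv i])))
       | i j. True}
   \<union> {fadd (fsub (mon [E i, E i, E j]) (fscale (qv + inverse qv) (mon [E i, E j, E i]))) (mon [E j, E i, E i])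
       | i j. \<bar>i - j\<bar> = 1}
   \<union> {fadd (fsub (mon [F i, F i, F j]) (fscale (qv + inverse qv) (mon [F i, F j, F i]))) (mon [F j, F i, F i])
       | i j. \<bar>i - j\<bar> = 1}"

text \<open>Two-sided ideal of defining relations: U(infinity) = FA / Jrel.\<close>
definition Jrel :: "fa set" where "Jrel = tgen Rels"

record 'm umod =
  carrier :: "'m set"
  mzero :: 'm
  madd :: "'m \<Rightarrow> 'm \<Rightarrow> 'm"
  mscale :: "qf \<Rightarrow> 'm \<Rightarrow> 'm"
  mact :: "gen \<Rightarrow> 'm \<Rightarrow> 'm"

definition umod_iso :: "('a, 'c) umod_scheme \<Rightarrow> ('b, 'd) umod_scheme \<Rightarrow> ('a \<Rightarrow> 'b) \<Rightarrow> bool" where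
  "umod_iso M N f \<longleftrightarrow> bij_betw f (carrier M) (carrier N)
     \<and> (\<forall>x\<in>carrier M. \<forall>y\<in>carrier M. f (madd M x y) = madd N (f x) (f y))
     \<and> (\<forall>c. \<forall>x\<in>carrier M. f (mscale M c x) = mscale N c (f x))
     \<and> (\<forall>g. \<forall>x\<in>carrier M. f (mact M g x) = mact N g (f x))"

definition umod_isomorphic :: "('a, 'c) umod_scheme \<Rightarrow> ('b, 'd) umod_scheme \<Rightarrow> bool" where
  "umod_isomorphic M N \<longleftrightarrow> (\<exists>f. umod_iso M N f)"

definition submod :: "('a, 'c) umod_scheme \<Rightarrow> 'a set \<Rightarrow> bool" where
  "submod M S \<longleftrightarrow> S \<subseteq> carrier M \<and> mzero M \<in> S
     \<and> (\<forall>x\<in>S. \<forall>y\<in>S. madd M x y \<in> S) \<and> (\<forall>c. \<forall>x\<in>S. mscale M c x \<in> S)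
     \<and> (\<forall>g. \<forall>x\<in>S. mact M g x \<in> S)"

definition maxsub :: "('a, 'c) umod_scheme \<Rightarrow> 'a set \<Rightarrow> bool" where
  "maxsub M S \<longleftrightarrow> submod M S \<and> S \<noteq> carrier M
     \<and> (\<forall>T. submod M T \<and> S \<subseteq> T \<and> T \<noteq> carrier M \<longrightarrow> T = S)"

definition mspan :: "('a, 'c) umod_scheme \<Rightarrow> 'a set \<Rightarrow> 'a set" where
  "mspan M X = \<Inter>{S. S \<subseteq> carrier M \<and> mzero M \<in> S \<and> (\<forall>x\<in>S. \<forall>y\<in>S. madd M x y \<in> S)
                      \<and> (\<forall>c. \<forall>x\<in>S. mscale M c x \<in> S) \<and> X \<subseteq> S}"

definition mcos :: "('a, 'c) umod_scheme \<Rightarrow> 'a set \<Rightarrow> 'a \<Rightarrow> 'a set" where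
  "mcos M S x = {madd M x s | s. s \<in> S}"

definition mrep :: "('a, 'c) umod_scheme \<Rightarrow> 'a set \<Rightarrow> 'a set \<Rightarrow> 'a" where
  "mrep M S X = (SOME x. x \<in> carrier M \<and> X = mcos M S x)"

definition qmod :: "('a, 'c) umod_scheme \<Rightarrow> 'a set \<Rightarrow> 'a set umod" where
  "qmod M S = \<lparr> carrier = mcos M S ` carrier M,
                mzero = mcos M S (mzero M),
                madd = (\<lambda>X Y. mcos M S (madd M (mrep M S X) (mrep M S Y))),
                mscale = (\<lambda>c X. mcos M S (mscale M c (mrep M S X))),
                mact = (\<lambda>g X. mcos M S (mact M g (mrep M S X))) \<rparr>"

definition actw :: "('a, 'c) umod_scheme \<Rightarrow> gen list \<Rightarrow> 'a \<Rightarrow> 'a" where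
  "actw M w x = foldr (mact M) w x"

definition regA :: "fa umod" where
  "regA = \<lparr> carrier = FA, mzero = fzero, madd = fadd, mscale = fscale,
            mact = (\<lambda>g p. fmul (mon [g]) p) \<rparr>"

definition dominant :: "(int \<Rightarrow> int) \<Rightarrow> bool" where
  "dominant lam \<longleftrightarrow> (\<forall>i. lam i \<ge> lam (i + 1))"

text \<open>Preimage in FA of the left ideal sum U E_i + sum U (K_i - v^lam_i) of U(infinity).\<close>
definition NM :: "(int \<Rightarrow> int) \<Rightarrow> fa set" where
  "NM lam = lgen FA (Jrel \<union> {mon [E i] | i. True} \<union> {fsub (mon [K i]) (cst (vexp (lam i))) | i. True})"

definition Mmod :: "(int \<Rightarrow> int) \<Rightarrow> fa set umod" where
  "Mmod lam = qmod regA (NM lam)"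

definition one_lam :: "(int \<Rightarrow> int) \<Rightarrow> fa set" where
  "one_lam lam = mcos regA (NM lam) (mon [])"

definition Lmod :: "(int \<Rightarrow> int) \<Rightarrow> fa set set umod" where
  "Lmod lam = qmod (Mmod lam) (THE S. maxsub (Mmod lam) S)"

definition Fdiv :: "('a, 'c) umod_scheme \<Rightarrow> int \<Rightarrow> nat \<Rightarrow> 'a \<Rightarrow> 'a" where
  "Fdiv M i m x = mscale M (inverse (qfact m)) (actw M (replicate m (F i)) x)"

text \<open>I(lambda) = sum_i U^-(infinity) F_i^(lam_i - lam_(i+1) + 1) 1_lambda; U^- is spanned by words in the F_j.\<close>
definition Iset :: "(int \<Rightarrow> int) \<Rightarrow> fa set set" where
  "Iset lam = mspan (Mmod lam)
     {actw (Mmod lam) w (Fdiv (Mmod lam) i (nat (lam i - lam (i + 1) + 1)) (one_lam lam)) | w i.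
        \<forall>g\<in>set w. \<exists>j. g = F j}"

definition MImod :: "(int \<Rightarrow> int) \<Rightarrow> fa set set umod" where
  "MImod lam = qmod (Mmod lam) (Iset lam)"

definition in_rng :: "nat \<Rightarrow> gen \<Rightarrow> bool" where
  "in_rng n g = (case g of
      E i \<Rightarrow> - int n \<le> i \<and> i < int n
    | F i \<Rightarrow> - int n \<le> i \<and> i < int n
    | K j \<Rightarrow> - int n \<le> j \<and> j \<le> int n
    | Kinv j \<Rightarrow> - int n \<le> j \<and> j \<le> int n)"

text \<open>Elements of FA involving only generators of U([-n,n]); their image in U(infinity) is U([-n,n]).\<close>
definition An :: "nat \<Rightarrow> fa set" where
  "An n = {p \<in> FA. \<forall>w. p w \<noteq> 0 \<longrightarrow> (\<forall>g\<in>set w. in_rng n g)}"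

text \<open>Preimage in An n of the left ideal I_n(lambda_[-n,n]) of U([-n,n]).\<close>
definition Pn :: "(int \<Rightarrow> int) \<Rightarrow> nat \<Rightarrow> fa set" where
  "Pn lam n = lgen (An n) ((Jrel \<inter> An n)
      \<union> {mon [E i] | i. - int n \<le> i \<and> i < int n}
      \<union> {mon (replicate (nat (lam i - lam (i + 1) + 1)) (F i)) | i. - int n \<le> i \<and> i < int n}
      \<union> {fsub (mon [K j]) (cst (vexp (lam j))) | j. - int n \<le> j \<and> j \<le> int n})"

definition cosn :: "(int \<Rightarrow> int) \<Rightarrow> nat \<Rightarrow> fa \<Rightarrow> fa set" where
  "cosn lam n x = {fadd x p | p. p \<in> Pn lam n}"

text \<open>Carrier of L(lambda_[-n,n]) = U([-n,n]) / I_n.\<close>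
definition Lcar :: "(int \<Rightarrow> int) \<Rightarrow> nat \<Rightarrow> fa set set" where
  "Lcar lam n = cosn lam n ` An n"

definition repn :: "(int \<Rightarrow> int) \<Rightarrow> nat \<Rightarrow> fa set \<Rightarrow> fa" where
  "repn lam n c = (SOME x. x \<in> An n \<and> c = cosn lam n x)"

definition phi :: "(int \<Rightarrow> int) \<Rightarrow> nat \<Rightarrow> nat \<Rightarrow> fa set \<Rightarrow> fa set" where
  "phi lam n k c = cosn lam k (repn lam n c)"

definition DLpairs :: "(int \<Rightarrow> int) \<Rightarrow> (nat \<times> fa set) set" where
  "DLpairs lam = {(n, c) | n c. 1 \<le> n \<and> c \<in> Lcar lam n}"

definition dl_eq :: "(int \<Rightarrow> int) \<Rightarrow> nat \<times> fa set \<Rightarrow> nat \<times> fa set \<Rightarrow> bool" where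
  "dl_eq lam p q \<longleftrightarrow> (\<exists>k. fst p \<le> k \<and> fst q \<le> k \<and> phi lam (fst p) k (snd p) = phi lam (fst q) k (snd q))"

definition dlcls :: "(int \<Rightarrow> int) \<Rightarrow> nat \<times> fa set \<Rightarrow> (nat \<times> fa set) set" where
  "dlcls lam p = {q \<in> DLpairs lam. dl_eq lam p q}"

definition dlrep :: "(int \<Rightarrow> int) \<Rightarrow> (nat \<times> fa set) set \<Rightarrow> nat \<times> fa set" where
  "dlrep lam X = (SOME p. p \<in> DLpairs lam \<and> X = dlcls lam p)"

text \<open>Smallest n such that the generator lies in U([-n,n]) (at least 1).\<close>
definition gidx :: "gen \<Rightarrow> nat" where
  "gidx g = (case g of E i \<Rightarrow> nat (max (i + 1) (- i)) | F i \<Rightarrow> nat (max (i + 1) (- i))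
                     | K j \<Rightarrow> nat \<bar>j\<bar> | Kinv j \<Rightarrow> nat \<bar>j\<bar>)"

definition DLmod :: "(int \<Rightarrow> int) \<Rightarrow> (nat \<times> fa set) set umod" where
  "DLmod lam = \<lparr>
     carrier = dlcls lam ` DLpairs lam,
     mzero = dlcls lam (1, cosn lam 1 fzero),
     madd = (\<lambda>X Y. let (n, c) = dlrep lam X; (m, d) = dlrep lam Y; k = max n m in
               dlcls lam (k, cosn lam k (fadd (repn lam k (phi lam n k c)) (repn lam k (phi lam m k d))))),
     mscale = (\<lambda>a X. let (n, c) = dlrep lam X in
               dlcls lam (n, cosn lam n (fscale a (repn lam n c)))),
     mact = (\<lambda>g X. let (n, c) = dlrep lam X; k = max n (max 1 (gidx g)) in
               dlcls lam (k, cosn lam k (fmul (mon [g]) (repn lam k (phi lam n k c))))) \<rparr>"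

end

theory Submission
  imports Defs "HOL-Library.Multiset"
begin

text \<open>
  Write \<open>N\<close> for the left ideal defining \<open>M(\<lambda>)\<close> and \<open>N'\<close> for the one generated in addition by the
  \<open>F\<^sub>i\<close>-powers. Since these powers are singular modulo \<open>N\<close>, the submodule \<open>I(\<lambda>)\<close> is \<open>N' / N\<close>, and since
  \<open>N'\<close> is the union of the \<open>I\<^sub>n\<close>, both \<open>M(\<lambda>)/I(\<lambda>)\<close> and the direct limit are \<open>U / N'\<close>. It remains to see that
  \<open>I(\<lambda>)\<close> is the largest proper submodule of \<open>M(\<lambda>)\<close>. A submodule not contained in it has, by separation of
  weights and minimality of degree, a weight vector that is singular and nonzero modulo \<open>I(\<lambda>)\<close>. Its weight
  \<open>\<mu>\<close> is dominant because the \<open>F\<^sub>i\<close> act locally nilpotently, and a quantum Casimir element of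
  \<open>U([m,n])\<close> commuting with \<open>F\<^sub>m, \<dots>, F\<^bsub>n-1\<^esub>\<close>, which acts on singular vectors of weight \<open>\<mu>\<close> by
  \<open>\<Sum>\<^sub>j v\<^bsup>2(\<mu>\<^sub>j - j)\<^esup>\<close>, forces \<open>\<mu> = \<lambda>\<close>, so the submodule is everything. That \<open>1 \<notin> N'\<close> is seen on
  functionals on the free Verma module of the quantum group without Serre relations.
\<close>

section \<open>Quantum integers\<close>

text \<open>No Casimir element exists for the whole index set Z, since the defining sum would be
  infinite. A homogeneous vector of \<open>U^-\<close>, however, contains only finitely many F_i,
  and a sum cut to an interval around their indices commutes with it. Applying this element to the
  vector in two ways, by moving it to the generator of weight \<lambda> and by using that the vector
  itself is singular of weight \<mu>, gives two sums of powers of v. As v is an indeterminate, the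
  exponents \<lambda>_j - j and \<mu>_j - j agree as multisets over the interval. At the smallest
  occurring index a one has \<mu>_a < \<lambda>_a, while dominance makes \<mu>_a - a the largest
  exponent of its side, so the vector must have degree zero.

  The other obstacle is collapse: even 0 \<noteq> 1 in U needs a concrete model. Passing to
  functionals turns the Serre relations into a condition on functions of words, and what has to be
  checked is that the generators preserve this condition.\<close>

lemma qv_power: "qv ^ n = Fract (monom 1 n) 1"
  by (induction n) (auto simp: qv_def monom_Suc One_fract_def)

lemma qv_nz [simp]: "qv \<noteq> 0"
  by (simp add: qv_def Zero_fract_def eq_fract)

lemma Fract_sum_1: "(\<Sum>i\<in>A. Fract (g i) 1) = Fract (\<Sum>i\<in>A. g i) (1 :: rat poly)"
  by (induction A rule: infinite_finite_induct) (auto simp: Zero_fract_def)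

text \<open>Powers of an indeterminate are linearly independent. This turns equal Casimir
  eigenvalues into equal multisets of exponents.\<close>

lemma sum_qv_powi_eq_card:
  assumes "finite A" "(\<Sum>i\<in>A. qv powi (f i)) = (\<Sum>i\<in>A. qv powi (g i))"
  shows "card {i\<in>A. f i = d} = card {i\<in>A. g i = d}"
proof -
  define h where "h i = max \<bar>f i\<bar> \<bar>g i\<bar>" for i
  \<comment> \<open>\<open>M\<close> bounds all exponents and \<open>d\<close> in absolute value, so
    multiplication by \<open>qv powi M\<close> makes both sums polynomials, and the coefficients in
    degree \<open>d + M\<close> can be compared.\<close>
  define M where "M = \<bar>d\<bar> + (\<Sum>i\<in>A. h i)"
  have hM: "h i \<le> M" if "i \<in> A" for i
  proof -
    have "h i \<le> sum h A" using assms(1) that by (intro member_le_sum) (auto simp: h_def)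
    then show ?thesis unfolding M_def by linarith
  qed
  have fM: "0 \<le> f i + M" and gM: "0 \<le> g i + M" if "i \<in> A" for i
    using hM[OF that] unfolding h_def by linarith+
  have "0 \<le> sum h A" by (intro sum_nonneg) (auto simp: h_def)
  then have dM: "0 \<le> d + M" unfolding M_def by linarith
  have *: "(\<Sum>i\<in>A. qv powi (t i)) * qv powi M = Fract (\<Sum>i\<in>A. monom 1 (nat (t i + M))) 1"
    if "\<And>i. i \<in> A \<Longrightarrow> 0 \<le> t i + M" for t
  proof -
    have "(\<Sum>i\<in>A. qv powi (t i)) * qv powi M = (\<Sum>i\<in>A. qv powi (t i + M))"
      by (simp add: sum_distrib_right power_int_add)
    also have "\<dots> = (\<Sum>i\<in>A. Fract (monom 1 (nat (t i + M))) 1)"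
      using that by (intro sum.cong) (auto simp: power_int_def qv_power)
    finally show ?thesis by (simp add: Fract_sum_1)
  qed
  have "(\<Sum>i\<in>A. monom (1::rat) (nat (f i + M))) = (\<Sum>i\<in>A. monom 1 (nat (g i + M)))"
    using *[of f, OF fM] *[of g, OF gM] assms(2) by (simp add: eq_fract)
  then have "coeff (\<Sum>i\<in>A. monom (1::rat) (nat (f i + M))) (nat (d + M)) =
     coeff (\<Sum>i\<in>A. monom 1 (nat (g i + M))) (nat (d + M))" by simp
  moreover have "coeff (\<Sum>i\<in>A. monom (1::rat) (nat (t i + M))) (nat (d + M)) = of_nat (card {i\<in>A. t i = d})"
    if "\<And>i. i \<in> A \<Longrightarrow> 0 \<le> t i + M" for t
  proof -
    have "(\<Sum>i\<in>A. coeff (monom (1::rat) (nat (t i + M))) (nat (d + M))) = (\<Sum>i\<in>A. if t i = d then 1 else 0)"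
      using that dM by (intro sum.cong) (auto simp: nat_eq_iff)
    then show ?thesis using assms(1)
      by (simp add: coeff_sum sum.If_cases Int_def)
  qed
  ultimately show ?thesis using fM gM by simp
qed

lemma qv_powi_inj: "qv powi a = qv powi b \<longleftrightarrow> a = b"
  using sum_qv_powi_eq_card[of "{()}" "\<lambda>_. a" "\<lambda>_. b" a] by (auto split: if_splits)

lemma vexp_nz [simp]: "vexp a \<noteq> 0"
  by (simp add: vexp_def)

lemma vexp_inj: "vexp a = vexp b \<longleftrightarrow> a = b"
  by (simp add: vexp_def qv_powi_inj)

lemma vexp_add: "vexp (a + b) = vexp a * vexp b"
  by (simp add: vexp_def power_int_add)

lemma vexp_0 [simp]: "vexp 0 = 1" by (simp add: vexp_def)
lemma vexp_1 [simp]: "vexp 1 = qv" by (simp add: vexp_def)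
lemma vexp_m1 [simp]: "vexp (-1) = inverse qv" by (simp add: vexp_def power_int_minus)
lemma vexp_uminus: "vexp (- a) = inverse (vexp a)" by (simp add: vexp_def power_int_minus)

lemma qv_diff_nz [simp]: "qv - inverse qv \<noteq> 0"
  using vexp_inj[of 1 "-1"] by simp

text \<open>If it vanished, then v^2 = -1 and v^4 = 1 = v^0. This is [2], by which
  \<open>fmat_f_middle\<close> has to divide.\<close>

lemma qv_add_nz [simp]: "qv + inverse qv \<noteq> 0"
proof
  assume *: "qv + inverse qv = 0"
  have "vexp 2 = qv * qv" using vexp_add[of 1 1] by simp
  moreover have "vexp 4 = vexp 2 * vexp 2" using vexp_add[of 2 2] by simp
  moreover have "qv * (qv + inverse qv) = qv * qv + 1" by (simp add: distrib_left)
  then have "qv * qv = - 1" unfolding * by (simp add: eq_neg_iff_add_eq_0)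
  ultimately have "vexp 4 = vexp 0" by simp
  then show False unfolding vexp_inj by simp
qed

lemma qint_eq: "qint t = (vexp t - vexp (- t)) / (qv - inverse qv)"
  by (simp add: qint_def vexp_def)

lemma qint_0 [simp]: "qint 0 = 0" by (simp add: qint_eq)
lemma qint_1 [simp]: "qint 1 = 1"
  unfolding qint_eq vexp_1 vexp_m1 by (rule divide_self[OF qv_diff_nz])

lemma qint_nz:
  assumes "t \<noteq> 0"
  shows "qint t \<noteq> 0"
  using assms vexp_inj[of t "-t"] qv_diff_nz unfolding qint_eq by auto

text \<open>The field identity behind \<open>qint_mult_step\<close>, with x = v^m, y = v^d, q = v
  and D = v - v^-1.\<close>

lemma qint_step_aux:
  fixes x y q D :: "'a::field"
  assumes "x \<noteq> 0" "y \<noteq> 0" "q \<noteq> 0" "D = q - inverse q" "D \<noteq> 0"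
  shows "(x - inverse x) / D * ((y / x * q - x / y / q) / D) + (y / x / x - x * x / y) / D
       = (x * q - inverse x / q) / D * ((y / x - x / y) / D)"
proof -
  define X Y Q where XYQ: "X = inverse x" "Y = inverse y" "Q = inverse q"
  have *: "x * X = 1" using assms by (auto simp: XYQ)
  have "(x - X) * (y * X * q - x * Y * Q) + D * (y * X * X - x * x * Y)
     = (x * X) * (y * q) + (x * X) * (Y * Q) - x * x * Y * q - X * X * y * Q"
    by (simp add: assms(4) XYQ[symmetric] algebra_simps)
  also have "\<dots> = (x * q - X * Q) * (y * X - x * Y)"
    by (simp add: algebra_simps)
  finally have 1: "(x - X) * (y * X * q - x * Y * Q) + D * (y * X * X - x * x * Y) = \<dots>" .
  have 2: "A / D * (B / D) + C / D = A' / D * (B' / D)" if "A * B + D * C = A' * B'" for A B C A' B'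
  proof -
    have "A / D * (B / D) + C / D = (A * B + D * C) / (D * D)"
      using assms(5) by (simp add: add_divide_distrib)
    then show ?thesis by (simp add: that)
  qed
  show ?thesis using 2[OF 1] unfolding XYQ by (simp only: divide_inverse)
qed

text \<open>On a singular vector x with d = \<mu>_i - \<mu>_(i+1), the vector E_i F_i^m x equals
  [m][d - m + 1] F_i^(m-1) x, and moving E_i past one more F_i adds [d - 2m]. This is the induction
  step of \<open>e_f_power_singular\<close>.\<close>

lemma qint_mult_step: "qint m * qint (d - m + 1) + qint (d - 2 * m) = qint (m + 1) * qint (d - m)"
proof -
  have m: "vexp (a - b) = vexp a / vexp b" for a b
    using vexp_add[of a "-b"] by (simp add: vexp_uminus divide_inverse)
  have d: "- (d - 2 * m) = m + m - d" "d - 2 * m = d - m - m" "- (d - m + 1) = m - d - 1"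
    "- (m + 1) = - m - 1" "- (d - m) = m - d" by auto
  show ?thesis
    unfolding qint_eq d(1) unfolding d(2-)
    using qint_step_aux[OF vexp_nz vexp_nz qv_nz refl qv_diff_nz, of m d]
    by (simp only: vexp_add m vexp_uminus vexp_1)
qed

section \<open>The quantized enveloping algebra\<close>

text \<open>The locale allows the computations to run in a ring type with its simplification rules;
  the free algebra comes back only at the interpretation in \<open>uinf\<close>. \<open>l i\<close>
  is the inverse of \<open>k i\<close>, and \<open>gen_induct\<close> says that words in the
  generators span.\<close>

locale quantum_gl =
  fixes smul :: "qf \<Rightarrow> 'a::ring_1 \<Rightarrow> 'a" (infixr "\<odot>" 75)
    and e f k l :: "int \<Rightarrow> 'a"
  assumes smul_add_right [simp]: "c \<odot> (x + y) = c \<odot> x + c \<odot> y"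
    and smul_add_left: "(c + d) \<odot> x = c \<odot> x + d \<odot> x"
    and smul_smul [simp]: "c \<odot> d \<odot> x = (c * d) \<odot> x"
    and smul_one [simp]: "1 \<odot> x = x"
    and smul_mult_left [simp]: "(c \<odot> x) * y = c \<odot> (x * y)"
    and smul_mult_right [simp]: "x * (c \<odot> y) = c \<odot> (x * y)"
    and k_k: "k i * k j = k j * k i"
    and k_l [simp]: "k i * l i = 1"
    and l_k [simp]: "l i * k i = 1"
    and k_e: "k i * e j = vexp (delta i j - delta i (j + 1)) \<odot> (e j * k i)"
    and k_f: "k i * f j = vexp (delta i (j + 1) - delta i j) \<odot> (f j * k i)"
    and f_f: "\<bar>i - j\<bar> > 1 \<Longrightarrow> f i * f j = f j * f i"
    and e_e: "\<bar>i - j\<bar> > 1 \<Longrightarrow> e i * e j = e j * e i"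
    and e_f_rel: "e i * f j - f j * e i =
           (of_int (delta i j) / (qv - inverse qv)) \<odot> (k i * l (i + 1) - k (i + 1) * l i)"
    and serre_f: "\<bar>i - j\<bar> = 1 \<Longrightarrow>
           f i * f i * f j - (qv + inverse qv) \<odot> (f i * f j * f i) + f j * f i * f i = 0"
    and gen_induct: "\<And>P x. \<lbrakk>P 1; \<And>x y. P x \<Longrightarrow> P y \<Longrightarrow> P (x + y); \<And>c x. P x \<Longrightarrow> P (c \<odot> x);
           \<And>i x. P x \<Longrightarrow> P (e i * x); \<And>i x. P x \<Longrightarrow> P (f i * x);
           \<And>i x. P x \<Longrightarrow> P (k i * x); \<And>i x. P x \<Longrightarrow> P (l i * x)\<rbrakk> \<Longrightarrow> P x"
begin

lemma smul_zero_left [simp]: "0 \<odot> x = 0"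
  using smul_add_left[of 0 0 x] by simp

lemma smul_zero_right [simp]: "c \<odot> 0 = 0"
  using smul_add_right[of c 0 0] by simp

lemma smul_minus_right [simp]: "c \<odot> (- x) = - (c \<odot> x)"
  using smul_add_right[of c x "- x"] by (simp add: eq_neg_iff_add_eq_0 add.commute)

lemma smul_minus_left [simp]: "(- c) \<odot> x = - (c \<odot> x)"
  using smul_add_left[of c "- c" x] by (simp add: eq_neg_iff_add_eq_0 add.commute)

lemma smul_diff_right [simp]: "c \<odot> (x - y) = c \<odot> x - c \<odot> y"
  using smul_add_right[of c x "- y"] by simp

lemma smul_diff_left: "(c - d) \<odot> x = c \<odot> x - d \<odot> x"
  using smul_add_left[of c "- d" x] by simp

lemma smul_sum_right: "c \<odot> sum g A = (\<Sum>i\<in>A. c \<odot> g i)"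
  by (induction A rule: infinite_finite_induct) auto

lemma smul_sum_left: "sum g A \<odot> x = (\<Sum>i\<in>A. g i \<odot> x)"
  by (induction A rule: infinite_finite_induct) (auto simp: smul_add_left)

lemma smul_cancel: "c \<noteq> 0 \<Longrightarrow> c \<odot> x = c \<odot> y \<longleftrightarrow> x = y"
  by (metis smul_smul smul_one left_inverse)

lemma l_commute:
  assumes "k i * y = c \<odot> (y * k i)" "c \<noteq> 0"
  shows "l i * y = inverse c \<odot> (y * l i)"
proof -
  have "c \<odot> (l i * y) = l i * (c \<odot> (y * k i)) * l i"
    by (simp add: mult.assoc)
  also have "\<dots> = y * l i"
    unfolding assms(1)[symmetric] by (simp flip: mult.assoc)
  finally show ?thesis using assms(2)
    by (metis smul_smul smul_one left_inverse)
qed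

lemma l_f: "l i * f j = vexp (delta i j - delta i (j + 1)) \<odot> (f j * l i)"
  using l_commute[OF k_f[of i j]] by (simp add: vexp_uminus[symmetric])

lemma l_e: "l i * e j = vexp (delta i (j + 1) - delta i j) \<odot> (e j * l i)"
  using l_commute[OF k_e[of i j]] by (simp add: vexp_uminus[symmetric])

lemma k_f_eq:
  "k i * f i = inverse qv \<odot> (f i * k i)"
  "k (i + 1) * f i = qv \<odot> (f i * k (i + 1))"
  "j \<noteq> i \<Longrightarrow> j \<noteq> i + 1 \<Longrightarrow> k j * f i = f i * k j"
  by (simp_all add: k_f delta_def)

lemma e_f_commute: "i \<noteq> j \<Longrightarrow> e i * f j = f j * e i"
  using e_f_rel[of i j] by (simp add: delta_def)

lemma e_f_same:
  "e i * f i = f i * e i + inverse (qv - inverse qv) \<odot> (k i * l (i + 1) - k (i + 1) * l i)"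
  using e_f_rel[of i i] by (simp add: delta_def field_simps)

section \<open>Quantum root vectors\<close>

text \<open>\<open>eroot i n\<close> is a root vector for the root eps_i - eps_(i+n+1), made of
  v-commutators with one further simple root at a time. The initial factor v - v^-1 cancels the
  denominator of [E_i, F_i].\<close>

fun eroot :: "int \<Rightarrow> nat \<Rightarrow> 'a" where
  "eroot i 0 = (qv - inverse qv) \<odot> e i"
| "eroot i (Suc n) = qv \<odot> (eroot i n * e (i + 1 + int n)) - e (i + 1 + int n) * eroot i n"

text \<open>Starting from K_i rather than from a lowering generator gives diagonal and lower entries
  by one recursion; the factor v - v^-1 then appears by itself (\<open>fmat_1\<close>).
  \<open>fmat i n\<close> involves F_i, ..., F_(i+n-1).\<close>

fun fmat :: "int \<Rightarrow> nat \<Rightarrow> 'a" where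
  "fmat i 0 = k i"
| "fmat i (Suc n) = qv \<odot> (f (i + int n) * fmat i n) - fmat i n * f (i + int n)"

lemma k_eroot: "k j * eroot i n = vexp (delta j i - delta j (i + 1 + int n)) \<odot> (eroot i n * k j)"
proof (induction n)
  case 0
  then show ?case by (simp add: k_e mult.commute)
next
  case (Suc n)
  have 1: "k j * (eroot i n * e (i + 1 + int n)) =
     vexp (delta j i - delta j (i + 1 + int (Suc n))) \<odot> (eroot i n * e (i + 1 + int n) * k j)"
    by (simp add: mult.assoc[symmetric] Suc)
       (simp add: mult.assoc k_e vexp_add[symmetric] algebra_simps)
  have 2: "k j * (e (i + 1 + int n) * eroot i n) =
     vexp (delta j i - delta j (i + 1 + int (Suc n))) \<odot> (e (i + 1 + int n) * eroot i n * k j)"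
    by (simp add: mult.assoc[symmetric] k_e)
       (simp add: mult.assoc Suc vexp_add[symmetric] algebra_simps)
  show ?case
    by (simp only: eroot.simps right_diff_distrib left_diff_distrib 1 2 smul_mult_right smul_mult_left
      smul_diff_right smul_smul mult.commute)
qed

lemma l_eroot: "l j * eroot i n = vexp (delta j (i + 1 + int n) - delta j i) \<odot> (eroot i n * l j)"
  using l_commute[OF k_eroot[of j i n]] by (simp add: vexp_uminus[symmetric])

lemma eroot_f_far:
  assumes "j < i \<or> j > i + int n"
  shows "eroot i n * f j = f j * eroot i n"
  using assms
proof (induction n)
  case 0
  then have "i \<noteq> j" by auto
  then show ?case by (simp only: eroot.simps smul_mult_left e_f_commute[OF \<open>i \<noteq> j\<close>] smul_mult_right)
next
  case (Suc n)
  then have 1: "eroot i n * f j = f j * eroot i n" and 2: "e (i + 1 + int n) * f j = f j * e (i + 1 + int n)"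
    by (auto simp: e_f_commute)
  have "eroot i n * e (i + 1 + int n) * f j = f j * (eroot i n * e (i + 1 + int n))"
    by (metis 1 2 mult.assoc)
  moreover have "e (i + 1 + int n) * eroot i n * f j = f j * (e (i + 1 + int n) * eroot i n)"
    by (metis 1 2 mult.assoc)
  ultimately show ?case by (simp add: left_diff_distrib right_diff_distrib)
qed

lemma eroot_e_far:
  assumes "j < i - 1 \<or> j > i + int n + 1"
  shows "eroot i n * e j = e j * eroot i n"
  using assms
proof (induction n)
  case 0
  then show ?case by (auto simp: e_e)
next
  case (Suc n)
  then have 1: "eroot i n * e j = e j * eroot i n" and 2: "e (i + 1 + int n) * e j = e j * e (i + 1 + int n)"
    by (auto simp: e_e)
  have "eroot i n * e (i + 1 + int n) * e j = e j * (eroot i n * e (i + 1 + int n))"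
    by (metis 1 2 mult.assoc)
  moreover have "e (i + 1 + int n) * eroot i n * e j = e j * (e (i + 1 + int n) * eroot i n)"
    by (metis 1 2 mult.assoc)
  ultimately show ?case by (simp add: left_diff_distrib right_diff_distrib)
qed

lemma eroot_0_f: "eroot i 0 * f i = f i * eroot i 0 + k i * l (i + 1) - k (i + 1) * l i"
proof -
  have "(qv - inverse qv) \<odot> inverse (qv - inverse qv) \<odot> x = x" for x
    using right_inverse[OF qv_diff_nz] by (simp only: smul_smul smul_one)
  then show ?thesis
    by (simp only: eroot.simps smul_mult_left e_f_same smul_add_right smul_mult_right add_diff_eq)
qed

text \<open>F_j meets E_j in both terms of the v-commutator. The parts with K_(j+1) L_j cancel, and
  those with K_j L_(j+1) combine to the coefficient (v - v^-1)/(v - v^-1) = 1.\<close>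

lemma eroot_f_top:
  "eroot i (Suc n) * f (i + 1 + int n)
     = f (i + 1 + int n) * eroot i (Suc n) + eroot i n * k (i + 1 + int n) * l (i + 2 + int n)"
proof -
  define j where "j = i + 1 + int n"
  define X where "X = eroot i n"
  define c where "c = inverse (qv - inverse qv)"
  have c: "c * qv - c * inverse qv = 1"
    unfolding right_diff_distrib[symmetric] c_def by (rule left_inverse[OF qv_diff_nz])
  have f: "X * f j = f j * X" unfolding X_def j_def by (rule eroot_f_far) auto
  have ef: "e j * f j = f j * e j + c \<odot> (k j * l (j + 1) - k (j + 1) * l j)"
    by (simp add: e_f_same c_def)
  have kX: "k j * X = inverse qv \<odot> (X * k j)" "k (j + 1) * X = X * k (j + 1)"
    "l j * X = qv \<odot> (X * l j)" "l (j + 1) * X = X * l (j + 1)"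
    unfolding X_def j_def by (simp_all add: k_eroot l_eroot delta_def)
  have 1: "X * e j * f j = f j * (X * e j) + c \<odot> (X * k j * l (j + 1) - X * k (j + 1) * l j)"
    by (simp add: mult.assoc ef distrib_left right_diff_distrib) (simp add: mult.assoc[symmetric] f)
  have "e j * X * f j = e j * f j * X" by (simp add: mult.assoc f)
  also have "\<dots> = f j * (e j * X) + c \<odot> (k j * l (j + 1) * X - k (j + 1) * l j * X)"
    by (simp add: ef algebra_simps)
  also have "k j * l (j + 1) * X = inverse qv \<odot> (X * k j * l (j + 1))"
    by (simp add: mult.assoc kX) (simp add: mult.assoc[symmetric] kX)
  also have "k (j + 1) * l j * X = qv \<odot> (X * k (j + 1) * l j)"
    by (simp add: mult.assoc kX) (simp add: mult.assoc[symmetric] kX)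
  finally have 2: "e j * X * f j = f j * (e j * X)
      + c \<odot> (inverse qv \<odot> (X * k j * l (j + 1)) - qv \<odot> (X * k (j + 1) * l j))" .
  have E: "eroot i (Suc n) = qv \<odot> (X * e j) - e j * X" by (simp add: X_def j_def)
  have "eroot i (Suc n) * f j = f j * eroot i (Suc n) + (c * qv - c * inverse qv) \<odot> (X * k j * l (j + 1))"
    unfolding E left_diff_distrib smul_mult_left 1 2
    by (simp add: right_diff_distrib smul_diff_left mult.commute)
  moreover have "i + 2 + int n = j + 1" by (simp add: j_def)
  ultimately show ?thesis by (simp only: c smul_one X_def flip: j_def)
qed

text \<open>Cancelling the first simple root leaves the root vector that starts at i + 1. Only the
  base case is a computation: the later E_j have j \<ge> i + 2 and commute with F_i, K_(i+1) and
  L_i.\<close>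

lemma eroot_f_bottom: "eroot i (Suc n) * f i = f i * eroot i (Suc n) - k (i + 1) * l i * eroot (i + 1) n"
proof (induction n)
  case 0
  define j where "j = i + 1"
  define c where "c = qv - inverse qv"
  have ij: "e j * f i = f i * e j" by (simp add: e_f_commute j_def)
  have kk: "k j * e j = qv \<odot> (e j * k j)" "l j * e j = inverse qv \<odot> (e j * l j)"
    "k i * e j = e j * k i" "l i * e j = e j * l i"
    by (simp_all add: k_e l_e j_def delta_def)
  define X where "X = eroot i 0"
  have X: "X * f i = f i * X + k i * l j - k j * l i" unfolding X_def j_def by (rule eroot_0_f)
  have E: "eroot i (Suc 0) = qv \<odot> (X * e j) - e j * X" by (simp add: X_def j_def)
  have 1: "X * e j * f i = f i * (X * e j) + k i * l j * e j - k j * l i * e j"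
    by (simp add: mult.assoc ij) (simp add: mult.assoc[symmetric] X distrib_right left_diff_distrib)
  have 2: "e j * X * f i = f i * (e j * X) + e j * k i * l j - e j * k j * l i"
    by (simp add: mult.assoc X distrib_left right_diff_distrib) (simp add: mult.assoc[symmetric] ij)
  have 3: "k i * l j * e j = inverse qv \<odot> (e j * k i * l j)"
    by (simp add: mult.assoc kk) (simp add: mult.assoc[symmetric] kk)
  have 4: "e j * k j * l i = inverse qv \<odot> (k j * l i * e j)"
    by (simp add: mult.assoc kk) (simp add: mult.assoc[symmetric] kk)
  show ?case unfolding E left_diff_distrib smul_mult_left 1 2 3 4
    by (simp add: j_def[symmetric] right_diff_distrib smul_diff_left)
next
  case (Suc n)
  define j where "j = i + 2 + int n"
  define X where "X = eroot i (Suc n)"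
  define Y where "Y = eroot (i + 1) n"
  have X: "X * f i = f i * X - k (i + 1) * l i * Y" using Suc by (simp add: X_def Y_def)
  have ij: "e j * f i = f i * e j" by (simp add: e_f_commute j_def)
  have kk: "k (i + 1) * e j = e j * k (i + 1)" "l i * e j = e j * l i"
    by (simp_all add: k_e l_e j_def delta_def)
  have E: "eroot i (Suc (Suc n)) = qv \<odot> (X * e j) - e j * X" "eroot (i + 1) (Suc n) = qv \<odot> (Y * e j) - e j * Y"
    by (simp_all add: X_def Y_def j_def algebra_simps)
  have 1: "X * e j * f i = f i * (X * e j) - k (i + 1) * l i * (Y * e j)"
    by (simp add: mult.assoc ij) (simp add: mult.assoc[symmetric] X left_diff_distrib)
  have "e j * X * f i = f i * (e j * X) - e j * (k (i + 1) * l i * Y)"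
    by (simp add: mult.assoc X right_diff_distrib) (simp add: mult.assoc[symmetric] ij)
  also have "e j * (k (i + 1) * l i * Y) = k (i + 1) * l i * (e j * Y)"
    by (simp add: mult.assoc[symmetric] kk[symmetric]) (simp add: mult.assoc kk[symmetric])
  finally have 2: "e j * X * f i = f i * (e j * X) - k (i + 1) * l i * (e j * Y)" .
  show ?case unfolding E left_diff_distrib smul_mult_left 1 2
    by (simp add: right_diff_distrib)
qed

text \<open>For j just below the newly added index h, \<open>eroot_f_top\<close> leaves a term Y K_j
  L_h. Since Y and K_j commute with E_h while L_h E_h = v^-1 E_h L_h, this term drops out of the
  v-commutator with E_h.\<close>

lemma eroot_f_interior:
  assumes "i < j" "j < i + int n"
  shows "eroot i n * f j = f j * eroot i n"
  using assms
proof (induction n)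
  case 0
  then show ?case by simp
next
  case (Suc n)
  define h where "h = i + 1 + int n"
  define X where "X = eroot i n"
  have E: "eroot i (Suc n) = qv \<odot> (X * e h) - e h * X" by (simp add: X_def h_def)
  have hj: "e h * f j = f j * e h" using Suc.prems by (simp add: e_f_commute h_def)
  show ?case
  proof (cases "j < i + int n")
    case True
    then have X: "X * f j = f j * X" using Suc by (simp add: X_def)
    have 1: "X * e h * f j = f j * (X * e h)" by (metis X hj mult.assoc)
    have 2: "e h * X * f j = f j * (e h * X)" by (metis X hj mult.assoc)
    show ?thesis unfolding E left_diff_distrib smul_mult_left 1 2 by (simp add: right_diff_distrib)
  next
    case False
    then have j: "j = i + int n" using Suc.prems by simp
    with Suc.prems obtain m where m: "n = Suc m" by (cases n) auto
    define Y where "Y = eroot i m"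
    have X: "X * f j = f j * X + Y * k j * l h"
      using eroot_f_top[of i m] by (simp add: X_def Y_def j m h_def algebra_simps)
    have hh: "h = j + 1" by (simp add: h_def j)
    have kk: "k j * e h = e h * k j" "l h * e h = inverse qv \<odot> (e h * l h)"
      by (simp_all add: k_e l_e hh delta_def)
    have Y: "Y * e h = e h * Y"
      unfolding Y_def by (rule eroot_e_far) (auto simp: h_def m)
    have 1: "X * e h * f j = f j * (X * e h) + Y * k j * l h * e h"
      by (simp add: mult.assoc hj) (simp add: mult.assoc[symmetric] X distrib_right)
    have 2: "e h * X * f j = f j * (e h * X) + e h * Y * k j * l h"
      by (simp add: mult.assoc X distrib_left) (simp add: mult.assoc[symmetric] hj)
    have 3: "Y * k j * l h * e h = inverse qv \<odot> (e h * Y * k j * l h)"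
    proof -
      have "k j * (e h * z) = e h * (k j * z)" "Y * (e h * z) = e h * (Y * z)" for z
        by (metis kk(1) mult.assoc, metis Y mult.assoc)
      then show ?thesis by (simp add: mult.assoc kk)
    qed
    show ?thesis unfolding E left_diff_distrib smul_mult_left 1 2 3
      by (simp add: right_diff_distrib)
  qed
qed


section \<open>Commutation of the lower triangular entries with the F_j\<close>

lemma fmat_f_far:
  assumes "j < i - 1 \<or> j > i + int n"
  shows "fmat i n * f j = f j * fmat i n"
  using assms
proof (induction n)
  case 0
  then show ?case by (auto simp: k_f_eq)
next
  case (Suc n)
  define h where "h = i + int n"
  define X where "X = fmat i n"
  have E: "fmat i (Suc n) = qv \<odot> (f h * X) - X * f h" by (simp add: X_def h_def)
  have hj: "f h * f j = f j * f h" using Suc.prems by (intro f_f) (auto simp: h_def)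
  have X: "X * f j = f j * X" using Suc by (auto simp: X_def)
  have 1: "X * f h * f j = f j * (X * f h)" by (metis X hj mult.assoc)
  have 2: "f h * X * f j = f j * (f h * X)" by (metis X hj mult.assoc)
  show ?case unfolding E left_diff_distrib smul_mult_left 1 2 by (simp add: right_diff_distrib)
qed

lemma fmat_1: "fmat i (Suc 0) = (qv - inverse qv) \<odot> (f i * k i)"
  by (simp add: k_f_eq smul_diff_left)

lemma fmat_2: "fmat i (Suc (Suc 0)) = (qv - inverse qv) \<odot> ((qv \<odot> (f (i + 1) * f i) - f i * f (i + 1)) * k i)"
proof -
  have "f i * k i * f (i + 1) = f i * f (i + 1) * k i"
    by (simp add: mult.assoc k_f delta_def)
  moreover have "fmat i (Suc (Suc 0)) = (qv - inverse qv) \<odot> (qv \<odot> (f (i + 1) * (f i * k i)) - f i * k i * f (i + 1))"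
    unfolding fmat.simps(2)[of i "Suc 0"] fmat_1 by (simp add: mult.commute)
  ultimately show ?thesis by (simp add: left_diff_distrib mult.assoc)
qed

text \<open>The last factor F_(i+n-1) is the only one adjacent to F_(i+n), and the remaining part
  commutes with F_(i+n). The expression is thus a v-commutator of that part with an ordinary Serre
  element.\<close>

lemma fmat_serre:
  assumes "n > 0"
  shows "f (i + int n) * f (i + int n) * fmat i n
           - (qv + inverse qv) \<odot> (f (i + int n) * fmat i n * f (i + int n))
           + fmat i n * f (i + int n) * f (i + int n) = 0"
proof -
  obtain m where m: "n = Suc m" using assms by (cases n) auto
  define G where "G = f (i + int n)"
  define Y where "Y = fmat i m"
  define H where "H = f (i + int m)"
  have YG: "Y * G = G * Y" unfolding Y_def G_def m by (rule fmat_f_far) auto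
  have YG': "Y * (G * z) = G * (Y * z)" for z by (metis YG mult.assoc)
  have X: "fmat i n = qv \<odot> (H * Y) - Y * H" by (simp add: m Y_def H_def)
  define S where "S = G * G * H - (qv + inverse qv) \<odot> (G * H * G) + H * G * G"
  have "S = 0" unfolding S_def G_def H_def by (rule serre_f) (simp add: m)
  moreover have "G * G * fmat i n - (qv + inverse qv) \<odot> (G * fmat i n * G) + fmat i n * G * G
     = qv \<odot> (S * Y) - Y * S"
    unfolding X S_def by (simp add: algebra_simps YG YG')
  ultimately show ?thesis by (simp add: G_def)
qed

text \<open>The difference of the two sides is v times the Serre element of
  \<open>fmat_serre\<close>, because v (v + v^-1) = v^2 + 1. For n = 0 the commutation of K_i with
  F_i takes over.\<close>

lemma fmat_f_top: "qv \<odot> (fmat i (Suc n) * f (i + int n)) = f (i + int n) * fmat i (Suc n)"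
proof (cases n)
  case 0
  have "f i * k i * f i = inverse qv \<odot> (f i * (f i * k i))" by (simp add: mult.assoc k_f_eq)
  moreover have "qv * (c * inverse qv) = c" for c by (simp add: mult.left_commute)
  ultimately show ?thesis unfolding 0 by (simp only: fmat_1 smul_mult_left smul_mult_right smul_smul of_nat_0 add_0_right)
next
  case (Suc m)
  define G where "G = f (i + int n)"
  define X where "X = fmat i n"
  have S: "G * G * X - (qv + inverse qv) \<odot> (G * X * G) + X * G * G = 0"
    unfolding G_def X_def by (rule fmat_serre) (simp add: Suc)
  have "G * (qv \<odot> (G * X) - X * G) - qv \<odot> ((qv \<odot> (G * X) - X * G) * G)
      = qv \<odot> (G * G * X - (qv + inverse qv) \<odot> (G * X * G) + X * G * G)"
    by (simp add: algebra_simps smul_add_left)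
  also have "\<dots> = 0" unfolding S by simp
  finally show ?thesis by (simp add: G_def X_def)
qed

text \<open>The hard case is the index next to the last one: F_j then fails to commute with the
  newly added F_h as well as with the entry built before. Serre relations for both pairs have to be
  combined.\<close>

lemma fmat_f_middle:
  assumes "i \<le> j" "j + 1 < i + int n"
  shows "fmat i n * f j = f j * fmat i n"
  using assms
proof (induction n)
  case 0
  then show ?case by simp
next
  case (Suc n)
  define h where "h = i + int n"
  define Y where "Y = fmat i n"
  have E: "fmat i (Suc n) = qv \<odot> (f h * Y) - Y * f h" by (simp add: Y_def h_def)
  show ?case
  proof (cases "j + 1 < h")
    case True
    have Y: "Y * f j = f j * Y" using Suc True by (simp add: Y_def h_def)
    have hj: "f h * f j = f j * f h" using True by (intro f_f) auto
    have 1: "Y * f h * f j = f j * (Y * f h)" by (metis Y hj mult.assoc)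
    have 2: "f h * Y * f j = f j * (f h * Y)" by (metis Y hj mult.assoc)
    show ?thesis unfolding E left_diff_distrib smul_mult_left 1 2 by (simp add: right_diff_distrib)
  next
    case False
    then have h: "h = j + 1" using Suc.prems by (simp add: h_def)
    then obtain m where m: "n = Suc m" using Suc.prems by (cases n) (auto simp: h_def)
    have jm: "j = i + int m" using h by (simp add: h_def m)
    define G where "G = f j"
    define H where "H = f h"
    have SH: "G * G * H - (qv + inverse qv) \<odot> (G * H * G) + H * G * G = 0"
      unfolding G_def H_def by (rule serre_f) (simp add: h)
    show ?thesis
    proof (cases m)
      \<comment> \<open>The preceding entry is K_i here, to which \<open>fmat_serre\<close> does not
        apply; K_i F_i = v^-1 F_i K_i replaces it.\<close>
      case 0
      then have ij: "j = i" by (simp add: jm)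
      have kG: "k i * G = inverse qv \<odot> (G * k i)" by (simp add: G_def ij k_f_eq)
      have F: "fmat i (Suc n) = (qv - inverse qv) \<odot> ((qv \<odot> (H * G) - G * H) * k i)"
        using fmat_2[of i] by (simp only: m 0 H_def G_def h ij)
      have "(qv \<odot> (H * G) - G * H) * k i * G = (H * G * G - inverse qv \<odot> (G * H * G)) * k i"
        by (simp add: mult.assoc left_diff_distrib kG)
      also have "H * G * G - inverse qv \<odot> (G * H * G) = G * (qv \<odot> (H * G) - G * H)"
        using SH by (simp add: algebra_simps smul_add_left)
      finally have 1: "(qv \<odot> (H * G) - G * H) * k i * G = G * ((qv \<odot> (H * G) - G * H) * k i)"
        by (simp only: mult.assoc)
      show ?thesis unfolding F using 1 by (simp only: G_def[symmetric] smul_mult_left smul_mult_right)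
    next
      case (Suc m')
      define X where "X = fmat i m"
      have SX: "G * G * X - (qv + inverse qv) \<odot> (G * X * G) + X * G * G = 0"
        unfolding G_def X_def jm by (rule fmat_serre) (simp add: Suc)
      have XH: "X * H = H * X" unfolding X_def H_def by (rule fmat_f_far) (simp add: h jm)
      have XH': "X * (H * z) = H * (X * z)" for z by (metis XH mult.assoc)
      have Y: "Y = qv \<odot> (G * X) - X * G" by (simp add: Y_def m X_def G_def jm)
      have YG: "qv \<odot> (Y * G) = G * Y" using fmat_f_top[of i m] by (simp add: Y_def m G_def jm)
      \<comment> \<open>\<open>T\<close> is the commutator of \<open>G\<close> with
        \<open>fmat i (Suc n)\<close>, rewritten by means of
        \<open>G * Y = qv \<odot> (Y * G)\<close>.\<close>
      define T where "T = qv \<odot> (G * H * Y) - qv \<odot> (Y * G * H) - H * G * Y + Y * H * G"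
      define q2 where "q2 = qv + inverse qv"
      define SH' where "SH' = G * G * H - q2 \<odot> (G * H * G) + H * G * G"
      define SX' where "SX' = G * G * X - q2 \<odot> (G * X * G) + X * G * G"
      define R where "R = H * G * X * G - X * G * H * G + G * X * G * H - G * H * G * X"
      have "T = R + (qv \<odot> (SX' * H) - qv \<odot> (SH' * X))"
        unfolding T_def Y R_def SX'_def SH'_def q2_def
        by (simp add: algebra_simps smul_add_left XH XH')
      also have "SX' = 0" using SX by (simp only: SX'_def q2_def)
      also have "SH' = 0" using SH by (simp only: SH'_def q2_def)
      finally have "T = R" by simp
      \<comment> \<open>It is [2] times \<open>R\<close>, not \<open>R\<close>, that gets expressed
        through Serre elements; cancelling [2] then finishes the argument.\<close>
      have "q2 \<odot> R = SH' * X + X * SH' - H * SX' - SX' * H"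
        unfolding R_def SH'_def SX'_def by (simp add: algebra_simps XH XH')
      then have "q2 \<odot> R = q2 \<odot> 0" by (simp add: \<open>SX' = 0\<close> \<open>SH' = 0\<close>)
      then have "T = 0" unfolding \<open>T = R\<close> using smul_cancel[of q2] qv_add_nz unfolding q2_def by blast
      have GYH: "G * (Y * H) = qv \<odot> (Y * (G * H))" and HGY: "H * (G * Y) = qv \<odot> (H * (Y * G))"
        by (simp_all flip: YG mult.assoc)
      have "fmat i (Suc n) * G - G * fmat i (Suc n) = - T"
        unfolding E H_def[symmetric] Y_def[symmetric] T_def
        by (simp add: algebra_simps GYH HGY)
      then show ?thesis using \<open>T = 0\<close> by (simp add: G_def)
    qed
  qed
qed


text \<open>F_(i-1) extends the entry by one index at the lower end. The base case is explicit; each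
  further F_j has j \<ge> i + 1 and commutes with F_(i-1) and with K_i L_(i-1).\<close>

lemma fmat_f_bottom:
  "fmat i (Suc n) * f (i - 1) = f (i - 1) * fmat i (Suc n) + fmat (i - 1) (Suc (Suc n)) * k i * l (i - 1)"
proof (induction n)
  case 0
  define h where "h = i - 1"
  have i: "i = h + 1" by (simp add: h_def)
  have "k i * f h = qv \<odot> (f h * k i)" unfolding i by (rule k_f_eq)
  moreover have "k h * (k i * l h) = k i"
    by (metis k_k k_l mult.assoc mult.right_neutral)
  moreover have "fmat h (Suc (Suc 0)) = (qv - inverse qv) \<odot> ((qv \<odot> (f i * f h) - f h * f i) * k h)"
    using fmat_2[of h] by (simp only: i)
  moreover have "fmat i (Suc 0) = (qv - inverse qv) \<odot> (f i * k i)" by (rule fmat_1)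
  ultimately show ?case
    unfolding h_def[symmetric] by (simp add: mult.assoc left_diff_distrib mult.commute)
next
  case (Suc n)
  define h where "h = i - 1"
  define j where "j = i + 1 + int n"
  define X where "X = fmat i (Suc n)"
  define Y where "Y = fmat h (Suc (Suc n))"
  define Z where "Z = k i * l h"
  have IH: "X * f h = f h * X + Y * Z" using Suc by (simp add: X_def Y_def Z_def h_def mult.assoc)
  have E: "fmat i (Suc (Suc n)) = qv \<odot> (f j * X) - X * f j" by (simp add: X_def j_def add.assoc add.left_commute)
  have "h + int (Suc (Suc n)) = j" by (simp add: j_def h_def)
  then have E': "fmat h (Suc (Suc (Suc n))) = qv \<odot> (f j * Y) - Y * f j"
    unfolding fmat.simps(2)[of h "Suc (Suc n)"] Y_def by simp
  have hj: "f j * f h = f h * f j" by (rule f_f) (simp add: j_def h_def)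
  have Z: "Z * f j = f j * Z" "f j * (Z * z) = Z * (f j * z)" for z
  proof -
    have "k i * f j = f j * k i" "l h * f j = f j * l h"
      by (simp_all add: k_f l_f delta_def j_def h_def)
    then show "Z * f j = f j * Z" unfolding Z_def by (metis mult.assoc)
    then show "f j * (Z * z) = Z * (f j * z)" by (metis mult.assoc)
  qed
  have 1: "f j * X * f h = f h * (f j * X) + f j * Y * Z"
    by (simp add: mult.assoc IH distrib_left) (simp add: mult.assoc[symmetric] hj)
  have "X * f j * f h = f h * (X * f j) + Y * Z * f j"
    by (simp add: mult.assoc hj) (simp add: mult.assoc[symmetric] IH distrib_right)
  then have 2: "X * f j * f h = f h * (X * f j) + Y * f j * Z" by (simp add: mult.assoc Z)
  show ?case
    unfolding h_def[symmetric] E E' left_diff_distrib smul_mult_left 1 2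
    by (simp add: right_diff_distrib left_diff_distrib Z_def mult.assoc)
qed

lemma fmat_0_f: "k i * f (i - 1) = qv \<odot> (f (i - 1) * k i)"
  using k_f_eq(2)[of "i - 1"] by simp

section \<open>A truncated quantum Casimir element\<close>

text \<open>\<open>emat\<close> and \<open>lmat\<close> are the upper and lower triangular parts of the quantum monodromy matrix of the
  natural representation, and the Casimir element is its quantum trace. Cutting the sum at \<open>[m,n]\<close> keeps it
  in the algebra while it still commutes with the generators inside that interval.\<close>

definition emat :: "int \<Rightarrow> int \<Rightarrow> 'a" where
  "emat i j = (if i < j then eroot i (nat (j - i - 1)) * k j else if i = j then k i else 0)"

definition lmat :: "int \<Rightarrow> int \<Rightarrow> 'a" where
  "lmat j i = fmat i (nat (j - i))"

definition kfexp :: "int \<Rightarrow> int \<Rightarrow> qf" where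
  "kfexp j t = vexp (delta j (t + 1) - delta j t)"

lemma k_f_kfexp: "k j * f t = kfexp j t \<odot> (f t * k j)"
  by (simp add: k_f kfexp_def)

text \<open>F_t interacts with a root vector only at its last simple root (j = t + 1) and its first
  one (i = t); for a simple root vector both corrections occur. The value 0 of \<open>emat\<close>
  below the diagonal lets the formula hold for all i and j.\<close>

lemma emat_f:
  "emat i j * f t = kfexp j t \<odot> (f t * emat i j + (if j = t + 1 then emat i t else 0)
       - (if i = t then k (t + 1) * l t * emat (t + 1) j else 0))"
proof -
  consider "i > j" | "i = j" | "i < j" by linarith
  then show ?thesis
  proof cases
    case 1
    then show ?thesis by (auto simp: emat_def)
  next
    case 2
    then show ?thesis by (auto simp: emat_def k_f_kfexp)
  next
    case ij: 3
    define n where "n = nat (j - i - 1)"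
    have j: "j = i + 1 + int n" using ij by (simp add: n_def)
    have E: "emat i j = eroot i n * k j" using ij by (simp add: emat_def n_def)
    have *: "emat i j * f t = kfexp j t \<odot> (eroot i n * f t * k j)"
      unfolding E by (simp add: mult.assoc k_f_kfexp)
    consider "n = 0" "t = i" | m where "n = Suc m" "t = i + int n" | m where "n = Suc m" "t = i"
      | "t \<noteq> i" "t \<noteq> i + int n"
    proof (cases n)
      case 0
      then show ?thesis using that(1,4) by auto
    next
      case (Suc m)
      then show ?thesis using that(2,3)[of m] that(4) by blast
    qed
    then show ?thesis
    proof cases
      case 1
      then have jt: "j = t + 1" using j by simp
      have "emat i t * 1 = k t" using 1 by (simp add: emat_def)
      moreover have "k (t + 1) * l t * emat (t + 1) j = k (t + 1) * l t * k j" by (simp add: emat_def jt)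
      moreover have "eroot i n * f t * k j = f t * emat i j + k t - k (t + 1) * l t * k j"
        unfolding E 1 eroot_0_f unfolding 1[symmetric] jt
        by (simp add: distrib_right left_diff_distrib mult.assoc del: eroot.simps)
      ultimately show ?thesis unfolding * using 1 jt by simp
    next
      case (2 m)
      then have jt: "j = t + 1" using j by simp
      have "t = i + 1 + int m" "t + 1 = i + 2 + int m" using 2 by auto
      then have "eroot i n * f t = f t * eroot i n + eroot i m * k t * l (t + 1)"
        using eroot_f_top[of i m] unfolding 2(1) by (simp only:)
      then have "eroot i n * f t * k j = f t * emat i j + eroot i m * k t"
        unfolding E unfolding jt by (simp add: distrib_right mult.assoc)
      moreover have "emat i t = eroot i m * k t" using 2 by (simp add: emat_def)
      ultimately show ?thesis unfolding * using 2 jt by simp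
    next
      case (3 m)
      then have "j \<noteq> t + 1" using j by simp
      moreover have "eroot i n * f t * k j = f t * emat i j - k (t + 1) * l t * (eroot (t + 1) m * k j)"
        unfolding E 3 eroot_f_bottom by (simp add: left_diff_distrib mult.assoc)
      moreover have "emat (t + 1) j = eroot (t + 1) m * k j"
        using 3 j by (simp add: emat_def)
      ultimately show ?thesis unfolding * using 3 by simp
    next
      case 4
      then have "j \<noteq> t + 1" using j by simp
      moreover have "eroot i n * f t = f t * eroot i n"
        using 4 eroot_f_far[of t i n] eroot_f_interior[of i t n] by linarith
      ultimately show ?thesis unfolding * unfolding E using 4 by (simp add: mult.assoc)
    qed
  qed
qed

text \<open>The corrections mirror those of \<open>emat_f\<close>, which makes them cancel in
  \<open>casimir_f\<close>. The hypothesis excludes i > j, where truncated subtraction turns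
  \<open>lmat j i\<close> into \<open>k i\<close>; in the Casimir sum such an entry is multiplied by
  \<open>emat i j = 0\<close>.\<close>

lemma f_lmat:
  assumes "i \<le> j"
  shows "f t * lmat j i = kfexp j t \<odot> (lmat j i * f t) + (if j = t then inverse qv \<odot> lmat (t + 1) i else 0)
       - (if i = t + 1 then kfexp j t \<odot> (lmat j t * k (t + 1) * l t) else 0)"
proof -
  define n where "n = nat (j - i)"
  have j: "j = i + int n" using assms by (simp add: n_def)
  have B: "lmat j i = fmat i n" by (simp add: lmat_def n_def)
  consider "t = j" | "t = i - 1" "n = 0" | m where "t = i - 1" "n = Suc m" | m where "t = j - 1" "n = Suc m"
    | "t < i - 1 \<or> t > j" | "i \<le> t" "t + 1 < i + int n"
  proof (cases n)
    case 0
    then show ?thesis using that(1,2,5) j by force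
  next
    case (Suc m)
    then show ?thesis using that(1,5,6) that(3,4)[of m] j by force
  qed
  then show ?thesis
  proof cases
    case 1
    then have t: "i \<noteq> t + 1" "kfexp j t = inverse qv" using assms by (auto simp: kfexp_def delta_def)
    have "lmat (t + 1) i = qv \<odot> (f t * lmat j i) - lmat j i * f t"
      using 1 j assms by (simp add: lmat_def nat_add_distrib)
    then show ?thesis using 1 t by simp
  next
    case 2
    then have t: "i = t + 1" "j = i" "kfexp j t = qv" using j by (auto simp: kfexp_def delta_def)
    have "k t * (k (t + 1) * l t) = k (t + 1)"
      by (metis k_k k_l mult.assoc mult.right_neutral)
    moreover have "lmat j t = (qv - inverse qv) \<odot> (f t * k t)" using fmat_1[of t] t by (simp add: lmat_def)
    ultimately have "lmat j t * k (t + 1) * l t = (qv - inverse qv) \<odot> (f t * k i)"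
      by (simp add: mult.assoc t)
    moreover have "lmat j i = k i" by (simp add: B 2)
    moreover have "k i * f t = qv \<odot> (f t * k i)" using fmat_0_f[of i] 2 by simp
    ultimately show ?thesis using t
      by (simp add: right_diff_distrib smul_diff_left)
  next
    case (3 m)
    then have t: "i = t + 1" "j \<noteq> t" "kfexp j t = 1" using j by (auto simp: kfexp_def delta_def)
    have "nat (j - t) = Suc (Suc m)" using 3 j by simp
    then have "lmat j t = fmat (i - 1) (Suc (Suc m))" by (simp only: lmat_def 3)
    moreover have "i - 1 = t" using t by simp
    ultimately have "fmat i n * f t = f t * fmat i n + lmat j t * k i * l t"
      using fmat_f_bottom[of i m] by (simp only: 3(2))
    then show ?thesis unfolding B using t by simp
  next
    case (4 m)
    then have t: "i \<noteq> t + 1" "j \<noteq> t" "kfexp j t = qv" using j by (auto simp: kfexp_def delta_def)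
    have "i + int m = t" using 4 j by simp
    then have "qv \<odot> (fmat i n * f t) = f t * fmat i n"
      using fmat_f_top[of i m] by (simp only: 4(2))
    then show ?thesis unfolding B using t by simp
  next
    case 5
    then have t: "i \<noteq> t + 1" "j \<noteq> t" "kfexp j t = 1" using assms by (auto simp: kfexp_def delta_def)
    have "fmat i n * f t = f t * fmat i n" using 5 j by (intro fmat_f_far) auto
    then show ?thesis using t by (simp add: B)
  next
    case 6
    then have t: "i \<noteq> t + 1" "j \<noteq> t" "kfexp j t = 1" using j by (auto simp: kfexp_def delta_def)
    then show ?thesis using fmat_f_middle[OF 6] by (simp add: B)
  qed
qed

definition casimir :: "int \<Rightarrow> int \<Rightarrow> 'a" where
  "casimir m n = (\<Sum>j\<in>{m..n}. vexp (- 2 * j) \<odot> (\<Sum>i\<in>{m..n}. lmat j i * emat i j))"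

text \<open>On both sides the j-th summand contains \<open>X j - Z j\<close>: \<open>Z j\<close>
  arises at i = t when F_t passes \<open>emat\<close>, and at i = t + 1 when it passes
  \<open>lmat\<close>. A multiple of \<open>Y\<close> is left over, at j = t + 1 on one side and at
  j = t on the other. Hence both t and t + 1 must lie in the interval.\<close>

lemma casimir_f:
  assumes "m \<le> t" "t < n"
  shows "casimir m n * f t = f t * casimir m n"
proof -
  define I where "I = {m..n}"
  have fin: "finite I" and tI: "t \<in> I" "t + 1 \<in> I" using assms by (auto simp: I_def)
  define X where "X j = (\<Sum>i\<in>I. kfexp j t \<odot> (lmat j i * f t * emat i j))" for j
  define Y where "Y = (\<Sum>i\<in>I. lmat (t + 1) i * emat i t)"
  define Z where "Z j = kfexp j t \<odot> (lmat j t * k (t + 1) * l t * emat (t + 1) j)" for j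
  have 1: "(\<Sum>i\<in>I. lmat j i * emat i j) * f t = X j + (if j = t + 1 then qv \<odot> Y else 0) - Z j" for j
  proof -
    have "lmat j i * emat i j * f t = kfexp j t \<odot> (lmat j i * f t * emat i j)
        + (if j = t + 1 then qv \<odot> (lmat (t + 1) i * emat i t) else 0) - (if i = t then Z j else 0)" for i
      unfolding mult.assoc[of _ _ "f t"] emat_f[of i j t]
      by (auto simp: Z_def algebra_simps kfexp_def delta_def)
    then show ?thesis
      using fin tI by (simp add: sum_distrib_right sum.distrib sum_subtractf X_def Y_def smul_sum_right)
  qed
  have 2: "f t * (\<Sum>i\<in>I. lmat j i * emat i j) = X j + (if j = t then inverse qv \<odot> Y else 0) - Z j" for j
  proof -
    have "f t * (lmat j i * emat i j) = kfexp j t \<odot> (lmat j i * f t * emat i j)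
        + (if j = t then inverse qv \<odot> (lmat (t + 1) i * emat i t) else 0) - (if i = t + 1 then Z j else 0)" for i
    proof (cases "i \<le> j")
      case True
      then show ?thesis
        unfolding mult.assoc[symmetric] f_lmat[OF True]
        by (auto simp: Z_def algebra_simps)
    next
      case False
      then show ?thesis by (auto simp: emat_def Z_def)
    qed
    then show ?thesis
      using fin tI by (simp add: sum_distrib_left sum.distrib sum_subtractf X_def Y_def smul_sum_right)
  qed
  \<comment> \<open>The weights v^(-2j) of the trace are chosen for this identity, which matches the
    two leftover multiples of \<open>Y\<close>.\<close>
  have v: "vexp (- (2 * (t + 1))) * qv = vexp (- (2 * t)) * inverse qv"
  proof -
    have "- (2 * (t + 1)) + 1 = - (2 * t) + - (1::int)" by simp
    then have "vexp (- (2 * (t + 1)) + 1) = vexp (- (2 * t) + - 1)" by (rule arg_cong)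
    then show ?thesis unfolding vexp_add by simp
  qed
  have "(\<Sum>j\<in>I. vexp (- 2 * j) \<odot> ((X j + (if j = t + 1 then qv \<odot> Y else 0)) - Z j))
      = (\<Sum>j\<in>I. vexp (- 2 * j) \<odot> (X j - Z j)) + (\<Sum>j\<in>I. if j = t + 1 then vexp (- 2 * j) \<odot> qv \<odot> Y else 0)"
    by (auto simp: sum.distrib[symmetric] intro!: sum.cong)
  moreover have "(\<Sum>j\<in>I. vexp (- 2 * j) \<odot> ((X j + (if j = t then inverse qv \<odot> Y else 0)) - Z j))
      = (\<Sum>j\<in>I. vexp (- 2 * j) \<odot> (X j - Z j)) + (\<Sum>j\<in>I. if j = t then vexp (- 2 * j) \<odot> inverse qv \<odot> Y else 0)"
    by (auto simp: sum.distrib[symmetric] intro!: sum.cong)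
  moreover have "casimir m n * f t = (\<Sum>j\<in>I. vexp (- 2 * j) \<odot> ((X j + (if j = t + 1 then qv \<odot> Y else 0)) - Z j))"
    unfolding casimir_def I_def[symmetric] sum_distrib_right[of _ _ "f t"] smul_mult_left 1[symmetric]
    by (simp only: sum_distrib_right)
  moreover have "f t * casimir m n = (\<Sum>j\<in>I. vexp (- 2 * j) \<odot> ((X j + (if j = t then inverse qv \<odot> Y else 0)) - Z j))"
    unfolding casimir_def I_def[symmetric] sum_distrib_left[of "f t"] smul_mult_right 2[symmetric]
    by (simp only: sum_distrib_left)
  ultimately show ?thesis using fin tI v by simp
qed

section \<open>Left ideals, spans and weights\<close>

definition left_ideal :: "'a set \<Rightarrow> bool" where
  "left_ideal S \<longleftrightarrow> 0 \<in> S \<and> (\<forall>x\<in>S. \<forall>y\<in>S. x + y \<in> S) \<and> (\<forall>a. \<forall>x\<in>S. a * x \<in> S)"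

lemma left_idealD:
  assumes "left_ideal S"
  shows "0 \<in> S" "x \<in> S \<Longrightarrow> y \<in> S \<Longrightarrow> x + y \<in> S" "x \<in> S \<Longrightarrow> a * x \<in> S"
  using assms by (auto simp: left_ideal_def)

lemma left_ideal_smul: "left_ideal S \<Longrightarrow> x \<in> S \<Longrightarrow> c \<odot> x \<in> S"
  using left_idealD(3)[of S x "c \<odot> 1"] by simp

lemma left_ideal_minus: "left_ideal S \<Longrightarrow> x \<in> S \<Longrightarrow> - x \<in> S"
  using left_idealD(3)[of S x "- 1"] by simp

lemma left_ideal_diff: "left_ideal S \<Longrightarrow> x \<in> S \<Longrightarrow> y \<in> S \<Longrightarrow> x - y \<in> S"
  using left_idealD(2)[of S x "- y"] left_ideal_minus[of S y] by simp

lemma left_ideal_sum: "left_ideal S \<Longrightarrow> (\<And>i. i \<in> A \<Longrightarrow> g i \<in> S) \<Longrightarrow> sum g A \<in> S"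
  by (induction A rule: infinite_finite_induct) (auto intro: left_idealD)

lemma left_ideal_smul_iff: "left_ideal S \<Longrightarrow> c \<noteq> 0 \<Longrightarrow> c \<odot> x \<in> S \<longleftrightarrow> x \<in> S"
  using left_ideal_smul[of S "c \<odot> x" "inverse c"] left_ideal_smul[of S x c] by auto

lemma left_ideal_cong: "left_ideal S \<Longrightarrow> x - y \<in> S \<Longrightarrow> x \<in> S \<longleftrightarrow> y \<in> S"
  using left_idealD(2)[of S "x - y" y] left_ideal_diff[of S x "x - y"] by auto

text \<open>Building the span one term at a time makes rule induction available for its
  elements.\<close>

inductive_set lin :: "'a set \<Rightarrow> 'a set" for X where
  lin_0: "0 \<in> lin X"
| lin_step: "x \<in> X \<Longrightarrow> y \<in> lin X \<Longrightarrow> c \<odot> x + y \<in> lin X"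

lemma lin_base: "x \<in> X \<Longrightarrow> x \<in> lin X"
  using lin_step[OF _ lin_0, of x X 1] by simp

lemma lin_add: "x \<in> lin X \<Longrightarrow> y \<in> lin X \<Longrightarrow> x + y \<in> lin X"
  by (induction x rule: lin.induct) (auto simp: add.assoc intro: lin.intros)

lemma lin_smul: "x \<in> lin X \<Longrightarrow> c \<odot> x \<in> lin X"
  by (induction x rule: lin.induct) (auto intro: lin.intros)

text \<open>Vectors of U/S are represented by elements of U, and equations by membership in
  \<open>S\<close>. The same lemmas then serve M(\<lambda>), its quotients and arbitrary
  submodules.\<close>

definition eigen :: "'a set \<Rightarrow> 'a \<Rightarrow> (int \<Rightarrow> int) \<Rightarrow> bool" where
  "eigen S x \<mu> \<longleftrightarrow> (\<forall>i. k i * x - vexp (\<mu> i) \<odot> x \<in> S)"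

definition singular :: "'a set \<Rightarrow> 'a \<Rightarrow> (int \<Rightarrow> int) \<Rightarrow> bool" where
  "singular S x \<mu> \<longleftrightarrow> (\<forall>i. e i * x \<in> S) \<and> eigen S x \<mu>"

lemma eigen_l:
  assumes S: "left_ideal S" and x: "eigen S x \<mu>"
  shows "l i * x - vexp (- \<mu> i) \<odot> x \<in> S"
proof -
  have "l i * (k i * x - vexp (\<mu> i) \<odot> x) \<in> S"
    using S x by (auto simp: eigen_def intro: left_idealD)
  then have "vexp (- \<mu> i) \<odot> (x - vexp (\<mu> i) \<odot> (l i * x)) \<in> S"
    using S by (auto simp: right_diff_distrib mult.assoc[symmetric] simp del: smul_diff_right intro!: left_ideal_smul)
  then have "vexp (- \<mu> i) \<odot> x - l i * x \<in> S"
    by (simp add: vexp_uminus)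
  then show ?thesis using left_ideal_minus[OF S] by fastforce
qed

lemma eigen_kl:
  assumes S: "left_ideal S" and x: "eigen S x \<mu>"
  shows "k i * l j * x - vexp (\<mu> i - \<mu> j) \<odot> x \<in> S"
proof -
  have "k i * (l j * x - vexp (- \<mu> j) \<odot> x) \<in> S"
    using eigen_l[OF assms] S by (auto intro: left_idealD)
  moreover have "vexp (- \<mu> j) \<odot> (k i * x - vexp (\<mu> i) \<odot> x) \<in> S"
    using S x by (auto simp: eigen_def simp del: smul_diff_right intro: left_ideal_smul)
  ultimately have "k i * (l j * x - vexp (- \<mu> j) \<odot> x) + vexp (- \<mu> j) \<odot> (k i * x - vexp (\<mu> i) \<odot> x) \<in> S"
    using S by (blast intro: left_idealD)
  then show ?thesis
    by (simp add: right_diff_distrib mult.assoc vexp_add[of "\<mu> i" "- \<mu> j", simplified] mult.commute)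
qed

lemma eigen_f:
  assumes S: "left_ideal S" and x: "eigen S x \<mu>"
  shows "eigen S (f j * x) (\<lambda>i. \<mu> i + (delta i (j + 1) - delta i j))"
  unfolding eigen_def
proof
  fix i
  have "vexp (delta i (j + 1) - delta i j) \<odot> (f j * (k i * x - vexp (\<mu> i) \<odot> x)) \<in> S"
    using S x by (auto simp: eigen_def simp del: smul_diff_right intro: left_ideal_smul left_idealD)
  then show "k i * (f j * x) - vexp (\<mu> i + (delta i (j + 1) - delta i j)) \<odot> (f j * x) \<in> S"
    by (simp add: mult.assoc[symmetric] k_f right_diff_distrib vexp_add mult.commute)
qed

lemma eigen_e_f:
  assumes S: "left_ideal S" and x: "eigen S x \<mu>"
  shows "e i * (f i * x) - (f i * (e i * x) + qint (\<mu> i - \<mu> (i + 1)) \<odot> x) \<in> S"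
proof -
  define c where "c = inverse (qv - inverse qv)"
  define d where "d = \<mu> i - \<mu> (i + 1)"
  have *: "c \<odot> ((k i * l (i + 1) * x - vexp d \<odot> x) - (k (i + 1) * l i * x - vexp (- d) \<odot> x)) \<in> S"
    using eigen_kl[OF S x, of i "i + 1"] eigen_kl[OF S x, of "i + 1" i]
    unfolding d_def by (intro left_ideal_smul[OF S left_ideal_diff[OF S]]) auto
  moreover have "e i * (f i * x) = f i * (e i * x) + c \<odot> (k i * l (i + 1) * x - k (i + 1) * l i * x)"
    by (simp only: mult.assoc[symmetric] e_f_same c_def distrib_right smul_mult_left left_diff_distrib)
  moreover have "qint d = c * vexp d - c * vexp (- d)"
    by (simp add: qint_eq c_def divide_inverse right_diff_distrib left_diff_distrib mult.commute)
  ultimately have "e i * (f i * x) - (f i * (e i * x) + qint d \<odot> x)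
      = c \<odot> ((k i * l (i + 1) * x - vexp d \<odot> x) - (k (i + 1) * l i * x - vexp (- d) \<odot> x))"
    by (simp only: smul_diff_left smul_diff_right smul_smul) (simp add: algebra_simps)
  with * show ?thesis unfolding d_def by simp
qed

text \<open>For i < j, \<open>emat i j\<close> is a root vector times K_j: K_j acts on
  \<open>x\<close> by a scalar and the root vector then kills it. Only i = j survives, where
  \<open>lmat\<close> and \<open>emat\<close> give K_j^2.\<close>

lemma casimir_singular:
  assumes S: "left_ideal S" and x: "singular S x \<mu>"
  shows "casimir m n * x - (\<Sum>j\<in>{m..n}. vexp (2 * (\<mu> j - j))) \<odot> x \<in> S"
proof -
  have E: "eroot i p * x \<in> S" for i p
  proof (induction p)
    case 0
    then show ?case using S x by (auto simp: singular_def intro: left_ideal_smul)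
  next
    case (Suc p)
    have "qv \<odot> (eroot i p * (e (i + 1 + int p) * x)) - e (i + 1 + int p) * (eroot i p * x) \<in> S"
      using x by (intro left_ideal_diff[OF S left_ideal_smul[OF S left_idealD(3)[OF S]] left_idealD(3)[OF S Suc]])
        (auto simp: singular_def)
    then show ?case by (simp add: left_diff_distrib mult.assoc)
  qed
  have k: "k j * x - vexp (\<mu> j) \<odot> x \<in> S" for j using x by (auto simp: singular_def eigen_def)
  have em: "emat i j * x - (if i = j then vexp (\<mu> j) else 0) \<odot> x \<in> S" for i j
  proof -
    have "eroot i p * (k j * x) \<in> S" for p
    proof -
      have "eroot i p * (k j * x - vexp (\<mu> j) \<odot> x) \<in> S"
        using S k by (blast intro: left_idealD)
      then show ?thesis using E left_ideal_smul[OF S E]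
        left_ideal_cong[OF S, of "eroot i p * (k j * x)"] by (simp add: right_diff_distrib)
    qed
    then show ?thesis using k left_idealD(1)[OF S] by (auto simp: emat_def mult.assoc)
  qed
  have lm: "lmat j i * emat i j * x - (if i = j then vexp (2 * \<mu> j) else 0) \<odot> x \<in> S" for i j
  proof -
    have 1: "lmat j i * (emat i j * x - (if i = j then vexp (\<mu> j) else 0) \<odot> x) \<in> S"
      using em S by (blast intro: left_idealD)
    show ?thesis
    proof (cases "i = j")
      case True
      have "vexp (\<mu> j) \<odot> (k j * x - vexp (\<mu> j) \<odot> x) \<in> S" using k S by (blast intro: left_ideal_smul)
      from left_idealD(2)[OF S 1 this] show ?thesis using True
        by (simp add: lmat_def right_diff_distrib mult.assoc vexp_add[symmetric])
    next
      case False
      then show ?thesis using 1 by (simp add: mult.assoc)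
    qed
  qed
  have "vexp (- 2 * j) \<odot> ((\<Sum>i\<in>{m..n}. lmat j i * emat i j) * x) - (if j \<in> {m..n} then vexp (2 * (\<mu> j - j)) else 0) \<odot> x \<in> S" for j
  proof -
    have "(\<Sum>i\<in>{m..n}. lmat j i * emat i j * x - (if i = j then vexp (2 * \<mu> j) else 0) \<odot> x) \<in> S"
      using lm S by (intro left_ideal_sum) auto
    then have "vexp (- 2 * j) \<odot> (\<Sum>i\<in>{m..n}. lmat j i * emat i j * x - (if i = j then vexp (2 * \<mu> j) else 0) \<odot> x) \<in> S"
      by (rule left_ideal_smul[OF S])
    moreover have "vexp (2 * (\<mu> j - j)) = vexp (- 2 * j) * vexp (2 * \<mu> j)"
      by (simp add: vexp_add[symmetric])
    ultimately show ?thesis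
      by (auto simp: sum_subtractf sum_distrib_right smul_sum_left[symmetric] split: if_splits)
  qed
  then have "(\<Sum>j\<in>{m..n}. vexp (- 2 * j) \<odot> ((\<Sum>i\<in>{m..n}. lmat j i * emat i j) * x) - (if j \<in> {m..n} then vexp (2 * (\<mu> j - j)) else 0) \<odot> x) \<in> S"
    by (rule left_ideal_sum[OF S])
  moreover have "(\<Sum>j\<in>{m..n}. (if j \<in> {m..n} then vexp (2 * (\<mu> j - j)) else 0) \<odot> x) = (\<Sum>j\<in>{m..n}. vexp (2 * (\<mu> j - j))) \<odot> x"
    unfolding smul_sum_left by (intro sum.cong) auto
  ultimately show ?thesis
    by (simp only: casimir_def sum_distrib_right smul_mult_left sum_subtractf)
qed

section \<open>Powers of a single F_i applied to a singular vector\<close>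

lemma e_f_power_singular:
  fixes i :: int
  assumes S: "left_ideal S" and x: "singular S x \<mu>"
  defines "d \<equiv> \<mu> i - \<mu> (i + 1)"
  shows "eigen S (f i ^ n * x) (\<lambda>j. \<mu> j + int n * (delta j (i + 1) - delta j i))"
    and "e i * (f i ^ Suc n * x) - (qint (int n + 1) * qint (d - int n)) \<odot> (f i ^ n * x) \<in> S"
proof -
  have w: "eigen S (f i ^ n * x) (\<lambda>j. \<mu> j + int n * (delta j (i + 1) - delta j i))" for n
  proof (induction n)
    case 0
    then show ?case using x by (simp add: singular_def)
  next
    case (Suc n)
    from eigen_f[OF S Suc, of i] show ?case by (simp add: mult.assoc algebra_simps)
  qed
  then show "eigen S (f i ^ n * x) (\<lambda>j. \<mu> j + int n * (delta j (i + 1) - delta j i))" .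
  \<comment> \<open>F_i^n lowers the value \<mu>_i - \<mu>_(i+1) by 2n, so the commutator of E_i and
    F_i acts there by [d - 2n].\<close>
  have ef: "e i * (f i * (f i ^ n * x)) - (f i * (e i * (f i ^ n * x)) + qint (d - 2 * int n) \<odot> (f i ^ n * x)) \<in> S" for n
    using eigen_e_f[OF S w, of i n] by (simp add: d_def delta_def algebra_simps)
  show "e i * (f i ^ Suc n * x) - (qint (int n + 1) * qint (d - int n)) \<odot> (f i ^ n * x) \<in> S"
  proof (induction n)
    case 0
    have "f i * (e i * x) \<in> S" using S x by (auto simp: singular_def intro: left_idealD)
    from left_idealD(2)[OF S ef[of 0, simplified] this] show ?case
      by (simp add: algebra_simps)
  next
    case (Suc n)
    have "f i * (e i * (f i ^ Suc n * x) - (qint (int n + 1) * qint (d - int n)) \<odot> (f i ^ n * x)) \<in> S"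
      using S Suc by (blast intro: left_idealD)
    from left_idealD(2)[OF S ef[of "Suc n"] this]
    have "e i * (f i ^ Suc (Suc n) * x)
        - (qint (int n + 1) * qint (d - int n) + qint (d - 2 * (int n + 1))) \<odot> (f i ^ Suc n * x) \<in> S"
      by (simp add: mult.assoc right_diff_distrib smul_add_left algebra_simps)
    moreover have "qint (int n + 1) * qint (d - int n) + qint (d - 2 * (int n + 1))
        = qint (int (Suc n) + 1) * qint (d - int (Suc n))"
      using qint_mult_step[of "int n + 1" d] by (simp add: algebra_simps)
    ultimately show ?case by simp
  qed
qed

lemma e_f_power_commute: "i \<noteq> j \<Longrightarrow> e i * f j ^ n = f j ^ n * e i"
  by (rule sym, rule power_commuting_commutes) (simp add: e_f_commute)

text \<open>With n = d the coefficient [n + 1][d - n] vanishes, and the other E_j commute with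
  F_i.\<close>

lemma f_power_singular:
  assumes S: "left_ideal S" and x: "singular S x \<mu>" and d: "\<mu> i - \<mu> (i + 1) = int n"
  shows "singular S (f i ^ Suc n * x) (\<lambda>j. \<mu> j + int (Suc n) * (delta j (i + 1) - delta j i))"
  unfolding singular_def
proof (intro conjI allI)
  show "eigen S (f i ^ Suc n * x) (\<lambda>j. \<mu> j + int (Suc n) * (delta j (i + 1) - delta j i))"
    by (rule e_f_power_singular[OF S x])
  fix j
  show "e j * (f i ^ Suc n * x) \<in> S"
  proof (cases "j = i")
    case True
    then show ?thesis using e_f_power_singular(2)[OF S x, of i n] d by simp
  next
    case False
    have "f i ^ Suc n * (e j * x) \<in> S" using S x by (auto simp: singular_def intro: left_idealD)
    then show ?thesis using e_f_power_commute[OF False, of "Suc n"] by (metis mult.assoc)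
  qed
qed

text \<open>Take the last power p with F_i^p x outside S. Applying E_i to F_i^(p+1) x forces
  [p + 1][d - p] = 0, and quantum integers vanish only at 0, so d = p \<ge> 0.\<close>

lemma singular_dominant:
  assumes S: "left_ideal S" and x: "singular S x \<mu>" "x \<notin> S" and n: "f i ^ n * x \<in> S"
  shows "\<mu> (i + 1) \<le> \<mu> i"
proof -
  define d where "d = \<mu> i - \<mu> (i + 1)"
  define m where "m = (LEAST n. f i ^ n * x \<in> S)"
  have m: "f i ^ m * x \<in> S" unfolding m_def using n by (rule LeastI)
  then obtain p where p: "m = Suc p" using x(2) by (cases m) auto
  have np: "f i ^ p * x \<notin> S" using not_less_Least[of p "\<lambda>n. f i ^ n * x \<in> S"] p unfolding m_def by auto
  have "e i * (f i ^ Suc p * x) \<in> S" using m S unfolding p by (blast intro: left_idealD)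
  then have "(qint (int p + 1) * qint (d - int p)) \<odot> (f i ^ p * x) \<in> S"
    using e_f_power_singular(2)[OF S x(1), of i p] left_ideal_cong[OF S] d_def by blast
  then have "qint (int p + 1) * qint (d - int p) = 0" using np left_ideal_smul_iff[OF S] by blast
  then have "d = int p" using qint_nz[of "int p + 1"] qint_nz[of "d - int p"] by force
  then show ?thesis by (simp add: d_def)
qed

section \<open>Words in the lowering generators\<close>

definition fw :: "int list \<Rightarrow> 'a" where "fw js = prod_list (map f js)"

lemma fw_simps [simp]: "fw [] = 1" "fw (j # js) = f j * fw js"
  by (simp_all add: fw_def)

definition fspan :: "int multiset \<Rightarrow> 'a set" where
  "fspan \<beta> = lin {fw js | js. mset js = \<beta>}"

text \<open>The weight of a word with letters \<open>\<beta>\<close>: each F_j adds 1 at position j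
  + 1 and subtracts 1 at position j.\<close>

definition wshift :: "int multiset \<Rightarrow> int \<Rightarrow> int" where
  "wshift \<beta> i = int (count \<beta> (i - 1)) - int (count \<beta> i)"

text \<open>The difference of the two multiplicity functions is invariant under translation, hence
  constant, and it is 0 at any index that occurs in neither multiset.\<close>

lemma wshift_inj:
  assumes "wshift \<beta> = wshift \<gamma>"
  shows "\<beta> = \<gamma>"
proof -
  define d where "d i = int (count \<beta> i) - int (count \<gamma> i)" for i
  have step: "d (i - 1) = d i" for i using fun_cong[OF assms, of i] by (simp add: wshift_def d_def)
  have "infinite (UNIV :: int set)" by (rule infinite_UNIV_int)
  then have "\<exists>j. j \<notin> set_mset \<beta> \<union> set_mset \<gamma>"
    using finite_set_mset[of \<beta>] finite_set_mset[of \<gamma>]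
    by (metis UNIV_eq_I finite_UnI)
  then obtain j where "j \<notin># \<beta>" "j \<notin># \<gamma>" by auto
  then have "d j = 0" by (simp add: d_def count_eq_zero_iff[symmetric] del: count_eq_zero_iff)
  have "d i = d j" for i
  proof (induction i rule: int_induct[where k = j])
    case (step1 i)
    then show ?case using step[of "i + 1"] by simp
  next
    case (step2 i)
    then show ?case using step[of i] by simp
  qed simp
  then show ?thesis using \<open>d j = 0\<close> by (intro multiset_eqI) (simp add: d_def)
qed

lemma fspan_empty: "y \<in> fspan {#} \<Longrightarrow> \<exists>c. y = c \<odot> 1"
  unfolding fspan_def
proof (induction y rule: lin.induct)
  case lin_0
  show ?case by (rule exI[of _ 0]) simp
next
  case (lin_step x y c)
  then obtain d where "y = d \<odot> 1" "x = 1" by auto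
  then have "c \<odot> x + y = (c + d) \<odot> 1" by (simp add: smul_add_left)
  then show ?case by blast
qed

lemma fw_eigen:
  assumes S: "left_ideal S" and x: "eigen S x \<mu>"
  shows "eigen S (fw js * x) (\<lambda>i. \<mu> i + wshift (mset js) i)"
proof (induction js)
  case Nil
  then show ?case using x by (simp add: wshift_def)
next
  case (Cons j js)
  have "(\<lambda>i. \<mu> i + wshift (mset js) i + (delta i (j + 1) - delta i j)) = (\<lambda>i. \<mu> i + wshift (mset (j # js)) i)"
    by (auto simp: wshift_def delta_def fun_eq_iff)
  then show ?case using eigen_f[OF S Cons, of j] by (simp add: mult.assoc)
qed

text \<open>Moving E_i to the right, each meeting with a letter i replaces the pair by a scalar on a
  weight vector, and E_i finally kills \<open>x\<close>. The coefficients do not matter later, only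
  that exactly one letter i has disappeared.\<close>

lemma e_fw:
  assumes S: "left_ideal S" and x: "singular S x \<mu>"
  shows "\<exists>y\<in>lin {fw ks | ks. add_mset i (mset ks) = mset js}. e i * (fw js * x) - y * x \<in> S"
proof (induction js)
  case Nil
  then show ?case using x left_idealD(1)[OF S] by (intro bexI[of _ 0]) (auto simp: singular_def intro: lin_0)
next
  case (Cons j js)
  let ?A = "\<lambda>js. lin {fw ks | ks. add_mset i (mset ks) = mset js}"
  from Cons obtain y where y: "y \<in> ?A js" and ye: "e i * (fw js * x) - y * x \<in> S" by blast
  have fy: "f j * y \<in> ?A (j # js)"
    using y
  proof (induction y rule: lin.induct)
    case (lin_step z y c)
    then obtain ks where "z = fw ks" "add_mset i (mset ks) = mset js" by blast
    then have "f j * z = fw (j # ks)" "add_mset i (mset (j # ks)) = mset (j # js)" by (auto simp: add_mset_commute)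
    then have "f j * z \<in> {fw ks | ks. add_mset i (mset ks) = mset (j # js)}" by blast
    from lin.lin_step[OF this lin_step.IH, of c] show ?case by (simp add: distrib_left)
  qed (simp add: lin_0)
  have fye: "f j * (e i * (fw js * x)) - f j * y * x \<in> S"
    using left_idealD(3)[OF S ye, of "f j"] by (simp add: right_diff_distrib mult.assoc)
  show ?case
  proof (cases "i = j")
    case False
    then have "e i * (fw (j # js) * x) = f j * (e i * (fw js * x))"
      using e_f_commute[OF False] by (metis fw_simps(2) mult.assoc)
    then show ?thesis using fy fye by (intro bexI[of _ "f j * y"]) auto
  next
    case True
    have eig: "eigen S (fw js * x) (\<lambda>i. \<mu> i + wshift (mset js) i)"
      using fw_eigen[OF S] x by (auto simp: singular_def)
    from eigen_e_f[OF S eig, of j] obtain c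
      where "e j * (f j * (fw js * x)) - (f j * (e j * (fw js * x)) + c \<odot> (fw js * x)) \<in> S" by blast
    from left_idealD(2)[OF S this fye[unfolded True]]
    have "e i * (fw (j # js) * x) - (c \<odot> fw js + f j * y) * x \<in> S"
      unfolding True by (simp add: distrib_right mult.assoc diff_diff_eq[symmetric])
    moreover have "c \<odot> fw js + f j * y \<in> ?A (j # js)"
      using fy True by (intro lin_step) auto
    ultimately show ?thesis by blast
  qed
qed

text \<open>The Serre relation lets all but at most one F_i pass to the right of F_j. This is what
  makes local nilpotency propagate.\<close>

lemma f_serre_power:
  assumes "\<bar>i - j\<bar> = 1"
  shows "\<exists>a b. f i ^ Suc p * f j = a \<odot> (f i * f j * f i ^ p) + b \<odot> (f j * f i ^ Suc p)"
proof (induction p)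
  case 0
  show ?case by (rule exI[of _ 1], rule exI[of _ 0]) simp
next
  case (Suc p)
  then obtain a b where ab: "f i ^ Suc p * f j = a \<odot> (f i * f j * f i ^ p) + b \<odot> (f j * f i ^ Suc p)" by blast
  have s: "f i * f i * f j = (qv + inverse qv) \<odot> (f i * f j * f i) - f j * f i * f i"
    using serre_f[OF assms] by (simp add: algebra_simps add_eq_0_iff)
  have "f i ^ Suc (Suc p) * f j = f i * (f i ^ Suc p * f j)" by (simp add: mult.assoc)
  also have "\<dots> = a \<odot> (f i * f i * f j * f i ^ p) + b \<odot> (f i * f j * f i ^ Suc p)"
    unfolding ab by (simp add: distrib_left mult.assoc)
  also have "\<dots> = (a * (qv + inverse qv) + b) \<odot> (f i * f j * f i ^ Suc p) + (- a) \<odot> (f j * f i ^ Suc (Suc p))"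
    unfolding s by (simp add: left_diff_distrib mult.assoc) (simp add: smul_add_left)
  finally show ?case by blast
qed

lemma f_power_mono:
  assumes S: "left_ideal S" and "f i ^ m * x \<in> S" "m \<le> n"
  shows "f i ^ n * x \<in> S"
proof -
  have "f i ^ n * x = f i ^ (n - m) * (f i ^ m * x)"
    using assms(3) by (simp add: mult.assoc[symmetric] power_add[symmetric])
  then show ?thesis using S assms(2) by (auto intro: left_idealD)
qed

text \<open>If F_i^m y lies in S, then so does F_i^(m+1) F_j y for adjacent j, since by
  \<open>f_serre_power\<close> every term ends in F_i^m y or F_i^(m+1) y. For other j the two
  commute.\<close>

lemma f_nilpotent_fw:
  assumes S: "left_ideal S" and n: "f i ^ n * x \<in> S"
  shows "\<exists>m. f i ^ m * (fw js * x) \<in> S"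
proof (induction js)
  case Nil
  then show ?case using n by auto
next
  case (Cons j js)
  define y where "y = fw js * x"
  from Cons obtain m where m: "f i ^ m * y \<in> S" unfolding y_def by blast
  have "\<exists>m. f i ^ m * (f j * y) \<in> S"
  proof (cases "\<bar>i - j\<bar> = 1")
    case True
    from f_serre_power[OF True, of m] obtain a b
      where ab: "f i ^ Suc m * f j = a \<odot> (f i * f j * f i ^ m) + b \<odot> (f j * f i ^ Suc m)" by blast
    have "f i ^ Suc m * (f j * y) = a \<odot> (f i * f j * (f i ^ m * y)) + b \<odot> (f j * (f i ^ Suc m * y))"
      by (simp only: mult.assoc[symmetric] ab smul_mult_left distrib_right)
    also have "\<dots> \<in> S"
      using S m f_power_mono[OF S m, of "Suc m"]
      by (intro left_idealD(2)[OF S left_ideal_smul[OF S left_idealD(3)[OF S]] left_ideal_smul[OF S left_idealD(3)[OF S]]]) auto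
    finally show ?thesis by blast
  next
    case False
    have "f i * f j = f j * f i" using False f_f[of i j] by (cases "i = j") auto
    then have "f i ^ m * f j = f j * f i ^ m" by (rule power_commuting_commutes)
    then have "f i ^ m * (f j * y) = f j * (f i ^ m * y)" by (metis mult.assoc)
    then show ?thesis using left_idealD(3)[OF S m] by metis
  qed
  then show ?case by (simp add: y_def mult.assoc)
qed

lemma f_nilpotent_lin:
  assumes S: "left_ideal S" and n: "f i ^ n \<in> S" and y: "y \<in> lin {fw js | js. P js}"
  shows "\<exists>m. f i ^ m * y \<in> S"
  using y
proof (induction y rule: lin.induct)
  case lin_0
  then show ?case using left_idealD(1)[OF S] by auto
next
  case (lin_step x y c)
  then obtain js m where x: "x = fw js" and m: "f i ^ m * y \<in> S" by blast
  obtain m' where m': "f i ^ m' * x \<in> S" using f_nilpotent_fw[OF S, of i n 1 js] n x by auto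
  have "c \<odot> (f i ^ max m m' * x) + f i ^ max m m' * y \<in> S"
    using f_power_mono[OF S m, of "max m m'"] f_power_mono[OF S m', of "max m m'"] S
    by (intro left_idealD(2) left_ideal_smul) auto
  then show ?case by (auto simp: distrib_left)
qed


section \<open>Highest weight modules\<close>

text \<open>Modulo \<open>N\<close> the span of the F-words is stable under left multiplication by
  every generator: under E_i by \<open>e_fw\<close>, under K_i and its inverse because words are
  weight vectors.\<close>

lemma decompose_lin:
  assumes N: "left_ideal N" and one: "singular N 1 \<mu>"
  shows "\<exists>y\<in>lin (range fw). x - y \<in> N"
proof (induction x rule: gen_induct)
  case 1
  have "fw [] \<in> lin (range fw)" by (intro lin_base rangeI)
  then show ?case using left_idealD(1)[OF N] by (intro bexI[of _ "1"]) auto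
next
  case (2 x y)
  then obtain x' y' where *: "x' \<in> lin (range fw)" "y' \<in> lin (range fw)" "x - x' \<in> N" "y - y' \<in> N" by blast
  from left_idealD(2)[OF N *(3,4)] lin_add[OF *(1,2)] show ?case
    by (intro bexI[of _ "x' + y'"]) (auto simp: algebra_simps)
next
  case (3 c x)
  then obtain x' where *: "x' \<in> lin (range fw)" "x - x' \<in> N" by blast
  then show ?case using lin_smul[OF *(1), of c] left_ideal_smul[OF N *(2), of c] by (intro bexI[of _ "c \<odot> x'"]) auto
next
  case (4 i x)
  have *: "\<exists>z\<in>lin (range fw). e i * y - z \<in> N" if "y \<in> lin (range fw)" for y
    using that
  proof (induction y rule: lin.induct)
    case lin_0
    then show ?case using left_idealD(1)[OF N] by (intro bexI[of _ 0]) (auto intro: lin.lin_0)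
  next
    case (lin_step x y c)
    then obtain js z where js: "x = fw js" and z: "z \<in> lin (range fw)" "e i * y - z \<in> N" by auto
    from e_fw[OF N one, of i js] obtain w where
      w: "w \<in> lin {fw ks | ks. add_mset i (mset ks) = mset js}" "e i * x - w \<in> N" by (auto simp: js)
    have w': "w \<in> lin (range fw)" using w(1)
    proof (induction w rule: lin.induct)
      case (lin_step a b d)
      then show ?case using lin.lin_step[of a "range fw" b d] by blast
    qed (rule lin_0)
    have "c \<odot> (e i * x - w) + (e i * y - z) \<in> N"
      using left_idealD(2)[OF N left_ideal_smul[OF N w(2)] z(2)] .
    then show ?case using lin_add[OF lin_smul[OF w', of c] z(1)]
      by (intro bexI[of _ "c \<odot> w + z"]) (auto simp: algebra_simps)
  qed
  from 4 obtain y where y: "y \<in> lin (range fw)" "x - y \<in> N" by blast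
  from *[OF y(1)] obtain z where z: "z \<in> lin (range fw)" "e i * y - z \<in> N" by blast
  show ?case using left_idealD(2)[OF N left_idealD(3)[OF N y(2), of "e i"] z(2)] z(1)
    by (intro bexI[of _ z]) (auto simp: algebra_simps)
next
  case (5 i x)
  then obtain y where y: "y \<in> lin (range fw)" "x - y \<in> N" by blast
  have "f i * y \<in> lin (range fw)"
    using y(1)
  proof (induction y rule: lin.induct)
    case (lin_step z y c)
    then obtain js where "z = fw js" by blast
    then have "f i * z \<in> range fw" using fw_simps(2) by (metis rangeI)
    from lin.lin_step[OF this lin_step.IH, of c] show ?case by (simp add: distrib_left)
  qed (simp add: lin_0)
  then show ?case using left_idealD(3)[OF N y(2), of "f i"] by (intro bexI[of _ "f i * y"]) (auto simp: algebra_simps)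
next
  case (6 i x)
  then obtain y where y: "y \<in> lin (range fw)" "x - y \<in> N" by blast
  have *: "\<exists>z\<in>lin (range fw). k i * y - z \<in> N" using y(1)
  proof (induction y rule: lin.induct)
    case lin_0
    then show ?case using left_idealD(1)[OF N] by (intro bexI[of _ 0]) (auto intro: lin.lin_0)
  next
    case (lin_step x y c)
    then obtain js z where js: "x = fw js" and z: "z \<in> lin (range fw)" "k i * y - z \<in> N" by auto
    have "eigen N 1 \<mu>" using one by (simp add: singular_def)
    from fw_eigen[OF N this, of js] obtain d where "k i * x - d \<odot> x \<in> N" unfolding eigen_def js by auto
    from left_idealD(2)[OF N left_ideal_smul[OF N this] z(2), of c]
    have "k i * (c \<odot> x + y) - ((c * d) \<odot> x + z) \<in> N" by (simp add: algebra_simps)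
    moreover have "(c * d) \<odot> x + z \<in> lin (range fw)" using lin_step.hyps(1) z(1) by (rule lin.lin_step)
    ultimately show ?case by blast
  qed
  then obtain z where z: "z \<in> lin (range fw)" "k i * y - z \<in> N" by blast
  show ?case using left_idealD(2)[OF N left_idealD(3)[OF N y(2), of "k i"] z(2)] z(1)
    by (intro bexI[of _ z]) (auto simp: algebra_simps)
next
  case (7 i x)
  then obtain y where y: "y \<in> lin (range fw)" "x - y \<in> N" by blast
  have *: "\<exists>z\<in>lin (range fw). l i * y - z \<in> N" using y(1)
  proof (induction y rule: lin.induct)
    case lin_0
    then show ?case using left_idealD(1)[OF N] by (intro bexI[of _ 0]) (auto intro: lin.lin_0)
  next
    case (lin_step x y c)
    then obtain js z where js: "x = fw js" and z: "z \<in> lin (range fw)" "l i * y - z \<in> N" by auto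
    have "eigen N 1 \<mu>" using one by (simp add: singular_def)
    from eigen_l[OF N fw_eigen[OF N this, of js]] obtain d where "l i * x - d \<odot> x \<in> N" unfolding js by auto
    from left_idealD(2)[OF N left_ideal_smul[OF N this] z(2), of c]
    have "l i * (c \<odot> x + y) - ((c * d) \<odot> x + z) \<in> N" by (simp add: algebra_simps)
    moreover have "(c * d) \<odot> x + z \<in> lin (range fw)" using lin_step.hyps(1) z(1) by (rule lin.lin_step)
    ultimately show ?case by blast
  qed
  then obtain z where z: "z \<in> lin (range fw)" "l i * y - z \<in> N" by blast
  show ?case using left_idealD(2)[OF N left_idealD(3)[OF N y(2), of "l i"] z(2)] z(1)
    by (intro bexI[of _ z]) (auto simp: algebra_simps)
qed

lemma lin_fw_decompose:
  assumes "y \<in> lin (range fw)"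
  shows "\<exists>B g. finite B \<and> (\<forall>\<beta>. g \<beta> \<in> fspan \<beta>) \<and> y = (\<Sum>\<beta>\<in>B. g \<beta>)"
  using assms
proof (induction y rule: lin.induct)
  case lin_0
  show ?case by (rule exI[of _ "{}"], rule exI[of _ "\<lambda>_. 0"]) (simp add: fspan_def lin.lin_0)
next
  case (lin_step x y c)
  then obtain js B g where js: "x = fw js" and B: "finite B" "\<forall>\<beta>. g \<beta> \<in> fspan \<beta>" "y = (\<Sum>\<beta>\<in>B. g \<beta>)" by blast
  define \<gamma> where "\<gamma> = mset js"
  \<comment> \<open>The multiset \<open>\<gamma>\<close> of the new word may or may not belong to
    \<open>B\<close>; the second conditional discards the value of \<open>g\<close> at
    \<open>\<gamma>\<close> when it was not part of the sum.\<close>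
  define g' where "g' \<beta> = (if \<beta> = \<gamma> then c \<odot> x else 0) + (if \<beta> \<in> B then g \<beta> else 0)" for \<beta>
  have "g' \<beta> \<in> fspan \<beta>" for \<beta>
  proof -
    have "x \<in> fspan \<gamma>" unfolding fspan_def \<gamma>_def js by (intro lin_base) blast
    then have "(if \<beta> = \<gamma> then c \<odot> x else 0) \<in> fspan \<beta>" unfolding fspan_def by (simp add: lin_smul lin_0)
    moreover have "(if \<beta> \<in> B then g \<beta> else 0) \<in> fspan \<beta>" using B(2) by (simp add: fspan_def lin_0)
    ultimately show ?thesis unfolding g'_def fspan_def by (rule lin_add)
  qed
  moreover have "(\<Sum>\<beta>\<in>insert \<gamma> B. g' \<beta>) = c \<odot> x + (\<Sum>\<beta>\<in>insert \<gamma> B. if \<beta> \<in> B then g \<beta> else 0)"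
    using B(1) by (simp add: g'_def sum.distrib)
  moreover have "(\<Sum>\<beta>\<in>insert \<gamma> B. if \<beta> \<in> B then g \<beta> else 0) = y"
    unfolding B(3) using B(1) by (intro sum.mono_neutral_cong_right) auto
  ultimately show ?case using B(1) by (metis finite_insert)
qed

lemma fspan_eigen:
  assumes N: "left_ideal N" and one: "eigen N 1 \<mu>" and y: "y \<in> fspan \<beta>"
  shows "eigen N y (\<lambda>i. \<mu> i + wshift \<beta> i)"
  using y unfolding fspan_def
proof (induction y rule: lin.induct)
  case lin_0
  then show ?case using left_idealD(1)[OF N] by (simp add: eigen_def)
next
  case (lin_step x y c)
  then obtain js where js: "x = fw js" "mset js = \<beta>" by blast
  have "k i * (c \<odot> x + y) - vexp (\<mu> i + wshift \<beta> i) \<odot> (c \<odot> x + y) \<in> N" for i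
  proof -
    have "c \<odot> (k i * x - vexp (\<mu> i + wshift \<beta> i) \<odot> x) \<in> N"
      using fw_eigen[OF N one, of js] unfolding eigen_def js
      by (intro left_ideal_smul[OF N]) (simp add: js)
    moreover have "k i * y - vexp (\<mu> i + wshift \<beta> i) \<odot> y \<in> N" using lin_step.IH by (simp add: eigen_def)
    ultimately have "c \<odot> (k i * x - vexp (\<mu> i + wshift \<beta> i) \<odot> x) + (k i * y - vexp (\<mu> i + wshift \<beta> i) \<odot> y) \<in> N"
      by (rule left_idealD(2)[OF N])
    then show ?thesis by (simp add: algebra_simps)
  qed
  then show ?case by (simp add: eigen_def)
qed

lemma e_fspan:
  assumes N: "left_ideal N" and one: "singular N 1 \<mu>" and y: "y \<in> fspan \<beta>"
  shows "\<exists>z\<in>lin {fw ks | ks. add_mset i (mset ks) = \<beta>}. e i * y - z \<in> N"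
  using y unfolding fspan_def
proof (induction y rule: lin.induct)
  case lin_0
  then show ?case using left_idealD(1)[OF N] by (intro bexI[of _ 0]) (auto intro: lin.lin_0)
next
  case (lin_step x y c)
  then obtain js z where js: "x = fw js" "mset js = \<beta>"
    and z: "z \<in> lin {fw ks | ks. add_mset i (mset ks) = \<beta>}" "e i * y - z \<in> N" by auto
  from e_fw[OF N one, of i js] obtain w where
    w: "w \<in> lin {fw ks | ks. add_mset i (mset ks) = \<beta>}" "e i * x - w \<in> N" by (auto simp: js)
  have "c \<odot> (e i * x - w) + (e i * y - z) \<in> N"
    using left_idealD(2)[OF N left_ideal_smul[OF N w(2)] z(2)] .
  then show ?case using lin_add[OF lin_smul[OF w(1), of c] z(1)]
    by (intro bexI[of _ "c \<odot> w + z"]) (auto simp: algebra_simps)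
qed

text \<open>Distinct degrees have distinct weights by \<open>wshift_inj\<close>, so some K_i
  separates any two components. Induction on the number of components removes one of them at a
  time.\<close>

lemma weight_components:
  assumes S: "left_ideal S" and one: "eigen S 1 \<mu>"
    and B: "finite B" and g: "\<And>\<beta>. g \<beta> \<in> fspan \<beta>" and sum: "(\<Sum>\<beta>\<in>B. g \<beta>) \<in> S"
  shows "\<forall>\<beta>\<in>B. g \<beta> \<in> S"
  using B g sum
proof (induction B arbitrary: g rule: finite_induct)
  case empty
  then show ?case by simp
next
  case (insert \<beta> B)
  define w where "w \<gamma> i = \<mu> i + wshift \<gamma> i" for \<gamma> i
  have eig: "k i * g \<gamma> - vexp (w \<gamma> i) \<odot> g \<gamma> \<in> S" for \<gamma> i
    using fspan_eigen[OF S one insert.prems(1), of \<gamma>] by (simp add: eigen_def w_def)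
  have 1: "g \<gamma> \<in> S" if \<gamma>: "\<gamma> \<in> B" for \<gamma>
  proof -
    have "\<gamma> \<noteq> \<beta>" using \<gamma> insert.hyps by auto
    then obtain i where i: "wshift \<gamma> i \<noteq> wshift \<beta> i" using wshift_inj by blast
    \<comment> \<open>Up to elements of \<open>S\<close>, K_i minus its eigenvalue at
      \<open>\<beta>\<close> kills that component and rescales the others as in \<open>g'\<close>;
      the factor at \<open>\<gamma>\<close> is nonzero by the choice of \<open>i\<close>.\<close>
    define g' where "g' \<delta> = (vexp (w \<delta> i) - vexp (w \<beta> i)) \<odot> g \<delta>" for \<delta>
    have g': "g' \<delta> \<in> fspan \<delta>" for \<delta>
      using insert.prems(1)[of \<delta>] unfolding g'_def fspan_def by (rule lin_smul)
    define s where "s = (\<Sum>\<delta>\<in>insert \<beta> B. g \<delta>)"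
    have "k i * s - vexp (w \<beta> i) \<odot> s \<in> S"
      using insert.prems(2) S unfolding s_def by (intro left_ideal_diff left_ideal_smul left_idealD(3)) auto
    moreover have "(\<Sum>\<delta>\<in>insert \<beta> B. k i * g \<delta> - vexp (w \<delta> i) \<odot> g \<delta>) \<in> S"
      using eig by (intro left_ideal_sum[OF S])
    moreover have "(\<Sum>\<delta>\<in>insert \<beta> B. g' \<delta>) = (k i * s - vexp (w \<beta> i) \<odot> s)
        - (\<Sum>\<delta>\<in>insert \<beta> B. k i * g \<delta> - vexp (w \<delta> i) \<odot> g \<delta>)"
      unfolding s_def g'_def by (simp only: smul_diff_left sum_subtractf sum_distrib_left smul_sum_right) simp
    ultimately have "(\<Sum>\<delta>\<in>insert \<beta> B. g' \<delta>) \<in> S" using left_ideal_diff[OF S] by simp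
    then have "(\<Sum>\<delta>\<in>B. g' \<delta>) \<in> S" using insert.hyps by (simp add: g'_def)
    from insert.IH[OF g' this] \<gamma> have "g' \<gamma> \<in> S" by blast
    moreover have "vexp (w \<gamma> i) - vexp (w \<beta> i) \<noteq> 0" using i by (simp add: vexp_inj w_def)
    ultimately show ?thesis unfolding g'_def using left_ideal_smul_iff[OF S] by blast
  qed
  then have "(\<Sum>\<gamma>\<in>B. g \<gamma>) \<in> S" by (intro left_ideal_sum[OF S])
  with insert.prems(2) insert.hyps have "g \<beta> + (\<Sum>\<gamma>\<in>B. g \<gamma>) - (\<Sum>\<gamma>\<in>B. g \<gamma>) \<in> S"
    by (intro left_ideal_diff[OF S]) auto
  with 1 show ?case by simp
qed

lemma casimir_fw:
  assumes "set js \<subseteq> {m..<n}"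
  shows "casimir m n * fw js = fw js * casimir m n"
  using assms
proof (induction js)
  case (Cons j js)
  then have "casimir m n * f j = f j * casimir m n" by (intro casimir_f) auto
  then show ?case using Cons by simp (metis mult.assoc)
qed simp

lemma casimir_fspan:
  assumes "y \<in> fspan \<beta>" "set_mset \<beta> \<subseteq> {m..<n}"
  shows "casimir m n * y = y * casimir m n"
  using assms(1) unfolding fspan_def
proof (induction y rule: lin.induct)
  case (lin_step x y c)
  then have "casimir m n * x = x * casimir m n" using casimir_fw assms(2) by auto
  with lin_step.IH show ?case by (simp add: algebra_simps)
qed simp

lemma one_in_left_ideal:
  assumes N: "left_ideal N" and one: "singular N 1 lam"
    and N': "left_ideal N'" "N \<subseteq> N'" and nilp: "\<And>i. \<exists>n. f i ^ n \<in> N'"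
    and S: "left_ideal S" "N \<subseteq> S" "\<not> S \<subseteq> N'"
  shows "1 \<in> S"
proof -
  \<comment> \<open>Homogeneous elements of \<open>U^-\<close> are used because the E_i lower their
    degree and because their weight is known from it.\<close>
  define P where "P n \<longleftrightarrow> (\<exists>\<beta> y. size \<beta> = n \<and> y \<in> fspan \<beta> \<and> y \<in> S \<and> y \<notin> N')" for n
  have "\<exists>n. P n"
  proof -
    obtain x where x: "x \<in> S" "x \<notin> N'" using S(3) by blast
    obtain y where y: "y \<in> lin (range fw)" "x - y \<in> N" using decompose_lin[OF N one] by blast
    obtain B g where B: "finite B" "\<And>\<beta>. g \<beta> \<in> fspan \<beta>" and yB: "y = (\<Sum>\<beta>\<in>B. g \<beta>)"
      using lin_fw_decompose[OF y(1)] by blast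
    have yS: "y \<in> S" and yN': "y \<notin> N'"
      using y(2) x S(1,2) N' left_ideal_cong[of S x y] left_ideal_cong[of N' x y] by blast+
    have "eigen S 1 lam" using one S(2) by (auto simp: singular_def eigen_def)
    from weight_components[OF S(1) this B] yS yB have "\<forall>\<beta>\<in>B. g \<beta> \<in> S" by blast
    moreover have "\<exists>\<beta>\<in>B. g \<beta> \<notin> N'" using yN' left_ideal_sum[OF N'(1), of B g] yB by blast
    ultimately show ?thesis using B(2) unfolding P_def by blast
  qed
  define n where "n = (LEAST n. P n)"
  have "P n" unfolding n_def using \<open>\<exists>n. P n\<close> by (rule LeastI_ex)
  then obtain \<beta> y where \<beta>: "size \<beta> = n" and y: "y \<in> fspan \<beta>" "y \<in> S" "y \<notin> N'" unfolding P_def by blast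
  have min: "z \<in> N'" if "z \<in> fspan \<gamma>" "z \<in> S" "size \<gamma> < n" for z \<gamma>
    using not_less_Least[of "size \<gamma>" P] that unfolding n_def P_def by blast
  show ?thesis
  proof (cases "\<beta> = {#}")
    case True
    then obtain c where c: "y = c \<odot> 1" using fspan_empty y(1) by blast
    then have "c \<noteq> 0" using y(3) left_idealD(1)[OF N'(1)] by auto
    then show ?thesis using y(2) left_ideal_smul_iff[OF S(1)] unfolding c by blast
  next
    case False
    \<comment> \<open>Modulo \<open>N\<close>, E_i y has smaller degree and still lies in
      \<open>S\<close>, so minimality puts it into \<open>N'\<close>. This makes \<open>y\<close>
      singular modulo \<open>N'\<close>.\<close>
    have ey: "e i * y \<in> N'" for i
    proof -
      obtain z where z: "z \<in> lin {fw ks | ks. add_mset i (mset ks) = \<beta>}" "e i * y - z \<in> N"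
        using e_fspan[OF N one y(1)] by blast
      have "z \<in> S" using z(2) S(2) left_idealD(3)[OF S(1) y(2), of "e i"] left_ideal_cong[OF S(1), of "e i * y" z] by blast
      have "z \<in> N'"
      proof (cases "i \<in># \<beta>")
        case True
        then obtain \<gamma> where \<gamma>: "\<beta> = add_mset i \<gamma>" by (auto dest: multi_member_split)
        then have "z \<in> fspan \<gamma>" using z(1) by (simp add: fspan_def)
        then show ?thesis using min \<open>z \<in> S\<close> \<beta> \<gamma> by auto
      next
        case False
        then have *: "{fw ks | ks. add_mset i (mset ks) = \<beta>} = {}" by auto
        from z(1) have "z = 0" unfolding * by (cases rule: lin.cases) auto
        then show ?thesis using left_idealD(1)[OF N'(1)] by simp
      qed
      then show ?thesis using z(2) N' left_ideal_cong[OF N'(1), of "e i * y" z] by blast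
    qed
    define \<mu> where "\<mu> = (\<lambda>i. lam i + wshift \<beta> i)"
    have "eigen N y \<mu>" using fspan_eigen[OF N _ y(1)] one by (simp add: singular_def \<mu>_def)
    then have sing: "singular N' y \<mu>" using N'(2) ey by (auto simp: singular_def eigen_def)
    have dom: "\<mu> (i + 1) \<le> \<mu> i" for i
    proof -
      obtain p where "f i ^ p \<in> N'" using nilp by blast
      from f_nilpotent_lin[OF N'(1) this y(1)[unfolded fspan_def]]
      show ?thesis using singular_dominant[OF N'(1) sing y(3)] by blast
    qed
    \<comment> \<open>At the smallest letter \<open>a\<close> no F_(a-1) compensates the loss, which
      gives \<mu> a < lam a. The interval ends at one above the largest letter, since F_j involves
      the positions j and j + 1.\<close>
    define a where "a = Min (set_mset \<beta>)"
    define b where "b = Max (set_mset \<beta>) + 1"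
    have a: "a \<in># \<beta>" using False by (auto simp: a_def)
    have ab: "set_mset \<beta> \<subseteq> {a..<b}" by (auto simp: a_def b_def le_imp_less_Suc zle_add1_eq_le)
    define c where "c \<nu> = (\<Sum>j\<in>{a..b}. vexp (2 * (\<nu> j - j)))" for \<nu>
    \<comment> \<open>The Casimir element moves to the right of \<open>y\<close> and acts on the
      highest weight vector, with the eigenvalue of \<open>lam\<close>. The other evaluation treats
      \<open>y\<close> itself as a singular vector and gives the eigenvalue of
      \<open>\<mu>\<close>.\<close>
    have "y * (casimir a b * 1 - c lam \<odot> 1) \<in> N'"
      using casimir_singular[OF N one, of a b] N' unfolding c_def by (blast intro: left_idealD)
    then have 1: "casimir a b * y - c lam \<odot> y \<in> N'"
      using casimir_fspan[OF y(1) ab] by (simp add: right_diff_distrib)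
    have "casimir a b * y - c \<mu> \<odot> y \<in> N'"
      using casimir_singular[OF N'(1) sing, of a b] unfolding c_def .
    from left_ideal_diff[OF N'(1) this 1] have "(c lam - c \<mu>) \<odot> y \<in> N'" by (simp add: smul_diff_left)
    then have "c lam = c \<mu>" using y(3) left_ideal_smul_iff[OF N'(1), of "c lam - c \<mu>" y] by auto
    then have "card {j \<in> {a..b}. 2 * (lam j - j) = 2 * (lam a - a)} = card {j \<in> {a..b}. 2 * (\<mu> j - j) = 2 * (lam a - a)}"
      unfolding c_def vexp_def by (intro sum_qv_powi_eq_card) auto
    moreover have aa: "a \<in> {j \<in> {a..b}. 2 * (lam j - j) = 2 * (lam a - a)}" using a ab by auto
    \<comment> \<open>The exponent which \<open>lam\<close> has at \<open>a\<close> is absent on the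
      side of \<open>\<mu>\<close>: by dominance \<mu> j - j is largest at j = a, and there it is
      already too small.\<close>
    moreover have none: "{j \<in> {a..b}. 2 * (\<mu> j - j) = 2 * (lam a - a)} = {}"
    proof -
      have "\<mu> a < lam a"
      proof -
        have "a - 1 \<notin># \<beta>" using ab by auto
        moreover have "count \<beta> a > 0" using a by simp
        ultimately show ?thesis by (simp add: \<mu>_def wshift_def not_in_iff)
      qed
      moreover have "\<mu> j \<le> \<mu> a" if "a \<le> j" for j
        using that by (induction j rule: int_ge_induct) (use dom order_trans in blast)+
      ultimately show ?thesis by force
    qed
    ultimately have "card {j \<in> {a..b}. 2 * (lam j - j) = 2 * (lam a - a)} = 0"
      by (simp only: none card.empty)
    then have "{j \<in> {a..b}. 2 * (lam j - j) = 2 * (lam a - a)} = {}"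
      by (subst (asm) card_0_eq) (rule finite_subset[of _ "{a..b}"], auto)
    with aa show ?thesis by blast
  qed
qed

text \<open>Since the E_i shorten words over a singular vector (\<open>e_fw\<close>), the
  \<open>U^-\<close> span of such vectors plus \<open>N\<close> is stable under all of U. This is
  how I(\<lambda>), a sum over \<open>U^-\<close>, is recognised as a submodule.\<close>

lemma singular_span_left_ideal:
  assumes N: "left_ideal N" and Y: "\<And>y. y \<in> Y \<Longrightarrow> \<exists>\<mu>. singular N y \<mu>"
  defines "X \<equiv> {fw js * y | js y. y \<in> Y}"
  shows "left_ideal {x. \<exists>y\<in>lin X. x - y \<in> N}" (is "left_ideal ?T")
proof -
  \<comment> \<open>As \<open>N\<close> is a left ideal, stability under a fixed \<open>a\<close>
    has to be tested only on the spanning elements.\<close>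
  have step: "a * x \<in> ?T" if gen: "\<And>js y. y \<in> Y \<Longrightarrow> a * (fw js * y) \<in> ?T" and x: "x \<in> ?T" for a x
  proof -
    have *: "a * y \<in> ?T" if "y \<in> lin X" for y
      using that
    proof (induction y rule: lin.induct)
      case lin_0
      then show ?case using left_idealD(1)[OF N] by (auto intro!: bexI[of _ 0] lin.lin_0)
    next
      case (lin_step u v c)
      from lin_step(1) gen obtain u' where u': "u' \<in> lin X" "a * u - u' \<in> N" unfolding X_def by blast
      from lin_step.IH obtain v' where v': "v' \<in> lin X" "a * v - v' \<in> N" by blast
      have "c \<odot> (a * u - u') + (a * v - v') \<in> N"
        using left_idealD(2)[OF N left_ideal_smul[OF N u'(2)] v'(2)] .
      then show ?case using lin_add[OF lin_smul[OF u'(1), of c] v'(1)]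
        by (auto simp: algebra_simps intro!: bexI[of _ "c \<odot> u' + v'"])
    qed
    from x obtain y where y: "y \<in> lin X" "x - y \<in> N" by blast
    from *[OF y(1)] obtain z where z: "z \<in> lin X" "a * y - z \<in> N" by blast
    show ?thesis using left_idealD(2)[OF N left_idealD(3)[OF N y(2), of a] z(2)] z(1)
      by (auto simp: algebra_simps intro!: bexI[of _ z])
  qed
  have inX: "fw js * y \<in> lin X" if "y \<in> Y" for js y using that unfolding X_def by (intro lin_base) blast
  have eig: "\<exists>c. a * (fw js * y) - c \<odot> (fw js * y) \<in> N" if "y \<in> Y" "a = k i \<or> a = l i" for js y a i
  proof -
    from Y[OF that(1)] obtain \<mu> where "eigen N y \<mu>" by (auto simp: singular_def)
    from fw_eigen[OF N this, of js] eigen_l[OF N fw_eigen[OF N this], of i js] that(2)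
    show ?thesis by (auto simp: eigen_def)
  qed
  have add: "x + y \<in> ?T" if "x \<in> ?T" "y \<in> ?T" for x y
  proof -
    from that obtain x' y' where *: "x' \<in> lin X" "y' \<in> lin X" "x - x' \<in> N" "y - y' \<in> N" by blast
    from left_idealD(2)[OF N *(3,4)] lin_add[OF *(1,2)] show ?thesis
      by (auto simp: algebra_simps intro!: bexI[of _ "x' + y'"])
  qed
  have smul: "c \<odot> x \<in> ?T" if "x \<in> ?T" for c x
  proof -
    from that obtain x' where *: "x' \<in> lin X" "x - x' \<in> N" by blast
    then show ?thesis using lin_smul[OF *(1), of c] left_ideal_smul[OF N *(2), of c]
      by (auto intro!: bexI[of _ "c \<odot> x'"])
  qed
  have "a * x \<in> ?T" if x: "x \<in> ?T" for a x
  proof (induction a rule: gen_induct)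
    case 1
    then show ?case using x by simp
  next
    case (2 a b)
    then show ?case using add by (simp add: distrib_right del: mem_Collect_eq)
  next
    case (3 c a)
    then show ?case using smul by (simp del: mem_Collect_eq)
  next
    case (4 i a)
    have "e i * (fw js * y) \<in> ?T" if "y \<in> Y" for js y
    proof -
      from Y[OF that] obtain \<mu> where "singular N y \<mu>" by blast
      from e_fw[OF N this, of i js] obtain z
        where z: "z \<in> lin {fw ks | ks. add_mset i (mset ks) = mset js}" "e i * (fw js * y) - z * y \<in> N" by blast
      have "z * y \<in> lin X" using z(1)
      proof (induction z rule: lin.induct)
        case (lin_step u v c)
        then obtain ks where "u = fw ks" by blast
        with lin_add[OF lin_smul[OF inX[OF that, of ks], of c] lin_step.IH] show ?case
          by (simp add: distrib_right)
      qed (simp add: lin_0)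
      then show ?thesis using z(2) by blast
    qed
    from step[of "e i", OF this 4] show ?case by (simp add: mult.assoc)
  next
    case (5 i a)
    have "f i * (fw js * y) \<in> ?T" if "y \<in> Y" for js y
      using inX[OF that, of "i # js"] left_idealD(1)[OF N] by (auto simp: mult.assoc intro!: bexI)
    from step[of "f i", OF this 5] show ?case by (simp add: mult.assoc)
  next
    case (6 i a)
    have "k i * (fw js * y) \<in> ?T" if "y \<in> Y" for js y
      using eig[OF that, of "k i" i js] lin_smul[OF inX[OF that]] by blast
    from step[of "k i", OF this 6] show ?case by (simp add: mult.assoc)
  next
    case (7 i a)
    have "l i * (fw js * y) \<in> ?T" if "y \<in> Y" for js y
      using eig[OF that, of "l i" i js] lin_smul[OF inX[OF that]] by blast
    from step[of "l i", OF this 7] show ?case by (simp add: mult.assoc)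
  qed
  moreover have "0 \<in> ?T" using left_idealD(1)[OF N] by (auto intro!: bexI[of _ 0] lin_0)
  ultimately show ?thesis unfolding left_ideal_def using add by blast
qed

end

section \<open>The free algebra\<close>

lemma fa_simps: "fadd p q w = p w + q w" "fsub p q w = p w - q w" "fscale c p w = c * p w" "fzero w = 0"
  "mon u w = (if w = u then 1 else 0)"
  by (simp_all add: fadd_def fsub_def fscale_def fzero_def mon_def)

lemma FA_fzero [simp]: "fzero \<in> FA" by (simp add: FA_def fzero_def)

lemma FA_mon [simp]: "mon u \<in> FA" by (simp add: FA_def mon_def)

lemma FA_fadd [simp]: "p \<in> FA \<Longrightarrow> q \<in> FA \<Longrightarrow> fadd p q \<in> FA"
  unfolding FA_def fadd_def mem_Collect_eq
  by (rule finite_subset[of _ "{w. p w \<noteq> 0} \<union> {w. q w \<noteq> 0}"]) auto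

lemma FA_fscale [simp]: "p \<in> FA \<Longrightarrow> fscale c p \<in> FA"
  unfolding FA_def fscale_def mem_Collect_eq
  by (rule finite_subset[of _ "{w. p w \<noteq> 0}"]) auto

lemma fsub_eq: "fsub p q = fadd p (fscale (- 1) q)"
  by (rule ext) (simp add: fa_simps)

lemma FA_fsub [simp]: "p \<in> FA \<Longrightarrow> q \<in> FA \<Longrightarrow> fsub p q \<in> FA"
  by (simp add: fsub_eq)

lemma FA_cst [simp]: "cst c \<in> FA" by (simp add: cst_def)

lemma FA_induct [consumes 1, case_names mon add scale]:
  assumes "p \<in> FA" and mon: "\<And>w. P (mon w)"
    and add: "\<And>x y. x \<in> FA \<Longrightarrow> y \<in> FA \<Longrightarrow> P x \<Longrightarrow> P y \<Longrightarrow> P (fadd x y)"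
    and scale: "\<And>c x. x \<in> FA \<Longrightarrow> P x \<Longrightarrow> P (fscale c x)"
  shows "P p"
proof -
  have "P p" if "finite A" "{w. p w \<noteq> 0} \<subseteq> A" for A
    using that
  proof (induction A arbitrary: p rule: finite_induct)
    case empty
    \<comment> \<open>The induction rule has no case for zero, which is therefore reached as a
      multiple of the empty word.\<close>
    then have "p = fscale 0 (mon [])" by (auto simp: fa_simps)
    then show ?case using scale[of "mon []" 0] mon by simp
  next
    case (insert a A)
    define q where "q = p(a := 0)"
    have q: "{w. q w \<noteq> 0} \<subseteq> A" using insert.prems by (auto simp: q_def)
    then have "q \<in> FA" using insert.hyps by (auto simp: FA_def intro: finite_subset)
    moreover have "p = fadd q (fscale (p a) (mon a))" by (auto simp: fa_simps q_def)
    ultimately show ?case using add[of q "fscale (p a) (mon a)"] scale[of "mon a"] insert.IH[OF q] mon by simp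
  qed
  then show ?thesis using assms(1) by (auto simp: FA_def)
qed

lemma fmul_fadd_left: "fmul (fadd p q) r = fadd (fmul p r) (fmul q r)"
  by (simp add: fmul_def fadd_def distrib_right sum.distrib)

lemma fmul_fadd_right: "fmul r (fadd p q) = fadd (fmul r p) (fmul r q)"
  by (simp add: fmul_def fadd_def distrib_left sum.distrib)

lemma fmul_fscale_left: "fmul (fscale c p) q = fscale c (fmul p q)"
  by (simp add: fmul_def fscale_def sum_distrib_left mult.assoc)

lemma fmul_fscale_right: "fmul p (fscale c q) = fscale c (fmul p q)"
  by (simp add: fmul_def fscale_def sum_distrib_left mult.left_commute)

lemma fmul_fsub_left: "fmul (fsub p q) r = fsub (fmul p r) (fmul q r)"
  by (simp add: fsub_eq fmul_fadd_left fmul_fscale_left)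

lemma fmul_fsub_right: "fmul r (fsub p q) = fsub (fmul r p) (fmul r q)"
  by (simp add: fsub_eq fmul_fadd_right fmul_fscale_right)

lemma fmul_mon_mon [simp]: "fmul (mon u) (mon v) = mon (u @ v)"
proof
  fix w
  \<comment> \<open>Among all cuts of \<open>w\<close>, only the one after \<open>length u\<close>
    letters can contribute.\<close>
  have "fmul (mon u) (mon v) w = (\<Sum>i\<le>length w. if i = length u then (if w = u @ v then 1 else 0) else 0)"
    unfolding fmul_def mon_def
  proof (intro sum.cong refl)
    fix i assume "i \<in> {..length w}"
    then have "length (take i w) = i" by simp
    then have "i = length u \<and> w = u @ v" if "take i w = u" "drop i w = v"
      using that append_take_drop_id[of i w] by simp
    moreover have "take i w = u \<and> drop i w = v" if "i = length u" "w = u @ v"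
      using that by simp
    ultimately have *: "take i w = u \<and> drop i w = v \<longleftrightarrow> i = length u \<and> w = u @ v" by blast
    have "(if take i w = u then 1 else 0) * (if drop i w = v then 1 else (0::qf))
        = (if take i w = u \<and> drop i w = v then 1 else 0)" by simp
    also have "\<dots> = (if i = length u then (if w = u @ v then 1 else 0) else 0)"
      unfolding * by simp
    finally show "(if take i w = u then 1 else 0) * (if drop i w = v then 1 else (0::qf)) = \<dots>" .
  qed
  then show "fmul (mon u) (mon v) w = mon (u @ v) w" by (auto simp: mon_def)
qed

lemma FA_fmul [simp]: "p \<in> FA \<Longrightarrow> q \<in> FA \<Longrightarrow> fmul p q \<in> FA"
proof (induction p rule: FA_induct)
  case (mon w)
  from mon show ?case by (induction q rule: FA_induct) (simp_all add: fmul_fadd_right fmul_fscale_right)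
qed (simp_all add: fmul_fadd_left fmul_fscale_left)

lemma fmul_assoc:
  assumes "p \<in> FA" "q \<in> FA" "r \<in> FA"
  shows "fmul (fmul p q) r = fmul p (fmul q r)"
  using assms(1)
proof (induction p rule: FA_induct)
  case (mon u)
  from assms(2) show ?case
  proof (induction q rule: FA_induct)
    case (mon v)
    from assms(3) show ?case
      by (induction r rule: FA_induct) (simp_all add: fmul_fadd_right fmul_fscale_right)
  qed (simp_all add: fmul_fadd_left fmul_fscale_left fmul_fadd_right fmul_fscale_right)
qed (simp_all add: fmul_fadd_left fmul_fscale_left)

lemma fmul_one_left [simp]: "p \<in> FA \<Longrightarrow> fmul (mon []) p = p"
  by (induction p rule: FA_induct) (simp_all add: fmul_fadd_right fmul_fscale_right)

lemma fmul_one_right [simp]: "p \<in> FA \<Longrightarrow> fmul p (mon []) = p"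
  by (induction p rule: FA_induct) (simp_all add: fmul_fadd_left fmul_fscale_left)

lemma fmul_cst: "p \<in> FA \<Longrightarrow> fmul (cst c) p = fscale c p"
  by (simp add: cst_def fmul_fscale_left)

lemma fmul_fzero_right [simp]: "fmul p fzero = fzero"
  by (simp add: fmul_def fzero_def)

lemma An_FA: "p \<in> An n \<Longrightarrow> p \<in> FA" by (simp add: An_def)

lemma An_fadd: "p \<in> An n \<Longrightarrow> q \<in> An n \<Longrightarrow> fadd p q \<in> An n"
  by (auto simp: An_def fa_simps) (metis add_0)+

lemma An_fscale: "p \<in> An n \<Longrightarrow> fscale c p \<in> An n"
  by (auto simp: An_def fa_simps)

lemma An_mon: "mon w \<in> An n \<longleftrightarrow> (\<forall>g\<in>set w. in_rng n g)"
  by (auto simp: An_def fa_simps)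

lemma An_fzero: "fzero \<in> An n" by (simp add: An_def fa_simps)

lemma An_cst: "cst c \<in> An n" by (simp add: cst_def An_fscale An_mon)

lemma An_fmul: "p \<in> An n \<Longrightarrow> q \<in> An n \<Longrightarrow> fmul p q \<in> An n"
proof -
  assume p: "p \<in> An n" and q: "q \<in> An n"
  have "\<forall>g\<in>set w. in_rng n g" if "fmul p q w \<noteq> 0" for w
  proof -
    from that obtain i where "i \<le> length w" "p (take i w) * q (drop i w) \<noteq> 0"
      unfolding fmul_def by (meson atMost_iff sum.neutral)
    then have "\<forall>g\<in>set (take i w). in_rng n g" "\<forall>g\<in>set (drop i w). in_rng n g"
      using p q by (auto simp: An_def)
    then show ?thesis by (metis Un_iff append_take_drop_id set_append)
  qed
  then show ?thesis using p q by (simp add: An_def)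
qed

lemma in_rng_mono: "in_rng n g \<Longrightarrow> n \<le> k \<Longrightarrow> in_rng k g"
  by (auto simp: in_rng_def split: gen.splits)

lemma An_mono: "n \<le> k \<Longrightarrow> An n \<subseteq> An k"
  by (auto simp: An_def intro: in_rng_mono)

lemma in_rng_gidx: "gidx g \<le> n \<Longrightarrow> in_rng n g"
  by (cases g) (auto simp: in_rng_def gidx_def)

lemma FA_An: "p \<in> FA \<Longrightarrow> \<exists>n\<ge>1. p \<in> An n"
proof (induction p rule: FA_induct)
  case (mon w)
  define n where "n = max 1 (Max (insert 0 (gidx ` set w)))"
  have "gidx g \<le> n" if "g \<in> set w" for g
    unfolding n_def using that by (intro max.coboundedI2 Max_ge) auto
  then have "mon w \<in> An n" using in_rng_gidx by (auto simp: An_mon)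
  then show ?case by (intro exI[of _ n]) (simp add: n_def)
next
  case (add x y)
  then obtain n m where "1 \<le> n" "x \<in> An n" "y \<in> An m" by blast
  then have "fadd x y \<in> An (max n m)"
    using An_mono[of n "max n m"] An_mono[of m "max n m"] by (intro An_fadd) auto
  then show ?case using \<open>1 \<le> n\<close> by (intro exI[of _ "max n m"]) auto
qed (auto intro: An_fscale)

section \<open>Ideals of the free algebra\<close>

lemma lidealD:
  assumes "lideal R I"
  shows "I \<subseteq> R" "fzero \<in> I" "x \<in> I \<Longrightarrow> y \<in> I \<Longrightarrow> fadd x y \<in> I"
    "a \<in> R \<Longrightarrow> x \<in> I \<Longrightarrow> fmul a x \<in> I"
  using assms by (auto simp: lideal_def)

lemma lideal_fscale: "lideal R I \<Longrightarrow> R \<subseteq> FA \<Longrightarrow> cst c \<in> R \<Longrightarrow> x \<in> I \<Longrightarrow> fscale c x \<in> I"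
  using fmul_cst[of x c] lidealD(1)[of R I] lidealD(4)[of R I "cst c" x] by auto

lemma lideal_fsub: "lideal R I \<Longrightarrow> R \<subseteq> FA \<Longrightarrow> cst (- 1) \<in> R \<Longrightarrow> x \<in> I \<Longrightarrow> y \<in> I \<Longrightarrow> fsub x y \<in> I"
  unfolding fsub_eq by (intro lidealD(3) lideal_fscale)

lemma lideal_An: "lideal (An n) (An n)"
  by (simp add: lideal_def An_fzero An_fadd An_fmul)

lemma lideal_FA: "lideal FA FA"
  by (simp add: lideal_def)

lemma lideal_lgen:
  assumes "lideal R R" "S \<subseteq> R"
  shows "lideal R (lgen R S)" "S \<subseteq> lgen R S"
  using assms unfolding lgen_def lideal_def by auto

lemma lgen_minimal: "lideal R I \<Longrightarrow> S \<subseteq> I \<Longrightarrow> lgen R S \<subseteq> I"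
  unfolding lgen_def by blast

lemma tideal_tgen:
  assumes "S \<subseteq> FA"
  shows "tideal (tgen S)" "S \<subseteq> tgen S"
proof -
  have "tideal FA" by (simp add: tideal_def lideal_FA)
  then show "tideal (tgen S)"
    using assms unfolding tgen_def tideal_def[of "\<Inter>_"] lideal_def by (auto simp: tideal_def lideal_def)
  show "S \<subseteq> tgen S" unfolding tgen_def by blast
qed

lemma tgen_minimal: "tideal I \<Longrightarrow> S \<subseteq> I \<Longrightarrow> tgen S \<subseteq> I"
  unfolding tgen_def by blast

lemma Rels_FA: "Rels \<subseteq> FA"
  by (auto simp: Rels_def)

lemma tideal_Jrel: "tideal Jrel"
  unfolding Jrel_def using Rels_FA by (rule tideal_tgen)

lemma lideal_Jrel: "lideal FA Jrel"
  using tideal_Jrel by (simp add: tideal_def)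

lemma Rels_Jrel: "r \<in> Rels \<Longrightarrow> r \<in> Jrel"
  using tideal_tgen(2)[OF Rels_FA] by (auto simp: Jrel_def)

lemma Jrel_fscale: "x \<in> Jrel \<Longrightarrow> fscale c x \<in> Jrel"
  using lideal_fscale[OF lideal_Jrel] by simp

lemma Jrel_fsub: "x \<in> Jrel \<Longrightarrow> y \<in> Jrel \<Longrightarrow> fsub x y \<in> Jrel"
  using lideal_fsub[OF lideal_Jrel] by simp

lemma Jrel_FA: "x \<in> Jrel \<Longrightarrow> x \<in> FA"
  using lidealD(1)[OF lideal_Jrel] by auto

definition NMgens :: "(int \<Rightarrow> int) \<Rightarrow> fa set" where
  "NMgens lam = Jrel \<union> {mon [E i] | i. True} \<union> {fsub (mon [K i]) (cst (vexp (lam i))) | i. True}"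

lemma NMgens_FA: "NMgens lam \<subseteq> FA"
  by (auto simp: NMgens_def Jrel_FA)

lemma NM_lgen: "NM lam = lgen FA (NMgens lam)"
  by (simp add: NM_def NMgens_def)

lemma lideal_NM: "lideal FA (NM lam)"
  unfolding NM_lgen using lideal_FA NMgens_FA by (rule lideal_lgen)

lemma NMgens_NM: "NMgens lam \<subseteq> NM lam"
  unfolding NM_lgen using lideal_FA NMgens_FA by (rule lideal_lgen)

section \<open>Functionals on the free Verma module\<close>

definition lext :: "(gen list \<Rightarrow> qf) \<Rightarrow> fa \<Rightarrow> qf" where
  "lext G p = (\<Sum>w | p w \<noteq> 0. p w * G w)"

lemma lext_superset:
  assumes "finite A" "{w. p w \<noteq> 0} \<subseteq> A"
  shows "lext G p = (\<Sum>w\<in>A. p w * G w)"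
  unfolding lext_def using assms by (intro sum.mono_neutral_left) auto

lemma lext_fadd [simp]: "p \<in> FA \<Longrightarrow> q \<in> FA \<Longrightarrow> lext G (fadd p q) = lext G p + lext G q"
proof -
  assume "p \<in> FA" "q \<in> FA"
  then have "finite ({w. p w \<noteq> 0} \<union> {w. q w \<noteq> 0})" by (simp add: FA_def)
  from lext_superset[OF this, of _ G] show ?thesis
    by (subst (1 2 3) lext_superset[OF \<open>finite _\<close>]) (auto simp: fa_simps distrib_right sum.distrib)
qed

lemma lext_fscale [simp]: "p \<in> FA \<Longrightarrow> lext G (fscale c p) = c * lext G p"
proof -
  assume "p \<in> FA"
  then have fin: "finite {w. p w \<noteq> 0}" by (simp add: FA_def)
  show ?thesis
    by (subst (1 2) lext_superset[OF fin]) (auto simp: fa_simps sum_distrib_left mult.assoc)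
qed

lemma lext_mon [simp]: "lext G (mon w) = G w"
  by (simp add: lext_def mon_def)

lemma lext_fsub [simp]: "p \<in> FA \<Longrightarrow> q \<in> FA \<Longrightarrow> lext G (fsub p q) = lext G p - lext G q"
  by (simp add: fsub_eq)

lemma lext_mon_fmul: "x \<in> FA \<Longrightarrow> lext G (fmul (mon u) x) = lext (\<lambda>w. G (u @ w)) x"
  by (induction x rule: FA_induct) (simp_all add: fmul_fadd_right fmul_fscale_right)

lemma lext_fmul_mon: "x \<in> FA \<Longrightarrow> lext G (fmul x (mon u)) = lext (\<lambda>w. G (w @ u)) x"
  by (induction x rule: FA_induct) (simp_all add: fmul_fadd_left fmul_fscale_left)

text \<open>The free Verma module has the words \<open>js\<close> (for \<open>F\<^sub>j\<^sub>1 F\<^sub>j\<^sub>2 \<dots>\<close>) as a basis; a function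
  \<open>int list \<Rightarrow> qf\<close> is a functional on it, and the generators act on functionals from the right.
  This avoids forming a quotient by the Serre relations: one restricts to the functionals killing them.\<close>

definition hwt :: "(int \<Rightarrow> int) \<Rightarrow> int list \<Rightarrow> int \<Rightarrow> int" where
  "hwt lam js i = lam i + int (count_list js (i - 1)) - int (count_list js i)"

definition hcar :: "(int \<Rightarrow> int) \<Rightarrow> int list \<Rightarrow> int \<Rightarrow> int" where
  "hcar lam js i = hwt lam js i - hwt lam js (i + 1)"

text \<open>The transpose of E_i: the value of \<open>\<phi>\<close> at E_i applied to the word
  \<open>js\<close>, computed from E_i F_j = F_j E_i + delta_ij [h], where h is the weight of the
  letters to the right. The empty word is the highest weight vector, hence 0.\<close>

primrec eact :: "(int \<Rightarrow> int) \<Rightarrow> int \<Rightarrow> int list \<Rightarrow> (int list \<Rightarrow> qf) \<Rightarrow> qf" where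
  "eact lam i [] \<phi> = 0"
| "eact lam i (j # js) \<phi> = eact lam i js (\<lambda>l. \<phi> (j # l)) + (if i = j then qint (hcar lam js i) * \<phi> js else 0)"

definition ract :: "(int \<Rightarrow> int) \<Rightarrow> (int list \<Rightarrow> qf) \<Rightarrow> gen \<Rightarrow> int list \<Rightarrow> qf" where
  "ract lam \<phi> g js = (case g of E i \<Rightarrow> eact lam i js \<phi> | F i \<Rightarrow> \<phi> (i # js)
     | K i \<Rightarrow> vexp (hwt lam js i) * \<phi> js | Kinv i \<Rightarrow> vexp (- hwt lam js i) * \<phi> js)"

lemma ract_simps [simp]:
  "ract lam \<phi> (E i) = (\<lambda>js. eact lam i js \<phi>)"
  "ract lam \<phi> (F i) = (\<lambda>js. \<phi> (i # js))"
  "ract lam \<phi> (K i) = (\<lambda>js. vexp (hwt lam js i) * \<phi> js)"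
  "ract lam \<phi> (Kinv i) = (\<lambda>js. vexp (- hwt lam js i) * \<phi> js)"
  by (simp_all add: ract_def fun_eq_iff)

lemma eact_sum: "eact lam i js (\<lambda>l. \<Sum>a\<in>A. c a * \<phi> a l) = (\<Sum>a\<in>A. c a * eact lam i js (\<phi> a))"
  by (induction js arbitrary: \<phi>) (simp_all add: sum.distrib distrib_left sum_distrib_left mult.left_commute)

lemma eact_add: "eact lam i js (\<lambda>l. \<phi> l + \<psi> l) = eact lam i js \<phi> + eact lam i js \<psi>"
  by (induction js arbitrary: \<phi> \<psi>) (simp_all add: distrib_left)

lemma eact_cmult: "eact lam i js (\<lambda>l. c * \<phi> l) = c * eact lam i js \<phi>"
  by (induction js arbitrary: \<phi>) (simp_all add: distrib_left mult.left_commute)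

lemma eact_zero [simp]: "eact lam i js (\<lambda>l. 0) = 0"
  using eact_cmult[of lam i js 0] by simp

text \<open>E_i deletes one letter i, so \<open>\<phi>\<close> is read only at words obtained that
  way. All of them have the same weight, which lets weight factors be pulled out as
  constants.\<close>

lemma eact_cong_mset:
  assumes "\<And>l. add_mset i (mset l) = mset js \<Longrightarrow> \<phi> l = c * \<psi> l"
  shows "eact lam i js \<phi> = c * eact lam i js \<psi>"
  using assms
proof (induction js arbitrary: \<phi> \<psi>)
  case (Cons j js)
  have "eact lam i js (\<lambda>l. \<phi> (j # l)) = c * eact lam i js (\<lambda>l. \<psi> (j # l))"
    by (rule Cons.IH) (simp add: Cons.prems add_mset_commute)
  moreover have "\<phi> js = c * \<psi> js" if "i = j" using that Cons.prems[of js] by simp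
  ultimately show ?case by (simp add: distrib_left mult.left_commute)
qed simp

lemma hwt_mset: "mset js = mset ks \<Longrightarrow> hwt lam js = hwt lam ks"
  by (simp add: hwt_def fun_eq_iff flip: count_mset)

lemma hcar_mset: "mset js = mset ks \<Longrightarrow> hcar lam js = hcar lam ks"
  using hwt_mset[of js ks lam] by (simp add: hcar_def fun_eq_iff)

lemma hwt_Cons: "hwt lam (j # js) i = hwt lam js i + delta i (j + 1) - delta i j"
  by (auto simp: hwt_def delta_def)

definition cartan :: "int \<Rightarrow> int \<Rightarrow> int" where
  "cartan i j = (if i = j then 2 else if \<bar>i - j\<bar> = 1 then - 1 else 0)"

lemma hcar_Cons: "hcar lam (j # js) i = hcar lam js i - cartan i j"
  by (auto simp: hcar_def hwt_Cons delta_def cartan_def)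

lemma eact_vexp: "eact lam j js (\<lambda>l. vexp (hwt lam l i) * \<phi> l)
    = vexp (hwt lam js i + delta i j - delta i (j + 1)) * eact lam j js \<phi>"
proof (rule eact_cong_mset)
  fix l assume "add_mset j (mset l) = mset js"
  then have "hwt lam js = hwt lam (j # l)" by (intro hwt_mset) simp
  then show "vexp (hwt lam l i) * \<phi> l = vexp (hwt lam js i + delta i j - delta i (j + 1)) * \<phi> l"
    by (simp add: hwt_Cons)
qed

text \<open>Deleting the letter j raises the weight by the j-th simple root, whence the Cartan
  integer.\<close>

lemma eact_qint_shift: "eact lam j js (\<lambda>l. qint (hcar lam l i + s) * \<phi> l)
    = qint (hcar lam js i + cartan i j + s) * eact lam j js \<phi>"
proof (rule eact_cong_mset)
  fix l assume "add_mset j (mset l) = mset js"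
  then have "hcar lam js = hcar lam (j # l)" by (intro hcar_mset) simp
  then show "qint (hcar lam l i + s) * \<phi> l = qint (hcar lam js i + cartan i j + s) * \<phi> l"
    by (simp add: hcar_Cons)
qed

lemma eact_qint: "eact lam j js (\<lambda>l. qint (hcar lam l i) * \<phi> l)
    = qint (hcar lam js i + cartan i j) * eact lam j js \<phi>"
  using eact_qint_shift[of lam j js i 0] by simp

lemma eact_eact_Cons:
  "eact lam j (a # js) (\<lambda>l. eact lam i l \<phi>)
     = eact lam j js (\<lambda>l. eact lam i l (\<lambda>m. \<phi> (a # m)))
       + (if i = a then qint (hcar lam js i + cartan i j) * eact lam j js \<phi> else 0)
       + (if j = a then qint (hcar lam js j) * eact lam i js \<phi> else 0)"
  by (simp add: eact_add eact_qint)

lemma eact_commute: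
  assumes "\<bar>i - j\<bar> > 1"
  shows "eact lam j js (\<lambda>l. eact lam i l \<phi>) = eact lam i js (\<lambda>l. eact lam j l \<phi>)"
proof (induction js arbitrary: \<phi>)
  case (Cons a js)
  have "cartan i j = 0" "cartan j i = 0" using assms by (auto simp: cartan_def)
  then show ?case unfolding eact_eact_Cons Cons using assms by auto
qed simp

lemma qint_two: "qint (t + 1) + qint (t - 1) = (qv + inverse qv) * qint t"
proof -
  have *: "(x * q - y * p) / D + (x * p - y * q) / D = (q + p) * ((x - y) / D)" for x y p q D :: qf
  proof -
    have "(x * q - y * p) + (x * p - y * q) = (q + p) * (x - y)" by (simp add: algebra_simps)
    then show ?thesis by (simp add: add_divide_distrib[symmetric])
  qed
  have m: "- (t + 1) = - t + - 1" "t - 1 = t + - 1" "- (t + - 1) = - t + 1" for t :: int by auto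
  show ?thesis
    unfolding qint_eq m vexp_add vexp_1 vexp_m1 by (rule *)
qed

lemma eact3_Cons:
  "eact lam x (a # js) (\<lambda>l. eact lam y l (\<lambda>m. eact lam z m \<phi>))
     = eact lam x js (\<lambda>l. eact lam y l (\<lambda>m. eact lam z m (\<lambda>n. \<phi> (a # n))))
       + (if z = a then qint (hcar lam js z + cartan z x + cartan z y) * eact lam x js (\<lambda>l. eact lam y l \<phi>) else 0)
       + (if y = a then qint (hcar lam js y + cartan y x) * eact lam x js (\<lambda>l. eact lam z l \<phi>) else 0)
       + (if x = a then qint (hcar lam js x) * eact lam y js (\<lambda>l. eact lam z l \<phi>) else 0)"
  by (simp add: eact_add eact_qint eact_qint_shift add.assoc)

text \<open>The outermost \<open>eact\<close> acts first on the word, so the first term is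
  \<open>\<phi>\<close> at E_i E_i E_j applied to \<open>js\<close>. The relation holds on the free
  module already: removing the leading letter gives the shorter instance plus quadratic terms, whose
  coefficients cancel by [t + 1] + [t - 1] = [2][t].\<close>

lemma eact_serre:
  assumes "\<bar>i - j\<bar> = 1"
  shows "eact lam j js (\<lambda>l. eact lam i l (\<lambda>m. eact lam i m \<phi>))
    - (qv + inverse qv) * eact lam i js (\<lambda>l. eact lam j l (\<lambda>m. eact lam i m \<phi>))
    + eact lam i js (\<lambda>l. eact lam i l (\<lambda>m. eact lam j m \<phi>)) = 0"
proof (induction js arbitrary: \<phi>)
  case (Cons a js)
  have c: "cartan i j = - 1" "cartan j i = - 1" "cartan i i = 2" and ij: "i \<noteq> j"
    using assms by (auto simp: cartan_def)
  define q2 where "q2 = qv + inverse qv"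
  define h where "h = hcar lam js i"
  define h' where "h' = hcar lam js j"
  define A where "A = eact lam j js (\<lambda>l. eact lam i l \<phi>)"
  define B where "B = eact lam i js (\<lambda>l. eact lam j l \<phi>)"
  define C where "C = eact lam i js (\<lambda>l. eact lam i l \<phi>)"
  have q: "qint (h + 1) + qint (h - 1) = q2 * qint h" "qint (h + 2) + qint h = q2 * qint (h + 1)"
    "qint h' + qint (h' - 2) = q2 * qint (h' - 1)"
    using qint_two[of h] qint_two[of "h + 1"] qint_two[of "h' - 1"] by (simp_all add: q2_def add.commute)
  note IH = Cons[of "\<lambda>m. \<phi> (a # m)", folded q2_def]
  consider "a = i" | "a = j" | "a \<noteq> i" "a \<noteq> j" by blast
  then show ?case
  proof cases
    case 1
    have "eact lam j (a # js) (\<lambda>l. eact lam i l (\<lambda>m. eact lam i m \<phi>))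
      = eact lam j js (\<lambda>l. eact lam i l (\<lambda>m. eact lam i m (\<lambda>n. \<phi> (a # n)))) + qint (h + 1) * A + qint (h - 1) * A"
      using 1 ij unfolding eact3_Cons A_def h_def by (simp add: c add.commute)
    moreover have "eact lam i (a # js) (\<lambda>l. eact lam j l (\<lambda>m. eact lam i m \<phi>))
      = eact lam i js (\<lambda>l. eact lam j l (\<lambda>m. eact lam i m (\<lambda>n. \<phi> (a # n)))) + qint (h + 1) * B + qint h * A"
      using 1 ij unfolding eact3_Cons A_def B_def h_def by (simp add: c add.commute)
    moreover have "eact lam i (a # js) (\<lambda>l. eact lam i l (\<lambda>m. eact lam j m \<phi>))
      = eact lam i js (\<lambda>l. eact lam i l (\<lambda>m. eact lam j m (\<lambda>n. \<phi> (a # n)))) + qint (h + 2) * B + qint h * B"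
      using 1 ij unfolding eact3_Cons B_def h_def by (simp add: c add.commute)
    moreover have "qint (h + 1) * A + qint (h - 1) * A = q2 * (qint h * A)"
      "qint (h + 2) * B + qint h * B = q2 * (qint (h + 1) * B)"
      unfolding mult.assoc[symmetric] q[symmetric] by (simp_all only: distrib_right)
    ultimately show ?thesis using IH unfolding q2_def[symmetric] by (simp add: algebra_simps)
  next
    case 2
    have "eact lam j (a # js) (\<lambda>l. eact lam i l (\<lambda>m. eact lam i m \<phi>))
      = eact lam j js (\<lambda>l. eact lam i l (\<lambda>m. eact lam i m (\<lambda>n. \<phi> (a # n)))) + qint h' * C"
      using 2 ij unfolding eact3_Cons C_def h'_def by (simp add: c)
    moreover have "eact lam i (a # js) (\<lambda>l. eact lam j l (\<lambda>m. eact lam i m \<phi>))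
      = eact lam i js (\<lambda>l. eact lam j l (\<lambda>m. eact lam i m (\<lambda>n. \<phi> (a # n)))) + qint (h' - 1) * C"
      using 2 ij unfolding eact3_Cons C_def h'_def by (simp add: c)
    moreover have "eact lam i (a # js) (\<lambda>l. eact lam i l (\<lambda>m. eact lam j m \<phi>))
      = eact lam i js (\<lambda>l. eact lam i l (\<lambda>m. eact lam j m (\<lambda>n. \<phi> (a # n)))) + qint (h' - 2) * C"
      using 2 ij unfolding eact3_Cons C_def h'_def by (simp add: c)
    moreover have "qint h' * C + qint (h' - 2) * C = q2 * (qint (h' - 1) * C)"
      unfolding mult.assoc[symmetric] q[symmetric] by (simp only: distrib_right)
    ultimately show ?thesis using IH unfolding q2_def[symmetric] by (simp add: algebra_simps)
  next
    case 3
    then show ?thesis using IH unfolding eact3_Cons q2_def by simp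
  qed
qed simp

text \<open>These are the functionals that descend to the quotient of the free algebra on the F_j by
  its two-sided Serre ideal, as prefix and suffix are arbitrary.\<close>

definition serre_free :: "(int list \<Rightarrow> qf) \<Rightarrow> bool" where
  "serre_free \<phi> \<longleftrightarrow> (\<forall>as bs i j. \<bar>i - j\<bar> = 1 \<longrightarrow>
       \<phi> (as @ i # i # j # bs) - (qv + inverse qv) * \<phi> (as @ i # j # i # bs) + \<phi> (as @ j # i # i # bs) = 0)
     \<and> (\<forall>as bs i j. \<bar>i - j\<bar> > 1 \<longrightarrow> \<phi> (as @ i # j # bs) = \<phi> (as @ j # i # bs))"

lemma serre_free_Cons: "serre_free \<phi> \<Longrightarrow> serre_free (\<lambda>l. \<phi> (a # l))"
  unfolding serre_free_def by (intro conjI allI impI; simp flip: append_Cons)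

text \<open>All words of one relation have the same letters, so the factor \<open>c\<close> can be
  taken out. This covers the action of K_i and its inverse.\<close>

lemma serre_free_weight:
  assumes \<phi>: "serre_free \<phi>" and c: "\<And>l m. mset l = mset m \<Longrightarrow> c l = c m"
  shows "serre_free (\<lambda>l. c l * \<phi> l)"
  unfolding serre_free_def
proof (intro conjI allI impI)
  fix as bs :: "int list" and i j :: int
  assume "\<bar>i - j\<bar> = 1"
  then have S: "\<phi> (as @ i # i # j # bs) - (qv + inverse qv) * \<phi> (as @ i # j # i # bs) + \<phi> (as @ j # i # i # bs) = 0"
    using \<phi> by (simp add: serre_free_def)
  have "c (as @ i # j # i # bs) = c (as @ i # i # j # bs)" "c (as @ j # i # i # bs) = c (as @ i # i # j # bs)"
    by (auto intro!: c)
  then have "c (as @ i # i # j # bs) * \<phi> (as @ i # i # j # bs)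
      - (qv + inverse qv) * (c (as @ i # j # i # bs) * \<phi> (as @ i # j # i # bs))
      + c (as @ j # i # i # bs) * \<phi> (as @ j # i # i # bs)
    = c (as @ i # i # j # bs) * (\<phi> (as @ i # i # j # bs) - (qv + inverse qv) * \<phi> (as @ i # j # i # bs) + \<phi> (as @ j # i # i # bs))"
    by (simp only: distrib_left right_diff_distrib mult.left_commute)
  then show "c (as @ i # i # j # bs) * \<phi> (as @ i # i # j # bs)
      - (qv + inverse qv) * (c (as @ i # j # i # bs) * \<phi> (as @ i # j # i # bs))
      + c (as @ j # i # i # bs) * \<phi> (as @ j # i # i # bs) = 0"
    unfolding S by simp
next
  fix as bs :: "int list" and i j :: int
  assume "1 < \<bar>i - j\<bar>"
  moreover have "c (as @ i # j # bs) = c (as @ j # i # bs)" by (auto intro!: c)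
  ultimately show "c (as @ i # j # bs) * \<phi> (as @ i # j # bs) = c (as @ j # i # bs) * \<phi> (as @ j # i # bs)"
    using \<phi> by (simp add: serre_free_def)
qed

text \<open>Dually: E_k maps the Serre ideal of the free Verma module into itself. A letter in front
  of the relation is handled by induction; the content is the case of an empty prefix.\<close>

lemma serre_free_eact_serre:
  assumes "serre_free \<phi>" "\<bar>i - j\<bar> = 1"
  shows "eact lam k (as @ i # i # j # bs) \<phi> - (qv + inverse qv) * eact lam k (as @ i # j # i # bs) \<phi>
     + eact lam k (as @ j # i # i # bs) \<phi> = 0"
  using assms(1)
proof (induction as arbitrary: \<phi>)
  case Nil
  define q2 where "q2 = qv + inverse qv"
  have c: "cartan i j = - 1" "cartan j i = - 1" "cartan i i = 2" and ij: "i \<noteq> j"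
    using assms(2) by (auto simp: cartan_def)
  have S: "\<phi> (i # i # j # l) + \<phi> (j # i # i # l) = q2 * \<phi> (i # j # i # l)" for l
  proof -
    have "\<phi> ([] @ i # i # j # l) - q2 * \<phi> ([] @ i # j # i # l) + \<phi> ([] @ j # i # i # l) = 0"
      using Nil assms(2) unfolding serre_free_def q2_def by blast
    then show ?thesis by (simp add: algebra_simps)
  qed
  define X where "X x y z = eact lam k bs (\<lambda>l. \<phi> (x # y # z # l))" for x y z
  have X: "X i i j + X j i i = q2 * X i j i"
    unfolding X_def eact_add[symmetric] eact_cmult[symmetric] S ..
  define h where "h = hcar lam bs i"
  define h' where "h' = hcar lam bs j"
  have q: "qint (h + 1) + qint (h - 1) = q2 * qint h" "qint h + qint (h - 2) = q2 * qint (h - 1)"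
    "qint h' + qint (h' + 2) = q2 * qint (h' + 1)"
    using qint_two[of h] qint_two[of "h - 1"] qint_two[of "h' + 1"] by (simp_all add: q2_def add.commute)
  have q': "qint (h - 1) * t + qint (h + 1) * t = q2 * (qint h * t)"
     "qint h * t + qint (h - 2) * t = q2 * (qint (h - 1) * t)"
     "qint h' * t + qint (h' + 2) * t = q2 * (qint (h' + 1) * t)" for t
    unfolding mult.assoc[symmetric] q[symmetric] by (simp_all only: distrib_right add.commute)
  \<comment> \<open>\<open>u\<close>, \<open>v\<close> and \<open>w\<close> collect, for each of the
    three words, the terms in which E_k meets one of the three leading letters. By
    \<open>qint_two\<close> they cancel separately at the remaining words i i, i j and j i.\<close>
  define u where "u = (if k = j then qint h' * \<phi> (i # i # bs) else 0)
     + (if k = i then qint (h - 1) * \<phi> (i # j # bs) + qint (h + 1) * \<phi> (i # j # bs) else 0)"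
  define v where "v = (if k = j then qint (h' + 1) * \<phi> (i # i # bs) else 0)
     + (if k = i then qint h * \<phi> (i # j # bs) + qint (h - 1) * \<phi> (j # i # bs) else 0)"
  define w where "w = (if k = j then qint (h' + 2) * \<phi> (i # i # bs) else 0)
     + (if k = i then qint h * \<phi> (j # i # bs) + qint (h - 2) * \<phi> (j # i # bs) else 0)"
  have uvw: "u + w = q2 * v"
    using ij unfolding u_def v_def w_def by (simp add: distrib_left q'[symmetric] add.assoc)
  have 1: "eact lam k (i # i # j # bs) \<phi> = X i i j + u"
    using ij by (simp add: X_def h_def h'_def hcar_Cons c add.commute u_def)
  have 2: "eact lam k (i # j # i # bs) \<phi> = X i j i + v"
    using ij by (simp add: X_def h_def h'_def hcar_Cons c add.commute v_def)
  have 3: "eact lam k (j # i # i # bs) \<phi> = X j i i + w"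
    using ij by (simp add: X_def h_def h'_def hcar_Cons c add.commute w_def)
  have "(X i i j + u) - q2 * (X i j i + v) + (X j i i + w)
      = (X i i j + X j i i - q2 * X i j i) + (u + w - q2 * v)"
    by (simp add: algebra_simps)
  also have "\<dots> = 0" unfolding X uvw by simp
  finally show ?case unfolding append_Nil 1 2 3 q2_def .
next
  case (Cons a as)
  define q2 where "q2 = qv + inverse qv"
  define c where "c = qint (hcar lam (as @ i # i # j # bs) k)"
  have c: "qint (hcar lam (as @ i # j # i # bs) k) = c" "qint (hcar lam (as @ j # i # i # bs) k) = c"
    using hcar_mset[of "as @ i # j # i # bs" "as @ i # i # j # bs" lam]
      hcar_mset[of "as @ j # i # i # bs" "as @ i # i # j # bs" lam] by (simp_all add: c_def)
  have "\<phi> (as @ i # i # j # bs) - q2 * \<phi> (as @ i # j # i # bs) + \<phi> (as @ j # i # i # bs) = 0"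
    using Cons.prems assms(2) unfolding serre_free_def q2_def by blast
  then have "c * (\<phi> (as @ i # i # j # bs) - q2 * \<phi> (as @ i # j # i # bs) + \<phi> (as @ j # i # i # bs)) = 0" by simp
  moreover note Cons.IH[OF serre_free_Cons[OF Cons.prems, of a], folded q2_def]
  ultimately show ?case unfolding append_Cons eact.simps c c_def[symmetric] q2_def[symmetric]
    by (auto simp: algebra_simps)
qed

lemma serre_free_eact_commute:
  assumes "serre_free \<phi>" "\<bar>i - j\<bar> > 1"
  shows "eact lam k (as @ i # j # bs) \<phi> = eact lam k (as @ j # i # bs) \<phi>"
  using assms(1)
proof (induction as arbitrary: \<phi>)
  case Nil
  have c: "cartan i j = 0" "cartan j i = 0" "i \<noteq> j"
    using assms(2) by (auto simp: cartan_def)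
  have "\<phi> ([] @ i # j # l) = \<phi> ([] @ j # i # l)" for l
    using Nil assms(2) unfolding serre_free_def by blast
  then show ?case using c by (simp add: hcar_Cons)
next
  case (Cons a as)
  have "hcar lam (as @ i # j # bs) = hcar lam (as @ j # i # bs)" by (rule hcar_mset) simp
  moreover have "\<phi> (as @ i # j # bs) = \<phi> (as @ j # i # bs)"
    using Cons.prems assms(2) unfolding serre_free_def by blast
  ultimately show ?case using Cons.IH[OF serre_free_Cons[OF Cons.prems, of a]] by simp
qed

lemma serre_free_ract:
  assumes "serre_free \<phi>"
  shows "serre_free (ract lam \<phi> g)"
proof (cases g)
  case (E i)
  show ?thesis unfolding serre_free_def E ract_simps
    using serre_free_eact_serre[OF assms] serre_free_eact_commute[OF assms] by blast
next
  case (F i)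
  then have "ract lam \<phi> g = (\<lambda>l. \<phi> (i # l))" by (auto simp: fun_eq_iff)
  then show ?thesis using serre_free_Cons[OF assms] by simp
next
  case (K i)
  have "serre_free (\<lambda>l. vexp (hwt lam l i) * \<phi> l)"
    using assms by (rule serre_free_weight) (metis hwt_mset)
  then show ?thesis by (simp add: K)
next
  case (Kinv i)
  have "serre_free (\<lambda>l. vexp (- hwt lam l i) * \<phi> l)"
    using assms by (rule serre_free_weight) (metis hwt_mset)
  then show ?thesis by (simp add: Kinv)
qed

text \<open>The value of \<open>\<phi>\<close> at the word \<open>w\<close> applied to
  \<open>js\<close>. Functionals are acted on from the right, so the first letter acts first, hence
  \<open>foldl\<close>.\<close>

definition rw :: "(int \<Rightarrow> int) \<Rightarrow> (int list \<Rightarrow> qf) \<Rightarrow> gen list \<Rightarrow> int list \<Rightarrow> qf" where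
  "rw lam = foldl (ract lam)"

lemma rw_simps [simp]: "rw lam \<phi> [] = \<phi>" "rw lam \<phi> (g # w) = rw lam (ract lam \<phi> g) w"
  "rw lam \<phi> (u @ w) = rw lam (rw lam \<phi> u) w"
  by (simp_all add: rw_def)

lemma serre_free_rw: "serre_free \<phi> \<Longrightarrow> serre_free (rw lam \<phi> w)"
  by (induction w arbitrary: \<phi>) (simp_all add: serre_free_ract)

lemma ract_sum: "ract lam (\<lambda>l. \<Sum>a\<in>A. c a * \<phi> a l) g = (\<lambda>l. \<Sum>a\<in>A. c a * ract lam (\<phi> a) g l)"
  by (cases g) (simp_all add: fun_eq_iff eact_sum sum_distrib_left mult.left_commute)

lemma rw_sum: "rw lam (\<lambda>l. \<Sum>a\<in>A. c a * \<phi> a l) w = (\<lambda>l. \<Sum>a\<in>A. c a * rw lam (\<phi> a) w l)"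
  by (induction w arbitrary: \<phi>) (simp_all add: ract_sum)

text \<open>The kernel of the right action on all functionals. Ranging over every
  \<open>\<phi>\<close> gives stability on the left, ranging over every \<open>js\<close> gives it
  on the right.\<close>

definition annih :: "(int \<Rightarrow> int) \<Rightarrow> fa set" where
  "annih lam = {x \<in> FA. \<forall>\<phi>. serre_free \<phi> \<longrightarrow> (\<forall>js. lext (\<lambda>w. rw lam \<phi> w js) x = 0)}"

lemma tideal_annih: "tideal (annih lam)"
proof -
  have left: "fmul a x \<in> annih lam" if "a \<in> FA" "x \<in> annih lam" for a x
    using that
  proof (induction a rule: FA_induct)
    case (mon u)
    then show ?case using serre_free_rw by (auto simp: annih_def lext_mon_fmul)
  qed (auto simp: annih_def fmul_fadd_left fmul_fscale_left)
  have right: "fmul x a \<in> annih lam" if "a \<in> FA" "x \<in> annih lam" for a x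
    using that
  proof (induction a rule: FA_induct)
    case (mon u)
    have "lext (\<lambda>w. rw lam (rw lam \<phi> w) u js) x = 0" if "serre_free \<phi>" for \<phi> js
    proof -
      have "lext (\<lambda>w. rw lam \<phi> w l) x = 0" for l using mon that by (simp add: annih_def)
      \<comment> \<open>Zero is written as an empty sum, so that \<open>rw_sum\<close> applies to
        both sides and shows that \<open>rw\<close> preserves it.\<close>
      then have "(\<lambda>l. \<Sum>w | x w \<noteq> 0. x w * rw lam \<phi> w l) = (\<lambda>l. \<Sum>w\<in>{}. x w * rw lam \<phi> w l)"
        by (simp add: lext_def)
      then have "rw lam (\<lambda>l. \<Sum>w | x w \<noteq> 0. x w * rw lam \<phi> w l) u = rw lam (\<lambda>l. \<Sum>w\<in>{}. x w * rw lam \<phi> w l) u"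
        by simp
      then have "(\<lambda>l. \<Sum>w | x w \<noteq> 0. x w * rw lam (rw lam \<phi> w) u l) = (\<lambda>l. 0)"
        unfolding rw_sum by simp
      then show ?thesis unfolding lext_def by (rule fun_cong)
    qed
    then show ?case using mon by (auto simp: annih_def lext_fmul_mon)
  qed (auto simp: annih_def fmul_fadd_right fmul_fscale_right)
  have "fadd x y \<in> annih lam" if "x \<in> annih lam" "y \<in> annih lam" for x y
    using that by (auto simp: annih_def)
  moreover have "fzero \<in> annih lam"
    by (simp add: annih_def lext_def fa_simps)
  ultimately show ?thesis using left right
    by (auto simp: tideal_def lideal_def annih_def[of lam] simp del: lext_fadd)
qed


lemma serre_free_head: "serre_free \<phi> \<Longrightarrow> \<bar>i - j\<bar> = 1 \<Longrightarrow>
    \<phi> (j # i # i # bs) - (qv + inverse qv) * \<phi> (i # j # i # bs) + \<phi> (i # i # j # bs) = 0"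
  unfolding serre_free_def by (drule conjunct1) (drule spec[of _ "[]"], simp add: add.commute add_diff_eq)

text \<open>Relations among the E_i hold for every functional (\<open>eact_commute\<close>,
  \<open>eact_serre\<close>), those among the F_i express \<open>serre_free\<close>, and the mixed
  one is the recursion defining \<open>eact\<close>.\<close>

lemma Rels_annih: "Rels \<subseteq> annih lam"
proof
  fix r assume r: "r \<in> Rels"
  then have "r \<in> FA" using Rels_FA by blast
  moreover have "lext (\<lambda>w. rw lam \<phi> w js) r = 0" if \<phi>: "serre_free \<phi>" for \<phi> js
  proof -
    have v: "vexp (- a) * vexp a = 1" "vexp a * vexp (- a) = 1" for a by (simp_all flip: vexp_add)
    show ?thesis
      using r unfolding Rels_def
    proof (elim UnE CollectE exE conjE)
      fix i j assume "r = fsub (mon [K i, K j]) (mon [K j, K i])"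
      then show ?thesis by (simp add: mult.left_commute)
    next
      fix i assume "r = fsub (mon [K i, Kinv i]) (mon [])"
      then show ?thesis by (simp add: v mult.assoc[symmetric])
    next
      fix i assume "r = fsub (mon [Kinv i, K i]) (mon [])"
      then show ?thesis by (simp add: v mult.assoc[symmetric])
    next
      fix i j assume "r = fsub (mon [K i, E j]) (fscale (vexp (delta i j - delta i (j + 1))) (mon [E j, K i]))"
      then have "lext (\<lambda>w. rw lam \<phi> w js) r = vexp (hwt lam js i + delta i j - delta i (j + 1)) * eact lam j js \<phi>
          - vexp (delta i j - delta i (j + 1)) * (vexp (hwt lam js i) * eact lam j js \<phi>)"
        by (simp add: eact_vexp)
      also have "hwt lam js i + delta i j - delta i (j + 1) = (delta i j - delta i (j + 1)) + hwt lam js i" by simp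
      finally show ?thesis by (simp only: vexp_add mult.assoc diff_self)
    next
      fix i j assume "r = fsub (mon [K i, F j]) (fscale (vexp (delta i (j + 1) - delta i j)) (mon [F j, K i]))"
      then have "lext (\<lambda>w. rw lam \<phi> w js) r = vexp (hwt lam js i + delta i (j + 1) - delta i j) * \<phi> (j # js)
          - vexp (delta i (j + 1) - delta i j) * (vexp (hwt lam js i) * \<phi> (j # js))"
        by (simp add: hwt_Cons)
      also have "hwt lam js i + delta i (j + 1) - delta i j = (delta i (j + 1) - delta i j) + hwt lam js i" by simp
      finally show ?thesis by (simp only: vexp_add mult.assoc diff_self)
    next
      fix i j assume "r = fsub (mon [E i, E j]) (mon [E j, E i])" "1 < \<bar>i - j\<bar>"
      then show ?thesis by (simp add: eact_commute)
    next
      fix i j assume "r = fsub (mon [F i, F j]) (mon [F j, F i])" "1 < \<bar>i - j\<bar>"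
      moreover from this(2) have "\<phi> ([] @ i # j # js) = \<phi> ([] @ j # i # js)"
        using \<phi> unfolding serre_free_def by blast
      ultimately show ?thesis by simp
    next
      fix i j assume "r = fsub (fsub (mon [E i, F j]) (mon [F j, E i]))
          (fscale (of_int (delta i j) / (qv - inverse qv)) (fsub (mon [K i, Kinv (i + 1)]) (mon [K (i + 1), Kinv i])))"
      then have "lext (\<lambda>w. rw lam \<phi> w js) r = (if i = j then qint (hcar lam js i) * \<phi> js else 0)
         - of_int (delta i j) / (qv - inverse qv) * (vexp (hwt lam js i) * vexp (- hwt lam js (i + 1)) - vexp (hwt lam js (i + 1)) * vexp (- hwt lam js i)) * \<phi> js"
        by (simp only: lext_fsub lext_fscale lext_mon FA_fsub FA_fscale FA_mon rw_simps ract_simps eact.simps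
            mult.assoc left_diff_distrib right_diff_distrib add_diff_cancel_left') (simp only: mult.left_commute)
      also have "vexp (hwt lam js i) * vexp (- hwt lam js (i + 1)) - vexp (hwt lam js (i + 1)) * vexp (- hwt lam js i)
          = vexp (hcar lam js i) - vexp (- hcar lam js i)"
        by (simp add: hcar_def flip: vexp_add)
      finally show ?thesis by (simp add: delta_def qint_eq)
    next
      fix i j assume "r = fadd (fsub (mon [E i, E i, E j]) (fscale (qv + inverse qv) (mon [E i, E j, E i]))) (mon [E j, E i, E i])"
        "\<bar>i - j\<bar> = 1"
      then show ?thesis using eact_serre[of i j lam js \<phi>] by simp
    next
      fix i j assume "r = fadd (fsub (mon [F i, F i, F j]) (fscale (qv + inverse qv) (mon [F i, F j, F i]))) (mon [F j, F i, F i])"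
        "\<bar>i - j\<bar> = 1"
      then show ?thesis using serre_free_head[OF \<phi>, of i j js] by simp
    qed
  qed
  ultimately show "r \<in> annih lam" by (simp add: annih_def)
qed

text \<open>The coefficient of the empty word in the result of applying an element to the highest
  weight vector.\<close>

definition vac :: "(int \<Rightarrow> int) \<Rightarrow> fa \<Rightarrow> qf" where
  "vac lam = lext (\<lambda>w. rw lam (\<lambda>l. if l = [] then 1 else 0) w [])"

lemma vac_NM:
  assumes "x \<in> NM lam"
  shows "vac lam x = 0"
proof -
  \<comment> \<open>Evaluation at \<open>[]\<close> alone describes the annihilator of the highest
    weight vector: a left ideal that contains E_i and K_i - v^(\<lambda>_i), unlike the kernel
    \<open>annih\<close>, which tests all words.\<close>
  define I where "I = {x \<in> FA. \<forall>\<phi>. serre_free \<phi> \<longrightarrow> lext (\<lambda>w. rw lam \<phi> w []) x = 0}"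
  have "fmul a x \<in> I" if "a \<in> FA" "x \<in> I" for a x
    using that
  proof (induction a rule: FA_induct)
    case (mon u)
    then show ?case using serre_free_rw by (auto simp: I_def lext_mon_fmul)
  qed (auto simp: I_def fmul_fadd_left fmul_fscale_left)
  moreover have "fadd x y \<in> I" if "x \<in> I" "y \<in> I" for x y using that by (simp add: I_def)
  moreover have "fzero \<in> I" by (simp add: I_def lext_def fa_simps)
  ultimately have "lideal FA I" unfolding lideal_def by (auto simp: I_def[symmetric]) (simp add: I_def)
  moreover have "NMgens lam \<subseteq> I"
  proof -
    have "Jrel \<subseteq> annih lam" unfolding Jrel_def using tideal_annih Rels_annih by (rule tgen_minimal)
    also have "\<dots> \<subseteq> I" by (auto simp: annih_def I_def)
    finally show ?thesis
      by (auto simp: NMgens_def I_def cst_def hwt_def)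
  qed
  ultimately have "NM lam \<subseteq> I" unfolding NM_lgen by (rule lgen_minimal)
  moreover have "serre_free (\<lambda>l. if l = [] then 1 else 0)" by (simp add: serre_free_def)
  ultimately show ?thesis using assms unfolding I_def vac_def by blast
qed

lemma vac_fadd: "x \<in> FA \<Longrightarrow> y \<in> FA \<Longrightarrow> vac lam (fadd x y) = vac lam x + vac lam y"
  and vac_fscale: "x \<in> FA \<Longrightarrow> vac lam (fscale c x) = c * vac lam x"
  and vac_fsub: "x \<in> FA \<Longrightarrow> y \<in> FA \<Longrightarrow> vac lam (fsub x y) = vac lam x - vac lam y"
  by (simp_all add: vac_def)

lemma vac_one: "vac lam (mon []) = 1"
  by (simp add: vac_def)

lemma rw_F: "rw lam \<phi> (map F js) l = \<phi> (js @ l)"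
  by (induction js arbitrary: \<phi>) simp_all

lemma vac_F: "js \<noteq> [] \<Longrightarrow> vac lam (mon (map F js)) = 0"
  by (simp add: vac_def rw_F)

section \<open>The quantum group as a ring type\<close>

lemma Jrel_NM: "Jrel \<subseteq> NM lam"
  using NMgens_NM by (auto simp: NMgens_def)

lemma one_notin_NM: "mon [] \<notin> NM lam"
  using vac_NM[of "mon []" lam] by (auto simp: vac_one)

lemma lideal_class_eq:
  assumes I: "lideal FA I" and x: "x \<in> FA" "y \<in> FA"
  shows "fsub x y \<in> I \<Longrightarrow> x \<in> I \<longleftrightarrow> y \<in> I"
    "fsub x y \<in> I \<Longrightarrow> fsub y x \<in> I"
    "fsub x x \<in> I"
    "fsub x y \<in> I \<Longrightarrow> fsub y z \<in> I \<Longrightarrow> fsub x z \<in> I"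
proof -
  have sub: "fsub a b \<in> I" if "a \<in> I" "b \<in> I" for a b
    using lideal_fsub[OF I] that by simp
  have 1: "x = fadd (fsub x y) y" "y = fsub x (fsub x y)" "fsub y x = fscale (- 1) (fsub x y)"
    "fsub x x = fzero" "fsub x z = fadd (fsub x y) (fsub y z)"
    by (auto simp: fa_simps)
  show "fsub x y \<in> I \<Longrightarrow> x \<in> I \<longleftrightarrow> y \<in> I"
    using 1(1,2) sub lidealD(3)[OF I] by metis
  show "fsub x y \<in> I \<Longrightarrow> fsub y x \<in> I"
    unfolding 1(3) using lideal_fscale[OF I] by simp
  show "fsub x x \<in> I" unfolding 1(4) by (rule lidealD(2)[OF I])
  show "fsub x y \<in> I \<Longrightarrow> fsub y z \<in> I \<Longrightarrow> fsub x z \<in> I"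
    unfolding 1(5) by (rule lidealD(3)[OF I])
qed

definition ucls :: "fa \<Rightarrow> fa set" where "ucls p = {q \<in> FA. fsub p q \<in> Jrel}"

typedef uinf = "ucls ` FA"
  using FA_fzero by blast

definition toU :: "fa \<Rightarrow> uinf" where "toU p = Abs_uinf (ucls p)"

definition ofU :: "uinf \<Rightarrow> fa" where "ofU u = (SOME p. p \<in> FA \<and> u = toU p)"

lemma toU_eq_iff:
  assumes "p \<in> FA" "q \<in> FA"
  shows "toU p = toU q \<longleftrightarrow> fsub p q \<in> Jrel"
proof -
  have "toU p = toU q \<longleftrightarrow> ucls p = ucls q"
    unfolding toU_def using assms by (simp add: Abs_uinf_inject)
  also have "\<dots> \<longleftrightarrow> fsub p q \<in> Jrel"
  proof
    assume "ucls p = ucls q"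
    moreover have "q \<in> ucls q" using assms lideal_class_eq(3)[OF lideal_Jrel] by (simp add: ucls_def)
    ultimately show "fsub p q \<in> Jrel" by (auto simp: ucls_def)
  next
    assume "fsub p q \<in> Jrel"
    then show "ucls p = ucls q" unfolding ucls_def
      using lideal_class_eq(2,4)[OF lideal_Jrel assms] lideal_class_eq(4)[OF lideal_Jrel assms(2,1)] by blast
  qed
  finally show ?thesis .
qed

lemma toU_eqI: "fsub q p \<in> Jrel \<Longrightarrow> p \<in> FA \<Longrightarrow> q \<in> FA \<Longrightarrow> toU p = toU q"
  using toU_eq_iff[of q p] by simp

lemma toU_cases [cases type: uinf]: obtains p where "p \<in> FA" "u = toU p"
  by (cases u) (auto simp: toU_def)

lemma ofU: "ofU u \<in> FA" "toU (ofU u) = u"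
proof -
  have "\<exists>p. p \<in> FA \<and> u = toU p" by (cases u) blast
  from someI_ex[OF this] show "ofU u \<in> FA" "toU (ofU u) = u" by (auto simp: ofU_def)
qed

lemma toU_Rels: "p \<in> FA \<Longrightarrow> q \<in> FA \<Longrightarrow> fsub p q \<in> Rels \<Longrightarrow> toU p = toU q"
  by (simp add: toU_eq_iff Rels_Jrel)

instantiation uinf :: ring_1
begin

definition "0 = toU fzero"
definition "1 = toU (mon [])"
definition "u + v = toU (fadd (ofU u) (ofU v))"
definition "u - v = toU (fsub (ofU u) (ofU v))"
definition "- u = toU (fscale (- 1) (ofU u))"
definition "u * v = toU (fmul (ofU u) (ofU v))"

lemma ofU_toU: "p \<in> FA \<Longrightarrow> fsub (ofU (toU p)) p \<in> Jrel"
  using ofU[of "toU p"] toU_eq_iff by auto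

lemma toU_fadd: "p \<in> FA \<Longrightarrow> q \<in> FA \<Longrightarrow> toU (fadd p q) = toU p + toU q"
proof -
  assume p: "p \<in> FA" "q \<in> FA"
  have "fsub (fadd (ofU (toU p)) (ofU (toU q))) (fadd p q)
      = fadd (fsub (ofU (toU p)) p) (fsub (ofU (toU q)) q)"
    by (auto simp: fa_simps)
  also have "\<dots> \<in> Jrel" using p by (intro lidealD(3)[OF lideal_Jrel] ofU_toU)
  finally show ?thesis unfolding plus_uinf_def by (rule toU_eqI) (use p ofU in auto)
qed

lemma toU_fsub: "p \<in> FA \<Longrightarrow> q \<in> FA \<Longrightarrow> toU (fsub p q) = toU p - toU q"
proof -
  assume p: "p \<in> FA" "q \<in> FA"
  have "fsub (fsub (ofU (toU p)) (ofU (toU q))) (fsub p q)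
      = fsub (fsub (ofU (toU p)) p) (fsub (ofU (toU q)) q)"
    by (auto simp: fa_simps)
  also have "\<dots> \<in> Jrel" using p by (intro Jrel_fsub ofU_toU)
  finally show ?thesis unfolding minus_uinf_def by (rule toU_eqI) (use p ofU in auto)
qed

lemma toU_uminus: "p \<in> FA \<Longrightarrow> toU (fscale (- 1) p) = - toU p"
proof -
  assume p: "p \<in> FA"
  have "fsub (fscale (- 1) (ofU (toU p))) (fscale (- 1) p) = fscale (- 1) (fsub (ofU (toU p)) p)"
    by (auto simp: fa_simps)
  also have "\<dots> \<in> Jrel" using p by (intro Jrel_fscale ofU_toU)
  finally show ?thesis unfolding uminus_uinf_def by (rule toU_eqI) (use p ofU in auto)
qed

lemma toU_fmul: "p \<in> FA \<Longrightarrow> q \<in> FA \<Longrightarrow> toU (fmul p q) = toU p * toU q"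
proof -
  assume p: "p \<in> FA" "q \<in> FA"
  let ?p = "ofU (toU p)" and ?q = "ofU (toU q)"
  have "fsub (fmul ?p ?q) (fmul p q) = fadd (fmul (fsub ?p p) ?q) (fmul p (fsub ?q q))"
    by (simp add: fmul_fsub_left fmul_fsub_right) (auto simp: fa_simps)
  also have "\<dots> \<in> Jrel"
  proof (rule lidealD(3)[OF lideal_Jrel])
    show "fmul (fsub ?p p) ?q \<in> Jrel"
      using tideal_Jrel ofU_toU[OF p(1)] ofU by (simp add: tideal_def)
    show "fmul p (fsub ?q q) \<in> Jrel"
      using lidealD(4)[OF lideal_Jrel p(1)] ofU_toU[OF p(2)] by blast
  qed
  finally show ?thesis unfolding times_uinf_def by (rule toU_eqI) (use p ofU in auto)
qed

lemmas toU_hom = toU_fadd toU_fsub toU_uminus toU_fmul zero_uinf_def one_uinf_def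

instance
proof
  fix a b c :: uinf
  obtain p where p: "p \<in> FA" "a = toU p" by (cases a)
  obtain q where q: "q \<in> FA" "b = toU q" by (cases b)
  obtain r where r: "r \<in> FA" "c = toU r" by (cases c)
  note h = p(2) q(2) r(2) toU_hom(1-4)[symmetric] zero_uinf_def one_uinf_def
  note FA = p(1) q(1) r(1)
  have e: "fadd (fadd p q) r = fadd p (fadd q r)" "fadd p q = fadd q p" "fadd fzero p = p"
    "fadd (fscale (- 1) p) p = fzero" "fsub p q = fadd p (fscale (- 1) q)"
    by (auto simp: fa_simps)
  show "a + b + c = a + (b + c)" using FA by (simp add: h e(1))
  show "a + b = b + a" using FA by (simp add: h e(2))
  show "0 + a = a" using FA by (simp add: h e(3))
  show "- a + a = 0" using FA by (simp add: h e(4))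
  show "a - b = a + - b" using FA by (simp add: h e(5))
  show "a * b * c = a * (b * c)" using FA by (simp add: h fmul_assoc)
  show "1 * a = a" "a * 1 = a" using FA by (simp_all add: h)
  show "(a + b) * c = a * c + b * c" using FA by (simp add: h fmul_fadd_left)
  show "a * (b + c) = a * b + a * c" using FA by (simp add: h fmul_fadd_right)
  \<comment> \<open>The class \<open>ring_1\<close> demands 0 \<noteq> 1, that is,
    \<open>mon []\<close> outside \<open>Jrel\<close>. The functionals provide this, with the weight
    0 as one possible choice.\<close>
  have "fsub (mon []) fzero = mon []" by (auto simp: fa_simps)
  then show "(0::uinf) \<noteq> 1"
    using one_notin_NM[of "\<lambda>_. 0"] Jrel_NM[of "\<lambda>_. 0"]
    by (auto simp: zero_uinf_def one_uinf_def toU_eq_iff[of "mon []" fzero] dest!: sym[of "toU fzero"])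
qed

end

definition usmul :: "qf \<Rightarrow> uinf \<Rightarrow> uinf" where
  "usmul c u = toU (fscale c (ofU u))"

lemma toU_fscale: "p \<in> FA \<Longrightarrow> toU (fscale c p) = usmul c (toU p)"
proof -
  assume p: "p \<in> FA"
  have "fsub (fscale c (ofU (toU p))) (fscale c p) = fscale c (fsub (ofU (toU p)) p)"
    by (auto simp: fa_simps right_diff_distrib)
  also have "\<dots> \<in> Jrel" using p by (intro Jrel_fscale ofU_toU)
  finally show ?thesis unfolding usmul_def by (rule toU_eqI) (use p ofU in auto)
qed

definition ugen :: "gen \<Rightarrow> uinf" where "ugen g = toU (mon [g])"

lemma toU_mon_Cons: "toU (mon (g # w)) = ugen g * toU (mon w)"
  by (simp add: ugen_def toU_fmul[symmetric])

interpretation U: quantum_gl usmul "\<lambda>i. ugen (E i)" "\<lambda>i. ugen (F i)" "\<lambda>i. ugen (K i)" "\<lambda>i. ugen (Kinv i)"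
proof (unfold_locales, goal_cases)
  case (1 c x y)
  obtain p where p: "p \<in> FA" "x = toU p" by (cases x)
  obtain q where q: "q \<in> FA" "y = toU q" by (cases y)
  have "fscale c (fadd p q) = fadd (fscale c p) (fscale c q)" by (auto simp: fa_simps distrib_left)
  then show ?case using p q by (simp flip: toU_fadd toU_fscale)
next
  case (2 c d x)
  obtain p where p: "p \<in> FA" "x = toU p" by (cases x)
  have "fscale (c + d) p = fadd (fscale c p) (fscale d p)" by (auto simp: fa_simps distrib_right)
  then show ?case using p by (simp flip: toU_fadd toU_fscale)
next
  case (3 c d x)
  obtain p where p: "p \<in> FA" "x = toU p" by (cases x)
  have "fscale c (fscale d p) = fscale (c * d) p" by (auto simp: fa_simps mult.assoc)
  then show ?case using p by (simp flip: toU_fscale)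
next
  case (4 x)
  obtain p where p: "p \<in> FA" "x = toU p" by (cases x)
  have "fscale 1 p = p" by (auto simp: fa_simps)
  then show ?case using p by (simp flip: toU_fscale)
next
  case (5 c x y)
  obtain p where p: "p \<in> FA" "x = toU p" by (cases x)
  obtain q where q: "q \<in> FA" "y = toU q" by (cases y)
  show ?case using p q by (simp add: fmul_fscale_left flip: toU_fmul toU_fscale)
next
  case (6 x c y)
  obtain p where p: "p \<in> FA" "x = toU p" by (cases x)
  obtain q where q: "q \<in> FA" "y = toU q" by (cases y)
  show ?case using p q by (simp add: fmul_fscale_right flip: toU_fmul toU_fscale)
next
  case (7 i j)
  show ?case unfolding ugen_def
    by (simp flip: toU_fmul) (rule toU_Rels, auto simp: Rels_def)
next
  case (8 i)
  show ?case unfolding ugen_def one_uinf_def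
    by (simp flip: toU_fmul) (rule toU_Rels, auto simp: Rels_def)
next
  case (9 i)
  show ?case unfolding ugen_def one_uinf_def
    by (simp flip: toU_fmul) (rule toU_Rels, auto simp: Rels_def)
next
  case (10 i j)
  show ?case unfolding ugen_def
    by (simp flip: toU_fmul toU_fscale) (rule toU_Rels, auto simp: Rels_def)
next
  case (11 i j)
  show ?case unfolding ugen_def
    by (simp flip: toU_fmul toU_fscale) (rule toU_Rels, auto simp: Rels_def)
next
  case (12 i j)
  then show ?case unfolding ugen_def
    by (simp flip: toU_fmul) (rule toU_Rels, auto simp: Rels_def)
next
  case (13 i j)
  then show ?case unfolding ugen_def
    by (simp flip: toU_fmul) (rule toU_Rels, auto simp: Rels_def)
next
  case (14 i j)
  show ?case unfolding ugen_def
    by (simp flip: toU_fmul toU_fscale toU_fsub) (rule toU_Rels, auto simp: Rels_def)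
next
  case (15 i j)
  have *: "fsub x fzero = x" for x by (auto simp: fa_simps)
  show ?case unfolding ugen_def zero_uinf_def using 15
    by (simp flip: toU_fmul toU_fscale toU_fsub toU_fadd) (rule toU_Rels, auto simp: Rels_def *)
next
  case (16 P x)
  obtain p where p: "p \<in> FA" "x = toU p" by (cases x)
  have "P (toU p)" using p(1)
  proof (induction p rule: FA_induct)
    case (mon w)
    show ?case
    proof (induction w)
      case Nil
      then show ?case using 16(1) by (simp add: one_uinf_def)
    next
      case (Cons g w)
      then show ?case using 16(4-7) by (cases g) (simp_all add: toU_mon_Cons)
    qed
  qed (simp_all add: toU_fadd toU_fscale 16)
  then show ?case by (simp add: p)
qed

lemma left_ideal_toU:
  assumes I: "lideal FA I"
  shows "U.left_ideal (toU ` I)"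
  unfolding U.left_ideal_def
proof (intro conjI ballI allI)
  show "0 \<in> toU ` I" unfolding zero_uinf_def using lidealD(2)[OF I] by (rule imageI)
next
  fix x y assume "x \<in> toU ` I" "y \<in> toU ` I"
  then obtain p q where pq: "p \<in> I" "q \<in> I" "x = toU p" "y = toU q" by blast
  then have "p \<in> FA" "q \<in> FA" using lidealD(1)[OF I] by auto
  then have "x + y = toU (fadd p q)" by (simp add: pq toU_fadd)
  then show "x + y \<in> toU ` I" using lidealD(3)[OF I pq(1,2)] by blast
next
  fix a x assume "x \<in> toU ` I"
  then obtain p where p: "p \<in> I" "x = toU p" by blast
  obtain q where q: "q \<in> FA" "a = toU q" by (cases a)
  have "p \<in> FA" using lidealD(1)[OF I] p by auto
  then have "a * x = toU (fmul q p)" using q by (simp add: p toU_fmul)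
  then show "a * x \<in> toU ` I" using lidealD(4)[OF I q(1) p(1)] by blast
qed

lemma toU_mem_iff:
  assumes I: "lideal FA I" "Jrel \<subseteq> I" and p: "p \<in> FA"
  shows "toU p \<in> toU ` I \<longleftrightarrow> p \<in> I"
proof
  assume "toU p \<in> toU ` I"
  then obtain q where q: "q \<in> I" "toU p = toU q" by blast
  then have "q \<in> FA" using lidealD(1)[OF I(1)] by auto
  then have "fsub p q \<in> I" using q p I(2) toU_eq_iff by blast
  then show "p \<in> I" using lideal_class_eq(1)[OF I(1) p \<open>q \<in> FA\<close>] q by blast
qed blast

section \<open>The left ideal presenting M(\<lambda>)/I(\<lambda>)\<close>

definition NIgens :: "(int \<Rightarrow> int) \<Rightarrow> fa set" where
  "NIgens lam = NMgens lam \<union> {mon (replicate (nat (lam i - lam (i + 1) + 1)) (F i)) | i. True}"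

definition NI :: "(int \<Rightarrow> int) \<Rightarrow> fa set" where "NI lam = lgen FA (NIgens lam)"

lemma NIgens_FA: "NIgens lam \<subseteq> FA"
  using NMgens_FA by (auto simp: NIgens_def)

lemma lideal_NI: "lideal FA (NI lam)"
  unfolding NI_def using lideal_FA NIgens_FA by (rule lideal_lgen)

lemma NIgens_NI: "NIgens lam \<subseteq> NI lam"
  unfolding NI_def using lideal_FA NIgens_FA by (rule lideal_lgen)

lemma NM_NI: "NM lam \<subseteq> NI lam"
  unfolding NM_lgen using lideal_NI by (rule lgen_minimal) (use NIgens_NI in \<open>auto simp: NIgens_def\<close>)

lemma toU_cst: "toU (cst c) = usmul c 1"
  by (simp add: cst_def toU_fscale one_uinf_def)

lemma singular_one: "U.singular (toU ` NM lam) 1 lam"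
  unfolding U.singular_def U.eigen_def
proof (intro conjI allI)
  fix i
  have "mon [E i] \<in> NM lam" using NMgens_NM by (auto simp: NMgens_def)
  then show "ugen (E i) * 1 \<in> toU ` NM lam" by (simp add: ugen_def)
  have "fsub (mon [K i]) (cst (vexp (lam i))) \<in> NM lam" using NMgens_NM by (auto simp: NMgens_def)
  moreover have "toU (fsub (mon [K i]) (cst (vexp (lam i)))) = ugen (K i) * 1 - usmul (vexp (lam i)) 1"
    by (simp add: ugen_def toU_fsub toU_cst)
  ultimately show "ugen (K i) * 1 - usmul (vexp (lam i)) 1 \<in> toU ` NM lam" by (metis imageI)
qed

lemma toU_F_power: "ugen (F i) ^ n = toU (mon (replicate n (F i)))"
  by (induction n) (simp_all add: toU_mon_Cons one_uinf_def)

lemma one_in_lideal: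
  assumes S: "lideal FA S" "NM lam \<subseteq> S" "\<not> S \<subseteq> NI lam"
  shows "mon [] \<in> S"
proof -
  have J: "Jrel \<subseteq> S" "Jrel \<subseteq> NI lam" using S(2) Jrel_NM NM_NI by blast+
  have "\<not> toU ` S \<subseteq> toU ` NI lam"
  proof
    assume *: "toU ` S \<subseteq> toU ` NI lam"
    obtain x where x: "x \<in> S" "x \<notin> NI lam" using S(3) by blast
    then have "x \<in> FA" using lidealD(1)[OF S(1)] by blast
    then show False using * x toU_mem_iff[OF lideal_NI J(2)] by blast
  qed
  moreover have "\<exists>n. ugen (F i) ^ n \<in> toU ` NI lam" for i
  proof -
    have "mon (replicate (nat (lam i - lam (i + 1) + 1)) (F i)) \<in> NI lam"
      using NIgens_NI[of lam] unfolding NIgens_def by blast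
    then show ?thesis unfolding toU_F_power by blast
  qed
  moreover have "toU ` NM lam \<subseteq> toU ` NI lam" "toU ` NM lam \<subseteq> toU ` S" using NM_NI S(2) by auto
  ultimately have "1 \<in> toU ` S"
    using left_ideal_toU[OF lideal_NM] singular_one left_ideal_toU[OF lideal_NI] left_ideal_toU[OF S(1)]
    by (intro U.one_in_left_ideal)
  then show ?thesis unfolding one_uinf_def using toU_mem_iff[OF S(1) J(1)] by simp
qed

lemma fw_toU: "U.fw js = toU (mon (map F js))"
  by (induction js) (simp_all add: one_uinf_def toU_mon_Cons)

text \<open>The powers of the F_i are singular modulo \<open>NM\<close>, dominance making their
  exponents d + 1 with d \<ge> 0, so \<open>singular_span_left_ideal\<close> describes
  \<open>NI\<close> as a span. An inclusion of \<open>NI\<close> can then be tested against linear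
  subspaces \<open>V\<close> that need not be left ideals.\<close>

lemma NI_span:
  assumes dom: "dominant lam" and V: "V \<subseteq> FA" "NM lam \<subseteq> V"
    and add: "\<And>x y. x \<in> V \<Longrightarrow> y \<in> V \<Longrightarrow> fadd x y \<in> V" and scale: "\<And>c x. x \<in> V \<Longrightarrow> fscale c x \<in> V"
    and gen: "\<And>js i. mon (map F js @ replicate (nat (lam i - lam (i + 1) + 1)) (F i)) \<in> V"
  shows "NI lam \<subseteq> V"
proof -
  define m where "m i = nat (lam i - lam (i + 1) + 1)" for i
  define Y where "Y = {ugen (F i) ^ m i | i. True}"
  define X where "X = {U.fw js * y | js y. y \<in> Y}"
  define T where "T = {x. \<exists>y\<in>U.lin X. x - y \<in> toU ` NM lam}"
  have N: "U.left_ideal (toU ` NM lam)" using lideal_NM by (rule left_ideal_toU)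
  have m: "m i = Suc (nat (lam i - lam (i + 1)))" "lam i - lam (i + 1) = int (nat (lam i - lam (i + 1)))" for i
  proof -
    have "0 \<le> lam i - lam (i + 1)" using dom by (simp add: dominant_def)
    then show "m i = Suc (nat (lam i - lam (i + 1)))" "lam i - lam (i + 1) = int (nat (lam i - lam (i + 1)))"
      by (simp_all only: m_def nat_add_distrib zero_le_one nat_one_as_int[symmetric] Suc_eq_plus1 nat_1 One_nat_def[symmetric] int_nat_eq if_True)
  qed
  have "\<exists>\<mu>. U.singular (toU ` NM lam) y \<mu>" if "y \<in> Y" for y
    using that U.f_power_singular[OF N singular_one m(2)] unfolding Y_def m(1) by auto
  from U.singular_span_left_ideal[OF N this] have T: "U.left_ideal T" unfolding T_def X_def by blast
  have XV: "\<exists>p\<in>V. y = toU p" if "y \<in> U.lin X" for y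
    using that
  proof (induction y rule: U.lin.induct)
    case lin_0
    have "fzero \<in> V" using V(2) lidealD(2)[OF lideal_NM] by blast
    then show ?case by (auto simp: zero_uinf_def)
  next
    case (lin_step x y c)
    from lin_step(1) obtain js i where "x = U.fw js * ugen (F i) ^ m i" unfolding X_def Y_def by blast
    also have "\<dots> = toU (mon (map F js @ replicate (m i) (F i)))"
      by (simp add: fw_toU toU_F_power flip: toU_fmul)
    finally have x: "x = toU (mon (map F js @ replicate (m i) (F i)))" (is "_ = toU ?x") .
    have xV: "?x \<in> V" using gen by (simp add: m_def)
    from lin_step.IH obtain p where p: "p \<in> V" "y = toU p" by blast
    have "usmul c x + y = toU (fadd (fscale c ?x) p)"
      using xV p V(1) by (auto simp: x toU_fadd toU_fscale)
    then show ?case using add[OF scale[OF xV] p(1)] by blast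
  qed
  have inT: "toU p \<in> T" if "p \<in> NM lam" for p
    unfolding T_def using that by (auto intro!: bexI[of _ 0] U.lin_0)
  have "lideal FA {p \<in> FA. toU p \<in> T}"
    unfolding lideal_def using U.left_idealD[OF T] inT[of fzero] lidealD(2)[OF lideal_NM]
    by (auto simp: toU_fadd toU_fmul)
  moreover have "NIgens lam \<subseteq> {p \<in> FA. toU p \<in> T}"
  proof -
    have "toU (mon (replicate (m i) (F i))) \<in> T" for i
    proof -
      have "U.fw [] * ugen (F i) ^ m i \<in> X" unfolding X_def Y_def by blast
      then have "toU (mon (replicate (m i) (F i))) \<in> U.lin X" by (intro U.lin_base) (simp add: toU_F_power)
      then show ?thesis unfolding T_def using U.left_idealD(1)[OF N] by force
    qed
    then show ?thesis using NIgens_FA[of lam] NMgens_NM[of lam] inT unfolding NIgens_def m_def by blast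
  qed
  ultimately have "NI lam \<subseteq> {p \<in> FA. toU p \<in> T}" unfolding NI_def by (rule lgen_minimal)
  moreover have "p \<in> V" if p: "p \<in> FA" "toU p \<in> T" for p
  proof -
    from p(2) obtain y where y: "y \<in> U.lin X" "toU p - y \<in> toU ` NM lam" unfolding T_def by blast
    from XV[OF y(1)] obtain q where q: "q \<in> V" "y = toU q" by blast
    then have qF: "q \<in> FA" using V by blast
    then have "toU (fsub p q) \<in> toU ` NM lam" using y q p by (simp add: toU_fsub)
    then have "fsub p q \<in> NM lam" using toU_mem_iff[OF lideal_NM Jrel_NM] p qF by simp
    moreover have "p = fadd (fsub p q) q" by (auto simp: fa_simps)
    ultimately show ?thesis using add[of "fsub p q" q] V(2) q(1) by auto
  qed
  ultimately show ?thesis by blast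
qed

lemma one_notin_NI:
  assumes "dominant lam"
  shows "mon [] \<notin> NI lam"
proof -
  have "NI lam \<subseteq> {p \<in> FA. vac lam p = 0}"
  proof (rule NI_span[OF assms])
    fix js i
    \<comment> \<open>Dominance makes the exponent positive, so the word is not empty and
      \<open>vac\<close> vanishes on it.\<close>
    have "vac lam (mon (map F (js @ replicate (nat (lam i - lam (i + 1) + 1)) i))) = 0"
      using assms by (intro vac_F) (auto simp: dominant_def not_le)
    then show "mon (map F js @ replicate (nat (lam i - lam (i + 1) + 1)) (F i)) \<in> {p \<in> FA. vac lam p = 0}"
      by simp
  qed (use vac_NM lidealD(1)[OF lideal_NM] in \<open>auto simp: vac_fadd vac_fscale\<close>)
  then show ?thesis by (auto simp: vac_one)
qed

section \<open>Modules presented as quotients of the free algebra\<close>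

text \<open>M is the quotient of the free algebra by \<open>I\<close> by way of
  \<open>\<pi>\<close>. Modules presented by the same left ideal are isomorphic, which reduces all
  comparisons of modules to comparisons of ideals.\<close>

definition presented :: "('a, 'c) umod_scheme \<Rightarrow> (fa \<Rightarrow> 'a) \<Rightarrow> fa set \<Rightarrow> bool" where
  "presented M \<pi> I \<longleftrightarrow> lideal FA I \<and> carrier M = \<pi> ` FA \<and> mzero M = \<pi> fzero
     \<and> (\<forall>x\<in>FA. \<forall>y\<in>FA. \<pi> x = \<pi> y \<longleftrightarrow> fsub x y \<in> I)
     \<and> (\<forall>x\<in>FA. \<forall>y\<in>FA. madd M (\<pi> x) (\<pi> y) = \<pi> (fadd x y))
     \<and> (\<forall>c. \<forall>x\<in>FA. mscale M c (\<pi> x) = \<pi> (fscale c x))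
     \<and> (\<forall>g. \<forall>x\<in>FA. mact M g (\<pi> x) = \<pi> (fmul (mon [g]) x))"

lemma presentedD:
  assumes "presented M \<pi> I"
  shows "lideal FA I" "carrier M = \<pi> ` FA" "mzero M = \<pi> fzero"
    "x \<in> FA \<Longrightarrow> y \<in> FA \<Longrightarrow> \<pi> x = \<pi> y \<longleftrightarrow> fsub x y \<in> I"
    "x \<in> FA \<Longrightarrow> y \<in> FA \<Longrightarrow> madd M (\<pi> x) (\<pi> y) = \<pi> (fadd x y)"
    "x \<in> FA \<Longrightarrow> mscale M c (\<pi> x) = \<pi> (fscale c x)"
    "x \<in> FA \<Longrightarrow> mact M g (\<pi> x) = \<pi> (fmul (mon [g]) x)"
  using assms by (simp_all add: presented_def)

lemma presented_isomorphic:
  assumes M: "presented M \<pi> I" and N: "presented N \<rho> I"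
  shows "umod_isomorphic M N"
proof -
  note M = presentedD[OF M] and N = presentedD[OF N]
  define s where "s a = (SOME x. x \<in> FA \<and> \<pi> x = a)" for a
  define h where "h a = \<rho> (s a)" for a
  have h: "h (\<pi> x) = \<rho> x" if "x \<in> FA" for x
  proof -
    have "s (\<pi> x) \<in> FA \<and> \<pi> (s (\<pi> x)) = \<pi> x" unfolding s_def by (rule someI[of _ x]) (simp add: that)
    then show ?thesis unfolding h_def using M(4) N(4) that by blast
  qed
  have "bij_betw h (carrier M) (carrier N)"
    unfolding bij_betw_def inj_on_def M(2) N(2) using M(4) N(4) h by (auto simp: image_image)
  then have "umod_iso M N h"
    unfolding umod_iso_def M(2) by (auto simp: M(5-7) N(5-7) h)
  then show ?thesis unfolding umod_isomorphic_def by blast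
qed

lemma fsub_fsub: "fsub (fadd x y) (fadd x' y') = fadd (fsub x x') (fsub y y')"
  "fsub (fscale c x) (fscale c y) = fscale c (fsub x y)" "fsub x fzero = x" "fsub x x = fzero"
  by (auto simp: fa_simps right_diff_distrib)

lemma submod_preimage:
  assumes M: "presented M \<pi> I" and S: "submod M S"
  shows "lideal FA {x \<in> FA. \<pi> x \<in> S}" "I \<subseteq> {x \<in> FA. \<pi> x \<in> S}" "S = \<pi> ` {x \<in> FA. \<pi> x \<in> S}"
proof -
  note M = presentedD[OF M]
  have S: "S \<subseteq> \<pi> ` FA" "\<pi> fzero \<in> S" "\<And>x y. x \<in> FA \<Longrightarrow> y \<in> FA \<Longrightarrow> \<pi> x \<in> S \<Longrightarrow> \<pi> y \<in> S \<Longrightarrow> \<pi> (fadd x y) \<in> S"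
    "\<And>c x. x \<in> FA \<Longrightarrow> \<pi> x \<in> S \<Longrightarrow> \<pi> (fscale c x) \<in> S"
    "\<And>g x. x \<in> FA \<Longrightarrow> \<pi> x \<in> S \<Longrightarrow> \<pi> (fmul (mon [g]) x) \<in> S"
    using S unfolding submod_def M(2,3) by (metis M(5-7))+
  show "S = \<pi> ` {x \<in> FA. \<pi> x \<in> S}" using S(1) by auto
  have "\<pi> x \<in> S" if "x \<in> I" for x
  proof -
    have "x \<in> FA" using that lidealD(1)[OF M(1)] by blast
    then have "\<pi> x = \<pi> fzero" using that M(4)[of x fzero] by (simp add: fsub_fsub)
    then show ?thesis using S(2) by simp
  qed
  then show "I \<subseteq> {x \<in> FA. \<pi> x \<in> S}" using lidealD(1)[OF M(1)] by blast
  have "\<pi> (fmul a x) \<in> S" if "a \<in> FA" "x \<in> FA" "\<pi> x \<in> S" for a x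
    using that
  proof (induction a rule: FA_induct)
    case (mon w)
    then show ?case
    proof (induction w)
      case (Cons g w)
      have "fmul (mon (g # w)) x = fmul (mon [g]) (fmul (mon w) x)"
        using Cons.prems by (simp flip: fmul_assoc)
      then show ?case using S(5)[of "fmul (mon w) x" g] Cons by simp
    qed simp
  qed (simp_all add: fmul_fadd_left fmul_fscale_left S)
  then show "lideal FA {x \<in> FA. \<pi> x \<in> S}" unfolding lideal_def using S by auto
qed

lemma lideal_submod:
  assumes M: "presented M \<pi> I" and J: "lideal FA J" "I \<subseteq> J"
  shows "submod M (\<pi> ` J)" "x \<in> FA \<Longrightarrow> \<pi> x \<in> \<pi> ` J \<longleftrightarrow> x \<in> J"
proof -
  note M = presentedD[OF M]
  have JF: "x \<in> FA" if "x \<in> J" for x using that lidealD(1)[OF J(1)] by blast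
  have sc: "fscale c x \<in> J" if "x \<in> J" for c x using lideal_fscale[OF J(1)] that by simp
  show "submod M (\<pi> ` J)" unfolding submod_def M(2,3)
    using lidealD[OF J(1)] sc JF by (auto simp: M(5-7) intro!: imageI)
  show "\<pi> x \<in> \<pi> ` J \<longleftrightarrow> x \<in> J" if "x \<in> FA"
  proof
    assume "\<pi> x \<in> \<pi> ` J"
    then obtain y where "y \<in> J" "\<pi> x = \<pi> y" by blast
    then show "x \<in> J" using M(4)[OF that JF] J(2) lideal_class_eq(1)[OF J(1) that JF] by blast
  qed blast
qed

lemma presented_qmod:
  assumes M: "presented M \<pi> I" and S: "submod M S"
  shows "presented (qmod M S) (\<lambda>x. mcos M S (\<pi> x)) {x \<in> FA. \<pi> x \<in> S}"
proof -
  define J where "J = {x \<in> FA. \<pi> x \<in> S}"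
  have J: "lideal FA J" "S = \<pi> ` J" "I \<subseteq> J" using submod_preimage[OF M S] unfolding J_def by blast+
  note M = presentedD[OF M]
  define c where "c x = mcos M S (\<pi> x)" for x
  have JF: "x \<in> FA" if "x \<in> J" for x using that by (simp add: J_def)
  have mem: "\<pi> y \<in> c x \<longleftrightarrow> fsub x y \<in> J" if xy: "x \<in> FA" "y \<in> FA" for x y
  proof
    assume "\<pi> y \<in> c x"
    then obtain z where z: "z \<in> J" "\<pi> y = madd M (\<pi> x) (\<pi> z)" unfolding c_def mcos_def J(2) by blast
    then have "\<pi> y = \<pi> (fadd x z)" using M(5) xy JF by simp
    then have "fsub y (fadd x z) \<in> J" using M(4) xy JF z J(3) by auto
    moreover have "fsub x y = fscale (- 1) (fadd (fsub y (fadd x z)) z)" by (auto simp: fa_simps)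
    ultimately show "fsub x y \<in> J" using lideal_fscale[OF J(1)] lidealD(3)[OF J(1)] z by simp
  next
    assume "fsub x y \<in> J"
    then have "fsub y x \<in> J" using lideal_class_eq(2)[OF J(1) xy] by blast
    moreover have "y = fadd x (fsub y x)" by (auto simp: fa_simps)
    then have "\<pi> y = madd M (\<pi> x) (\<pi> (fsub y x))" using M(5)[of x "fsub y x"] xy by simp
    ultimately show "\<pi> y \<in> c x" unfolding c_def mcos_def J(2) by blast
  qed
  have sub: "c x \<subseteq> \<pi> ` FA" if "x \<in> FA" for x
    unfolding c_def mcos_def J(2) using that JF M(5) by auto
  have eq: "c x = c y \<longleftrightarrow> fsub x y \<in> J" if xy: "x \<in> FA" "y \<in> FA" for x y
  proof
    assume "c x = c y"
    then show "fsub x y \<in> J" using mem[OF xy] mem[OF xy(2) xy(2)] lideal_class_eq(3)[OF J(1)] xy by auto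
  next
    assume *: "fsub x y \<in> J"
    have "\<pi> z \<in> c x \<longleftrightarrow> \<pi> z \<in> c y" if "z \<in> FA" for z
      using mem that xy * lideal_class_eq(2,4)[OF J(1) xy] lideal_class_eq(4)[OF J(1) xy(2,1)] by blast
    then show "c x = c y" using sub[OF xy(1)] sub[OF xy(2)] by blast
  qed
  \<comment> \<open>The representative chosen by \<open>mrep\<close> is known only modulo
    \<open>J\<close>, which suffices for the operations of the quotient.\<close>
  have rep: "\<exists>x'\<in>FA. mrep M S (c x) = \<pi> x' \<and> fsub x' x \<in> J" if x: "x \<in> FA" for x
  proof -
    have "\<exists>a. a \<in> carrier M \<and> c x = mcos M S a" using x unfolding M(2) c_def by blast
    from someI_ex[OF this] have "mrep M S (c x) \<in> \<pi> ` FA" "c x = mcos M S (mrep M S (c x))"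
      unfolding mrep_def M(2) by blast+
    then obtain x' where x': "x' \<in> FA" "mrep M S (c x) = \<pi> x'" "c x = c x'" unfolding c_def by force
    then have "fsub x' x \<in> J" using eq[OF x'(1) x] by simp
    then show ?thesis using x' by blast
  qed
  have "madd (qmod M S) (c x) (c y) = c (fadd x y)" if xy: "x \<in> FA" "y \<in> FA" for x y
  proof -
    obtain x' y' where *: "x' \<in> FA" "mrep M S (c x) = \<pi> x'" "fsub x' x \<in> J"
       "y' \<in> FA" "mrep M S (c y) = \<pi> y'" "fsub y' y \<in> J" using rep xy by meson
    then have "madd (qmod M S) (c x) (c y) = c (fadd x' y')" by (simp add: qmod_def M(5) c_def)
    also have "\<dots> = c (fadd x y)" using eq * xy lidealD(3)[OF J(1)] by (simp add: fsub_fsub)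
    finally show ?thesis .
  qed
  moreover have "mscale (qmod M S) a (c x) = c (fscale a x)" if x: "x \<in> FA" for a x
  proof -
    obtain x' where *: "x' \<in> FA" "mrep M S (c x) = \<pi> x'" "fsub x' x \<in> J" using rep x by meson
    then have "mscale (qmod M S) a (c x) = c (fscale a x')" by (simp add: qmod_def M(6) c_def)
    also have "\<dots> = c (fscale a x)" using eq * x lideal_fscale[OF J(1)] by (simp add: fsub_fsub)
    finally show ?thesis .
  qed
  moreover have "mact (qmod M S) g (c x) = c (fmul (mon [g]) x)" if x: "x \<in> FA" for g x
  proof -
    obtain x' where *: "x' \<in> FA" "mrep M S (c x) = \<pi> x'" "fsub x' x \<in> J" using rep x by meson
    then have "mact (qmod M S) g (c x) = c (fmul (mon [g]) x')" by (simp add: qmod_def M(7) c_def)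
    also have "\<dots> = c (fmul (mon [g]) x)" using eq * x lidealD(4)[OF J(1)] by (simp flip: fmul_fsub_right)
    finally show ?thesis .
  qed
  moreover have "carrier (qmod M S) = c ` FA" "mzero (qmod M S) = c fzero"
    unfolding qmod_def c_def by (auto simp: M(2,3))
  ultimately show ?thesis
    unfolding presented_def J_def[symmetric] c_def[symmetric] using J(1) eq by auto
qed

lemma presented_actw: "presented M \<pi> I \<Longrightarrow> x \<in> FA \<Longrightarrow> actw M w (\<pi> x) = \<pi> (fmul (mon w) x)"
proof (induction w)
  case (Cons g w)
  have "fmul (mon (g # w)) x = fmul (mon [g]) (fmul (mon w) x)"
    using Cons.prems by (simp flip: fmul_assoc)
  then show ?case using Cons presentedD(7)[OF Cons.prems(1), of "fmul (mon w) x" g] by (simp add: actw_def)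
qed (simp add: actw_def)

lemma presented_regA: "presented regA (\<lambda>x. x) {fzero}"
proof -
  have "fsub x y = fzero \<longleftrightarrow> x = y" for x y by (auto simp: fa_simps fun_eq_iff)
  moreover have "lideal FA {fzero}" unfolding lideal_def by (auto simp: fa_simps)
  ultimately show ?thesis by (auto simp: presented_def regA_def)
qed

section \<open>The irreducible quotient\<close>

lemma presented_Mmod: "presented (Mmod lam) (mcos regA (NM lam)) (NM lam)"
proof -
  have "submod regA (NM lam)"
    using lideal_submod(1)[OF presented_regA lideal_NM] lidealD(2)[OF lideal_NM] by simp
  from presented_qmod[OF presented_regA this]
  have "presented (Mmod lam) (mcos regA (NM lam)) {x \<in> FA. x \<in> NM lam}" by (simp add: Mmod_def)
  moreover have "{x \<in> FA. x \<in> NM lam} = NM lam" using lidealD(1)[OF lideal_NM] by auto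
  ultimately show ?thesis by simp
qed

lemma qfact_nz: "qfact m \<noteq> 0"
  unfolding qfact_def by (simp add: qint_nz)

text \<open>\<open>Iset\<close> is defined as a linear span of F-words only; \<open>NI_span\<close>
  shows that it nevertheless exhausts the image of the left ideal.\<close>

lemma Iset_eq:
  assumes dom: "dominant lam"
  shows "Iset lam = mcos regA (NM lam) ` NI lam"
proof -
  define \<pi> where "\<pi> = mcos regA (NM lam)"
  have P: "presented (Mmod lam) \<pi> (NM lam)" unfolding \<pi>_def by (rule presented_Mmod)
  note M = presentedD[OF P]
  define m where "m i = nat (lam i - lam (i + 1) + 1)" for i
  have one: "one_lam lam = \<pi> (mon [])" by (simp add: one_lam_def \<pi>_def)
  have Fdiv: "actw (Mmod lam) w (Fdiv (Mmod lam) i (m i) (one_lam lam))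
      = \<pi> (fscale (inverse (qfact (m i))) (mon (w @ replicate (m i) (F i))))" for w i
    unfolding Fdiv_def one by (simp add: presented_actw[OF P] M(6) fmul_fscale_right)
  define X where "X = {actw (Mmod lam) w (Fdiv (Mmod lam) i (m i) (one_lam lam)) | w i. \<forall>g\<in>set w. \<exists>j. g = F j}"
  define fam where "fam S \<longleftrightarrow> S \<subseteq> carrier (Mmod lam) \<and> mzero (Mmod lam) \<in> S \<and> (\<forall>x\<in>S. \<forall>y\<in>S. madd (Mmod lam) x y \<in> S)
                      \<and> (\<forall>c. \<forall>x\<in>S. mscale (Mmod lam) c x \<in> S) \<and> X \<subseteq> S" for S
  have Iset: "Iset lam = \<Inter>{S. fam S}" unfolding Iset_def mspan_def fam_def X_def m_def by blast
  have "fam (\<pi> ` NI lam)"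
  proof -
    have "submod (Mmod lam) (\<pi> ` NI lam)" by (rule lideal_submod[OF P lideal_NI NM_NI])
    moreover have "X \<subseteq> \<pi> ` NI lam"
    proof -
      have "fscale c (mon (w @ replicate (m i) (F i))) \<in> NI lam" for c w i
      proof -
        have "mon (replicate (m i) (F i)) \<in> NI lam" using NIgens_NI[of lam] unfolding NIgens_def m_def by blast
        then have "fmul (mon w) (mon (replicate (m i) (F i))) \<in> NI lam" by (intro lidealD(4)[OF lideal_NI]) auto
        then show ?thesis using lideal_fscale[OF lideal_NI] by simp
      qed
      then show ?thesis unfolding X_def Fdiv by blast
    qed
    ultimately show ?thesis unfolding fam_def submod_def by blast
  qed
  moreover have "\<pi> ` NI lam \<subseteq> S" if S: "fam S" for S
  proof -
    define V where "V = {x \<in> FA. \<pi> x \<in> S}"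
    have "NI lam \<subseteq> V"
    proof (rule NI_span[OF dom])
      show "V \<subseteq> FA" by (auto simp: V_def)
      show "NM lam \<subseteq> V"
      proof
        fix x assume x: "x \<in> NM lam"
        then have "x \<in> FA" using lidealD(1)[OF lideal_NM] by blast
        then have "\<pi> x = mzero (Mmod lam)" unfolding M(3) using x M(4)[of x fzero] by (simp add: fsub_fsub)
        then show "x \<in> V" using S \<open>x \<in> FA\<close> by (simp add: V_def fam_def)
      qed
      show "fadd x y \<in> V" if "x \<in> V" "y \<in> V" for x y
      proof -
        have "x \<in> FA" "y \<in> FA" "madd (Mmod lam) (\<pi> x) (\<pi> y) \<in> S" using that S by (simp_all add: V_def fam_def)
        then show ?thesis by (simp add: V_def M(5))
      qed
      show sc: "fscale c x \<in> V" if "x \<in> V" for c x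
      proof -
        have "x \<in> FA" "mscale (Mmod lam) c (\<pi> x) \<in> S" using that S by (simp_all add: V_def fam_def)
        then show ?thesis by (simp add: V_def M(6))
      qed
      show "mon (map F js @ replicate (nat (lam i - lam (i + 1) + 1)) (F i)) \<in> V" for js i
      proof -
        let ?w = "map F js @ replicate (m i) (F i)"
        have "actw (Mmod lam) (map F js) (Fdiv (Mmod lam) i (m i) (one_lam lam)) \<in> X"
          unfolding X_def by fastforce
        then have "fscale (inverse (qfact (m i))) (mon ?w) \<in> V" using S unfolding Fdiv V_def fam_def by auto
        \<comment> \<open>\<open>X\<close> contains divided powers and \<open>NI_span\<close> asks
          for plain ones; they differ by the nonzero scalar \<open>qfact\<close>.\<close>
        from sc[OF this, of "qfact (m i)"] have "fscale (qfact (m i)) (fscale (inverse (qfact (m i))) (mon ?w)) \<in> V" .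
        also have "fscale (qfact (m i)) (fscale (inverse (qfact (m i))) (mon ?w)) = mon ?w"
          using qfact_nz[of "m i"] by (auto simp: fa_simps)
        finally show ?thesis by (simp add: m_def)
      qed
    qed
    then show ?thesis by (auto simp: V_def)
  qed
  ultimately show ?thesis unfolding Iset \<pi>_def[symmetric] by blast
qed

text \<open>Every proper submodule lies in \<open>Iset\<close>, for otherwise
  \<open>one_in_lideal\<close> puts the generator into it. The equivalence gives the uniqueness
  needed to evaluate the description \<open>THE\<close> in \<open>Lmod\<close>.\<close>

lemma maxsub_Iset:
  assumes dom: "dominant lam"
  shows "maxsub (Mmod lam) S \<longleftrightarrow> S = Iset lam"
proof -
  define \<pi> where "\<pi> = mcos regA (NM lam)"
  have P: "presented (Mmod lam) \<pi> (NM lam)" unfolding \<pi>_def by (rule presented_Mmod)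
  have I: "Iset lam = \<pi> ` NI lam" using Iset_eq[OF dom] by (simp add: \<pi>_def)
  have sub: "submod (Mmod lam) (Iset lam)" unfolding I by (rule lideal_submod[OF P lideal_NI NM_NI])
  have proper: "Iset lam \<noteq> carrier (Mmod lam)"
    using lideal_submod(2)[OF P lideal_NI NM_NI, of "mon []"] one_notin_NI[OF dom]
    unfolding I presentedD(2)[OF P] by auto
  have max: "T \<subseteq> Iset lam" if T: "submod (Mmod lam) T" "T \<noteq> carrier (Mmod lam)" for T
  proof (rule ccontr)
    define T' where "T' = {x \<in> FA. \<pi> x \<in> T}"
    have T': "lideal FA T'" "NM lam \<subseteq> T'" "T = \<pi> ` T'"
      using submod_preimage[OF P T(1)] unfolding T'_def by blast+
    assume "\<not> T \<subseteq> Iset lam"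
    then have "\<not> T' \<subseteq> NI lam" using T'(3) I by blast
    then have "mon [] \<in> T'" using one_in_lideal[OF T'(1,2)] by blast
    then have "a \<in> T'" if "a \<in> FA" for a using lidealD(4)[OF T'(1) that] that by fastforce
    then have "FA \<subseteq> T'" by blast
    then have "T' = FA" using lidealD(1)[OF T'(1)] by blast
    then show False using T(2) T'(3) presentedD(2)[OF P] by simp
  qed
  show ?thesis
  proof
    assume "maxsub (Mmod lam) S"
    then show "S = Iset lam" using max sub proper unfolding maxsub_def by blast
  next
    assume "S = Iset lam"
    then show "maxsub (Mmod lam) S" using max sub proper unfolding maxsub_def by blast
  qed
qed

lemma presented_MImod:
  assumes dom: "dominant lam"
  shows "\<exists>\<pi>. presented (MImod lam) \<pi> (NI lam)"
proof -
  define \<pi> where "\<pi> = mcos regA (NM lam)"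
  have P: "presented (Mmod lam) \<pi> (NM lam)" unfolding \<pi>_def by (rule presented_Mmod)
  have I: "Iset lam = \<pi> ` NI lam" using Iset_eq[OF dom] by (simp add: \<pi>_def)
  have "submod (Mmod lam) (Iset lam)" unfolding I by (rule lideal_submod[OF P lideal_NI NM_NI])
  from presented_qmod[OF P this]
  have "presented (MImod lam) (\<lambda>x. mcos (Mmod lam) (Iset lam) (\<pi> x)) {x \<in> FA. \<pi> x \<in> Iset lam}"
    by (simp add: MImod_def)
  moreover have "{x \<in> FA. \<pi> x \<in> Iset lam} = NI lam"
    using lideal_submod(2)[OF P lideal_NI NM_NI] lidealD(1)[OF lideal_NI] unfolding I by blast
  ultimately show ?thesis by auto
qed

lemma Lmod_eq_MImod: "dominant lam \<Longrightarrow> Lmod lam = MImod lam"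
proof -
  assume "dominant lam"
  then have "maxsub (Mmod lam) = (\<lambda>S. S = Iset lam)" by (intro ext maxsub_Iset)
  then show ?thesis unfolding Lmod_def MImod_def by simp
qed

section \<open>The direct limit\<close>

definition Pgens :: "(int \<Rightarrow> int) \<Rightarrow> nat \<Rightarrow> fa set" where
  "Pgens lam n = (Jrel \<inter> An n)
      \<union> {mon [E i] | i. - int n \<le> i \<and> i < int n}
      \<union> {mon (replicate (nat (lam i - lam (i + 1) + 1)) (F i)) | i. - int n \<le> i \<and> i < int n}
      \<union> {fsub (mon [K j]) (cst (vexp (lam j))) | j. - int n \<le> j \<and> j \<le> int n}"

lemma Pn_lgen: "Pn lam n = lgen (An n) (Pgens lam n)"
  by (simp add: Pn_def Pgens_def)

lemma An_fsub: "p \<in> An n \<Longrightarrow> q \<in> An n \<Longrightarrow> fsub p q \<in> An n"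
  by (simp add: fsub_eq An_fadd An_fscale)

lemma Pgens_An: "Pgens lam n \<subseteq> An n"
  by (auto simp: Pgens_def An_mon in_rng_def intro!: An_fsub An_cst)

lemma lideal_Pn: "lideal (An n) (Pn lam n)"
  unfolding Pn_lgen using lideal_An Pgens_An by (rule lideal_lgen)

lemma Pgens_Pn: "Pgens lam n \<subseteq> Pn lam n"
  unfolding Pn_lgen using lideal_An Pgens_An by (rule lideal_lgen)

lemma lideal_restrict:
  assumes "lideal R I" "lideal A A" "A \<subseteq> R"
  shows "lideal A (I \<inter> A)"
  using assms unfolding lideal_def by blast

lemma Pn_mono:
  assumes "n \<le> k"
  shows "Pn lam n \<subseteq> Pn lam k"
proof -
  have "Pgens lam n \<subseteq> Pgens lam k"
    using assms An_mono[OF assms] unfolding Pgens_def by (intro Un_mono) auto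
  \<comment> \<open>Intersecting with \<open>An n\<close> turns an ideal of the larger algebra into
    one of \<open>An n\<close>, the only kind that \<open>lgen (An n)\<close> can be compared
    with.\<close>
  then have "Pgens lam n \<subseteq> Pn lam k \<inter> An n" using Pgens_Pn Pgens_An by blast
  moreover have "lideal (An n) (Pn lam k \<inter> An n)"
    using lideal_Pn lideal_An An_mono[OF assms] by (rule lideal_restrict)
  ultimately have "Pn lam n \<subseteq> Pn lam k \<inter> An n" unfolding Pn_lgen[of lam n] by (intro lgen_minimal)
  then show ?thesis by blast
qed

lemma Pn_NI: "Pn lam n \<subseteq> NI lam"
proof -
  have "Pgens lam n \<subseteq> NI lam"
    using NIgens_NI[of lam] unfolding Pgens_def NIgens_def NMgens_def by blast
  then have "Pgens lam n \<subseteq> NI lam \<inter> An n" using Pgens_An by blast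
  moreover have "lideal (An n) (NI lam \<inter> An n)"
    using lideal_NI lideal_An An_FA by (intro lideal_restrict) auto
  ultimately have "Pn lam n \<subseteq> NI lam \<inter> An n" unfolding Pn_lgen by (intro lgen_minimal)
  then show ?thesis by blast
qed

text \<open>An element of the free algebra involves finitely many generators, so any multiplier
  belongs to some \<open>An n\<close>. The increasing union of the \<open>Pn\<close> is therefore a
  left ideal of the whole free algebra.\<close>

lemma NI_Pn:
  assumes "x \<in> NI lam"
  shows "\<exists>n. x \<in> Pn lam n"
proof -
  define I where "I = (\<Union>n. Pn lam n)"
  have "lideal FA I" unfolding lideal_def
  proof (intro conjI ballI)
    show "I \<subseteq> FA" using lidealD(1)[OF lideal_Pn] An_FA unfolding I_def by blast
    show "fzero \<in> I" using lidealD(2)[OF lideal_Pn] unfolding I_def by blast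
  next
    fix x y assume "x \<in> I" "y \<in> I"
    then obtain n m where "x \<in> Pn lam n" "y \<in> Pn lam m" unfolding I_def by blast
    then have "x \<in> Pn lam (max n m)" "y \<in> Pn lam (max n m)"
      using Pn_mono[of n "max n m"] Pn_mono[of m "max n m"] by auto
    then show "fadd x y \<in> I" using lidealD(3)[OF lideal_Pn] unfolding I_def by blast
  next
    fix a x assume "a \<in> FA" "x \<in> I"
    then obtain n m where "a \<in> An n" "x \<in> Pn lam m" unfolding I_def using FA_An by blast
    then have "a \<in> An (max n m)" "x \<in> Pn lam (max n m)"
      using An_mono[of n "max n m"] Pn_mono[of m "max n m"] by auto
    then show "fmul a x \<in> I" using lidealD(4)[OF lideal_Pn] unfolding I_def by blast
  qed
  moreover have "NIgens lam \<subseteq> I"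
  proof
    fix x assume "x \<in> NIgens lam"
    then have "\<exists>n. x \<in> Pgens lam n"
      unfolding NIgens_def NMgens_def
    proof (elim UnE CollectE exE conjE)
      assume "x \<in> Jrel"
      then show ?thesis using FA_An[OF Jrel_FA] unfolding Pgens_def by blast
    next
      fix i assume x: "x = mon [E i]"
      \<comment> \<open>The level |i| + 1 rather than |i|, because E_i requires i < n
        strictly.\<close>
      have "- int (nat (\<bar>i\<bar> + 1)) \<le> i" "i < int (nat (\<bar>i\<bar> + 1))" by auto
      then show ?thesis unfolding Pgens_def x by blast
    next
      fix i assume x: "x = fsub (mon [K i]) (cst (vexp (lam i)))"
      have "- int (nat (\<bar>i\<bar> + 1)) \<le> i" "i \<le> int (nat (\<bar>i\<bar> + 1))" by auto
      then show ?thesis unfolding Pgens_def x by blast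
    next
      fix i assume x: "x = mon (replicate (nat (lam i - lam (i + 1) + 1)) (F i))"
      have "- int (nat (\<bar>i\<bar> + 1)) \<le> i" "i < int (nat (\<bar>i\<bar> + 1))" by auto
      then show ?thesis unfolding Pgens_def x by blast
    qed
    then show "x \<in> I" using Pgens_Pn unfolding I_def by blast
  qed
  ultimately have "NI lam \<subseteq> I" unfolding NI_def by (rule lgen_minimal)
  then show ?thesis using assms unfolding I_def by blast
qed

lemma cosn_eq_iff:
  assumes "x \<in> FA" "y \<in> FA"
  shows "cosn lam n x = cosn lam n y \<longleftrightarrow> fsub x y \<in> Pn lam n"
proof -
  have P: "fzero \<in> Pn lam n" "\<And>x y. x \<in> Pn lam n \<Longrightarrow> y \<in> Pn lam n \<Longrightarrow> fadd x y \<in> Pn lam n"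
    using lidealD[OF lideal_Pn] by blast+
  have Ps: "fscale c x \<in> Pn lam n" if "x \<in> Pn lam n" for c x
    using lideal_fscale[OF lideal_Pn _ An_cst that] An_FA by auto
  show ?thesis
  proof
    assume eq: "cosn lam n x = cosn lam n y"
    have "fadd x fzero \<in> cosn lam n x" using P(1) unfolding cosn_def by blast
    then have "fadd x fzero \<in> cosn lam n y" by (simp only: eq)
    then obtain p where p: "fadd x fzero = fadd y p" "p \<in> Pn lam n" unfolding cosn_def by blast
    have "fsub x y = p"
    proof
      fix w show "fsub x y w = p w" using fun_cong[OF p(1), of w] by (simp add: fa_simps)
    qed
    then show "fsub x y \<in> Pn lam n" using p by simp
  next
    assume *: "fsub x y \<in> Pn lam n"
    have "fadd x p = fadd y (fadd (fsub x y) p)" "fadd y p = fadd x (fadd (fscale (- 1) (fsub x y)) p)" for p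
      by (auto simp: fa_simps)
    then show "cosn lam n x = cosn lam n y"
      unfolding cosn_def using P(2)[OF *] P(2)[OF Ps[OF *, of "- 1"]] by blast
  qed
qed

lemma repn_cosn:
  assumes "x \<in> An n"
  shows "repn lam n (cosn lam n x) \<in> An n" "fsub (repn lam n (cosn lam n x)) x \<in> Pn lam n"
proof -
  have "\<exists>y. y \<in> An n \<and> cosn lam n x = cosn lam n y" using assms by blast
  from someI_ex[OF this] have *: "repn lam n (cosn lam n x) \<in> An n"
    "cosn lam n x = cosn lam n (repn lam n (cosn lam n x))" by (simp_all add: repn_def)
  then show "repn lam n (cosn lam n x) \<in> An n" "fsub (repn lam n (cosn lam n x)) x \<in> Pn lam n"
    using cosn_eq_iff[OF An_FA An_FA] assms by metis+
qed

lemma phi_cosn: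
  assumes "x \<in> An n" "n \<le> k"
  shows "phi lam n k (cosn lam n x) = cosn lam k x"
  unfolding phi_def using repn_cosn[OF assms(1)] Pn_mono[OF assms(2)] assms(1)
  by (subst cosn_eq_iff) (auto intro: An_FA)

section \<open>Classes in the direct limit and their representatives\<close>

definition dlc :: "(int \<Rightarrow> int) \<Rightarrow> nat \<Rightarrow> fa \<Rightarrow> (nat \<times> fa set) set" where
  "dlc lam n x = dlcls lam (n, cosn lam n x)"

lemma DLpairs_iff: "p \<in> DLpairs lam \<longleftrightarrow> (\<exists>n x. p = (n, cosn lam n x) \<and> 1 \<le> n \<and> x \<in> An n)"
  by (auto simp: DLpairs_def Lcar_def)

lemma dl_eq_iff:
  assumes "x \<in> An n" "y \<in> An m"
  shows "dl_eq lam (n, cosn lam n x) (m, cosn lam m y) \<longleftrightarrow> fsub x y \<in> NI lam"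
proof
  assume "dl_eq lam (n, cosn lam n x) (m, cosn lam m y)"
  then obtain k where "n \<le> k" "m \<le> k" "cosn lam k x = cosn lam k y"
    using assms phi_cosn unfolding dl_eq_def by auto
  then show "fsub x y \<in> NI lam" using cosn_eq_iff[OF An_FA An_FA] assms Pn_NI by blast
next
  assume "fsub x y \<in> NI lam"
  then obtain k0 where k0: "fsub x y \<in> Pn lam k0" using NI_Pn by blast
  \<comment> \<open>A common level for both representatives, high enough that their difference
    already lies in \<open>Pn\<close>.\<close>
  define k where "k = max k0 (max n m)"
  have "fsub x y \<in> Pn lam k" using k0 Pn_mono[of k0 k] by (auto simp: k_def)
  then have "cosn lam k x = cosn lam k y" using cosn_eq_iff[OF An_FA An_FA] assms by blast
  moreover have "n \<le> k" "m \<le> k" by (auto simp: k_def)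
  ultimately show "dl_eq lam (n, cosn lam n x) (m, cosn lam m y)"
    unfolding dl_eq_def using phi_cosn assms by (intro exI[of _ k]) simp
qed

lemma dlc_eq_iff:
  assumes "1 \<le> n" "x \<in> An n" "1 \<le> m" "y \<in> An m"
  shows "dlc lam n x = dlc lam m y \<longleftrightarrow> fsub x y \<in> NI lam"
proof -
  have F: "x \<in> FA" "y \<in> FA" using assms An_FA by auto
  have mem: "(k, cosn lam k z) \<in> dlc lam n' u \<longleftrightarrow> fsub u z \<in> NI lam"
    if "1 \<le> k" "z \<in> An k" "u \<in> An n'" for k z n' u
    using that dl_eq_iff[OF that(3,2)] by (auto simp: dlc_def dlcls_def DLpairs_iff)
  have sub: "p \<in> dlc lam n' u \<Longrightarrow> \<exists>k z. p = (k, cosn lam k z) \<and> 1 \<le> k \<and> z \<in> An k" for p n' u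
    by (auto simp: dlc_def dlcls_def DLpairs_iff)
  show ?thesis
  proof
    assume eq: "dlc lam n x = dlc lam m y"
    have "(m, cosn lam m y) \<in> dlc lam m y"
      using mem[OF assms(3,4,4)] lideal_class_eq(3)[OF lideal_NI F(2) F(2)] by blast
    then show "fsub x y \<in> NI lam" using mem[OF assms(3,4,2)] eq by blast
  next
    assume *: "fsub x y \<in> NI lam"
    then have yx: "fsub y x \<in> NI lam" using lideal_class_eq(2)[OF lideal_NI F] by blast
    have "(k, cosn lam k z) \<in> dlc lam n x \<longleftrightarrow> (k, cosn lam k z) \<in> dlc lam m y" if "1 \<le> k" "z \<in> An k" for k z
      using mem[OF that assms(2)] mem[OF that assms(4)] lideal_class_eq(4)[OF lideal_NI F] * yx
        lideal_class_eq(4)[OF lideal_NI F(2,1)] by blast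
    then show "dlc lam n x = dlc lam m y" using sub by (intro set_eqI) metis
  qed
qed

text \<open>The choice made by \<open>dlrep\<close> may live on another level; what is kept is
  congruence modulo \<open>NI\<close>.\<close>

lemma dlrep_dlc:
  assumes "1 \<le> n" "x \<in> An n"
  obtains n' x' where "dlrep lam (dlc lam n x) = (n', cosn lam n' x')" "1 \<le> n'" "x' \<in> An n'" "fsub x' x \<in> NI lam"
proof -
  have "\<exists>p. p \<in> DLpairs lam \<and> dlc lam n x = dlcls lam p"
    using assms by (auto simp: DLpairs_iff dlc_def)
  from someI_ex[OF this] have "dlrep lam (dlc lam n x) \<in> DLpairs lam"
    "dlc lam n x = dlcls lam (dlrep lam (dlc lam n x))" by (simp_all add: dlrep_def)
  then obtain n' x' where *: "dlrep lam (dlc lam n x) = (n', cosn lam n' x')" "1 \<le> n'" "x' \<in> An n'"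
    "dlc lam n x = dlc lam n' x'" unfolding DLpairs_iff by (metis dlc_def)
  then have "fsub x' x \<in> NI lam" using dlc_eq_iff assms by metis
  then show ?thesis using * that by blast
qed

lemma presented_DLmod: "\<exists>\<pi>. presented (DLmod lam) \<pi> (NI lam)"
proof -
  \<comment> \<open>An arbitrary level containing \<open>x\<close> is fixed to make
    \<open>\<pi>\<close> a function; by \<open>dlc_eq_iff\<close> the class does not depend on
    it.\<close>
  define lv where "lv x = (SOME n. 1 \<le> n \<and> x \<in> An n)" for x
  have lv: "1 \<le> lv x" "x \<in> An (lv x)" if "x \<in> FA" for x
    using someI_ex[of "\<lambda>n. 1 \<le> n \<and> x \<in> An n"] FA_An[OF that] unfolding lv_def by blast+
  define \<pi> where "\<pi> x = dlc lam (lv x) x" for x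
  have \<pi>: "dlc lam n x = \<pi> x" if "1 \<le> n" "x \<in> An n" for n x
    unfolding \<pi>_def using that lv An_FA[OF that(2)] lideal_class_eq(3)[OF lideal_NI] by (subst dlc_eq_iff) auto
  have eq: "\<pi> x = \<pi> y \<longleftrightarrow> fsub x y \<in> NI lam" if "x \<in> FA" "y \<in> FA" for x y
    unfolding \<pi>_def using that lv by (intro dlc_eq_iff)
  have rep: "\<exists>n x'. dlrep lam (\<pi> x) = (n, cosn lam n x') \<and> 1 \<le> n \<and> x' \<in> An n \<and> fsub x' x \<in> NI lam"
    if "x \<in> FA" for x
    using dlrep_dlc[OF lv[OF that], of lam] unfolding \<pi>_def by metis
  have rc: "repn lam k (cosn lam k x') \<in> An k" "fsub (repn lam k (cosn lam k x')) x \<in> NI lam"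
    if "x' \<in> An k" "fsub x' x \<in> NI lam" "x \<in> FA" for k x' x
    using repn_cosn[OF that(1)] Pn_NI lideal_class_eq(4)[OF lideal_NI] that An_FA
    by blast+
  have add: "madd (DLmod lam) (\<pi> x) (\<pi> y) = \<pi> (fadd x y)" if xy: "x \<in> FA" "y \<in> FA" for x y
  proof -
    obtain n x' where x': "dlrep lam (\<pi> x) = (n, cosn lam n x')" "1 \<le> n" "x' \<in> An n" "fsub x' x \<in> NI lam"
      using rep[OF xy(1)] by blast
    obtain m y' where y': "dlrep lam (\<pi> y) = (m, cosn lam m y')" "1 \<le> m" "y' \<in> An m" "fsub y' y \<in> NI lam"
      using rep[OF xy(2)] by blast
    define k where "k = max n m"
    have k: "n \<le> k" "m \<le> k" "1 \<le> k" using x'(2) by (auto simp: k_def)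
    define x'' where "x'' = repn lam k (cosn lam k x')"
    define y'' where "y'' = repn lam k (cosn lam k y')"
    have xk: "x' \<in> An k" "y' \<in> An k" using x' y' An_mono k by blast+
    have 2: "x'' \<in> An k" "fsub x'' x \<in> NI lam" "y'' \<in> An k" "fsub y'' y \<in> NI lam"
      unfolding x''_def y''_def using rc xk x' y' xy by blast+
    have "madd (DLmod lam) (\<pi> x) (\<pi> y) = dlc lam k (fadd x'' y'')"
      unfolding DLmod_def umod.simps x' y' Let_def split k_def[symmetric]
      by (simp add: phi_cosn[OF x'(3) k(1)] phi_cosn[OF y'(3) k(2)] x''_def y''_def dlc_def)
    also have "\<dots> = \<pi> (fadd x'' y'')" using 2 k by (intro \<pi> An_fadd)
    also have "\<dots> = \<pi> (fadd x y)" using eq 2 xy An_FA lidealD(3)[OF lideal_NI] by (simp add: fsub_fsub)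
    finally show ?thesis .
  qed
  have scale: "mscale (DLmod lam) a (\<pi> x) = \<pi> (fscale a x)" if x: "x \<in> FA" for a x
  proof -
    obtain n x' where x': "dlrep lam (\<pi> x) = (n, cosn lam n x')" "1 \<le> n" "x' \<in> An n" "fsub x' x \<in> NI lam"
      using rep[OF x] by blast
    define x'' where "x'' = repn lam n (cosn lam n x')"
    have 2: "x'' \<in> An n" "fsub x'' x \<in> NI lam" unfolding x''_def using rc x' x by blast+
    have "mscale (DLmod lam) a (\<pi> x) = dlc lam n (fscale a x'')"
      unfolding DLmod_def umod.simps x' Let_def split by (simp add: x''_def dlc_def)
    also have "\<dots> = \<pi> (fscale a x'')" using 2 x' by (intro \<pi> An_fscale)
    also have "\<dots> = \<pi> (fscale a x)" using eq 2 x An_FA lideal_fscale[OF lideal_NI] by (simp add: fsub_fsub)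
    finally show ?thesis .
  qed
  have act: "mact (DLmod lam) g (\<pi> x) = \<pi> (fmul (mon [g]) x)" if x: "x \<in> FA" for g x
  proof -
    obtain n x' where x': "dlrep lam (\<pi> x) = (n, cosn lam n x')" "1 \<le> n" "x' \<in> An n" "fsub x' x \<in> NI lam"
      using rep[OF x] by blast
    \<comment> \<open>Including \<open>gidx g\<close> puts \<open>mon [g]\<close> into
      \<open>An k\<close>, so that the product stays at level \<open>k\<close>.\<close>
    define k where "k = max n (max 1 (gidx g))"
    have k: "n \<le> k" "gidx g \<le> k" "1 \<le> k" by (auto simp: k_def)
    define x'' where "x'' = repn lam k (cosn lam k x')"
    have "x' \<in> An k" using x' An_mono k by blast
    then have 2: "x'' \<in> An k" "fsub x'' x \<in> NI lam" unfolding x''_def using rc x' x by blast+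
    have "mact (DLmod lam) g (\<pi> x) = dlc lam k (fmul (mon [g]) x'')"
      unfolding DLmod_def umod.simps x' Let_def split k_def[symmetric]
      by (simp add: phi_cosn[OF x'(3) k(1)] x''_def dlc_def)
    also have "\<dots> = \<pi> (fmul (mon [g]) x'')"
      using 2 k in_rng_gidx by (intro \<pi> An_fmul) (auto simp: An_mon)
    also have "\<dots> = \<pi> (fmul (mon [g]) x)" using eq 2 x An_FA lidealD(4)[OF lideal_NI] by (simp flip: fmul_fsub_right)
    finally show ?thesis .
  qed
  have "carrier (DLmod lam) = \<pi> ` FA"
  proof -
    have "carrier (DLmod lam) = {dlc lam n x | n x. 1 \<le> n \<and> x \<in> An n}"
    proof -
      have "carrier (DLmod lam) = {dlcls lam p | p. p \<in> DLpairs lam}" by (auto simp: DLmod_def)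
      then show ?thesis unfolding DLpairs_iff dlc_def by blast
    qed
    also have "\<dots> = \<pi> ` FA"
      using \<pi> An_FA lv unfolding \<pi>_def by blast
    finally show ?thesis .
  qed
  moreover have "mzero (DLmod lam) = \<pi> fzero"
    using \<pi>[of 1 fzero] by (simp add: DLmod_def dlc_def An_fzero)
  ultimately have "presented (DLmod lam) \<pi> (NI lam)"
    using lideal_NI eq add scale act by (simp add: presented_def)
  then show ?thesis by blast
qed

theorem theorem9p7:
  fixes lam :: "int \<Rightarrow> int"
  assumes "dominant lam"
  shows "umod_isomorphic (Lmod lam) (DLmod lam) \<and> umod_isomorphic (DLmod lam) (MImod lam)"
proof -
  obtain \<pi> where \<pi>: "presented (MImod lam) \<pi> (NI lam)" using presented_MImod[OF assms] by blast
  obtain \<rho> where \<rho>: "presented (DLmod lam) \<rho> (NI lam)" using presented_DLmod by blast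
  show ?thesis unfolding Lmod_eq_MImod[OF assms]
    using presented_isomorphic[OF \<pi> \<rho>] presented_isomorphic[OF \<rho> \<pi>] by (rule conjI)
qed

end
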